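(* For every $p$ with $1 \leq p < 4/3$ there exists a constant $A_p > 0$, depending only on $p$ (and in particular not on the choice of $\Sigma$, $\phi$ or of the conical surface), such that the following holds. Let $\Sigma \subset \mathbb{R}^2$ be the smooth boundary of a compact convex set $\Omega\subset\mathbb{R}^2$ having $0$ as an interior point, let $\phi$ be the associated homogeneous function of degree $1$ (with $\phi = 1$ exactly on $\Sigma$), and let $w$ be the associated weight. Then, with $q = p'/3$, $$\bigg(\int_{\mathbb{R}^2} |\widehat{F}(\xi, \phi(\xi))|^q\, w(\xi)^{1/3} \,\frac{d \xi}{\phi(\xi)}\bigg)^{1/q} \leq A_p \|F\|_{L^p(\mathbb{R}^3)} \qquad \text{for all } F \in \mathcal{S}(\mathbb{R}^3).$$
   Context: $\mathcal{S}(\mathbb{R}^n)$ is the Schwartz space; $\widehat F(\zeta)=\int_{\mathbb{R}^3} e^{-2\pi i x\cdot\zeta}F(x)\,dx$; $p'$ is the conjugate exponent, $1/p+1/p'=1$. When $q=\infty$ the left-hand side is the $L^\infty$ norm with respect to the measure $w(\xi)^{1/3}\,d\xi/\phi(\xi)$. Given $\Sigma=\partial\Omega$ with $\Omega\subset\mathbb{R}^2$ compact and convex, with smooth boundary and $0$ in its interior, $\phi:\mathbb{R}^2\to[0,\infty)$ denotes the function that is smooth away from the origin, homogeneous of degree 1 (i.e. $\phi(t\xi)=t\phi(\xi)$ for $t\ge 0$) and satisfies $\phi(\xi)=1$ if and only if $\xi\in\Sigma$. The conical surface generated by $\Sigma$ is $\{(\xi,\phi(\xi)):\xi\in\mathbb{R}^2\}\subset\mathbb{R}^3$.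 The weight is, for $\xi\ne0$, $$w(\xi)=\big\langle M(\phi)(\xi)\nabla\phi(\xi),\nabla\phi(\xi)\big\rangle\,\phi(\xi),$$ where $\langle\cdot,\cdot\rangle$ is the Euclidean inner product and $M(\phi)$ is the adjugate of the Hessian matrix of $\phi$, $$M(\phi)=\begin{pmatrix}\partial_{\xi_2}^2\phi & -\partial_{\xi_1}\partial_{\xi_2}\phi\\ -\partial_{\xi_1}\partial_{\xi_2}\phi & \partial_{\xi_1}^2\phi\end{pmatrix}.$$ The function $w$ is non-negative, smooth away from the origin and homogeneous of degree $0$; on $\Sigma$ one has $w=\kappa|\nabla\phi|^3$, where $\kappa\ge0$ is the curvature of $\Sigma$. *)

theory Defs
  imports "HOL-Probability.Essential_Supremum"
begin

text \<open>
  \<open>iterated_partial [v\<^sub>1, ..., v\<^sub>k] f\<close> is the iterated derivative of \<open>f\<close> in the directions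
  \<open>v\<^sub>k, ..., v\<^sub>1\<close>; when the directions are basis vectors it is a mixed partial derivative. Smoothness
  on an open set means that all iterated partials are (Frechet) differentiable at every point
  of the set; they are then continuous there, so this is the usual notion of \<open>C\<^sup>\<infinity>\<close>.
\<close>

fun iterated_partial ::
  "'a list \<Rightarrow> ('a::euclidean_space \<Rightarrow> 'b::real_normed_vector) \<Rightarrow> 'a \<Rightarrow> 'b" where
  "iterated_partial [] f = f"
| "iterated_partial (v # vs) f = (\<lambda>x. frechet_derivative (iterated_partial vs f) (at x) v)"

definition smooth_on ::
  "'a set \<Rightarrow> ('a::euclidean_space \<Rightarrow> 'b::real_normed_vector) \<Rightarrow> bool" where
  "smooth_on U f \<longleftrightarrow> (\<forall>vs\<in>lists Basis. \<forall>x\<in>U. iterated_partial vs f differentiable (at x))"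

definition schwartz :: "('a::euclidean_space \<Rightarrow> complex) \<Rightarrow> bool" where
  "schwartz F \<longleftrightarrow> smooth_on UNIV F \<and>
     (\<forall>k::nat. \<forall>vs\<in>lists Basis. \<exists>C. \<forall>x. norm x ^ k * norm (iterated_partial vs F x) \<le> C)"

definition fourier :: "('a::euclidean_space \<Rightarrow> complex) \<Rightarrow> 'a \<Rightarrow> complex" where
  "fourier F \<zeta> = (LINT x|lborel. exp (- 2 * of_real pi * \<i> * of_real (x \<bullet> \<zeta>)) * F x)"

text \<open>
  The conjugate exponent is the solution of \<open>1/p + 1/p' = 1\<close> in \<open>[1,\<infinity>]\<close>; in particular
  the conjugate exponent of \<open>1\<close> is \<open>inverse 0 = \<infinity>\<close>.
\<close>

definition conjugate_exponent :: "ennreal \<Rightarrow> ennreal" where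
  "conjugate_exponent p = inverse (1 - inverse p)"

lemma conjugate_exponent_one: "conjugate_exponent 1 = \<infinity>"
  by (simp add: conjugate_exponent_def)

lemma conjugate_exponent_real:
  assumes "1 < p"
  shows "conjugate_exponent (ennreal p) = ennreal (p / (p - 1))"
proof -
  have "1 - inverse (ennreal p) = ennreal (1 - inverse p)"
    using assms by (simp add: inverse_ennreal ennreal_minus flip: ennreal_1)
  moreover have "0 < 1 - inverse p"
    using assms by (simp add: field_simps)
  moreover have "inverse (1 - inverse p) = p / (p - 1)"
    using assms by (simp add: field_simps)
  ultimately show ?thesis
    by (simp add: conjugate_exponent_def inverse_ennreal)
qed

text \<open>
  The \<open>L\<^sup>q\<close> norm, for \<open>0 < q \<le> \<infinity>\<close>, with values in \<open>[0,\<infinity>]\<close>. Since \<open>enn2real \<infinity> = 0\<close>, an infinite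
  integral has to be treated separately.
\<close>

definition Lq_norm :: "ennreal \<Rightarrow> 'a measure \<Rightarrow> ('a \<Rightarrow> 'b::real_normed_vector) \<Rightarrow> ennreal" where
  "Lq_norm q M f =
    (if q = \<infinity> then esssup M (\<lambda>x. ennreal (norm (f x)))
     else let I = (\<integral>\<^sup>+x. ennreal (norm (f x) powr enn2real q) \<partial>M)
          in if I = \<infinity> then \<infinity> else ennreal (enn2real I powr (1 / enn2real q)))"

text \<open>
  A smooth embedded hypersurface: locally the zero set of a smooth function without
  critical points.
\<close>

definition smooth_hypersurface :: "'a::euclidean_space set \<Rightarrow> bool" where
  "smooth_hypersurface S \<longleftrightarrow>
     (\<forall>x\<in>S. \<exists>U (f :: 'a \<Rightarrow> real). open U \<and> x \<in> U \<and> smooth_on U f \<and>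
        S \<inter> U = {y\<in>U. f y = 0} \<and> (\<forall>y\<in>U. frechet_derivative f (at y) \<noteq> (\<lambda>v. 0)))"

definition admissible_domain :: "(real^2) set \<Rightarrow> bool" where
  "admissible_domain \<Omega> \<longleftrightarrow>
     compact \<Omega> \<and> convex \<Omega> \<and> 0 \<in> interior \<Omega> \<and> smooth_hypersurface (frontier \<Omega>)"

definition homogeneous_generator :: "(real^2) set \<Rightarrow> (real^2 \<Rightarrow> real) \<Rightarrow> bool" where
  "homogeneous_generator \<Sigma> \<phi> \<longleftrightarrow>
     (\<forall>\<xi>. 0 \<le> \<phi> \<xi>) \<and> smooth_on (- {0}) \<phi> \<and>
     (\<forall>t\<ge>0. \<forall>\<xi>. \<phi> (t *\<^sub>R \<xi>) = t * \<phi> \<xi>) \<and> (\<forall>\<xi>. \<phi> \<xi> = 1 \<longleftrightarrow> \<xi> \<in> \<Sigma>)"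

definition grad :: "(real^'n \<Rightarrow> real) \<Rightarrow> real^'n \<Rightarrow> real^'n" where
  "grad f \<xi> = (\<chi> i. iterated_partial [axis i 1] f \<xi>)"

definition hessian :: "(real^'n \<Rightarrow> real) \<Rightarrow> real^'n \<Rightarrow> real^'n^'n" where
  "hessian f \<xi> = (\<chi> i j. iterated_partial [axis i 1, axis j 1] f \<xi>)"

definition adjugate2 :: "real^2^2 \<Rightarrow> real^2^2" where
  "adjugate2 H = vector [vector [H $ 2 $ 2, - H $ 1 $ 2], vector [- H $ 2 $ 1, H $ 1 $ 1]]"

definition weight :: "(real^2 \<Rightarrow> real) \<Rightarrow> real^2 \<Rightarrow> real" where
  "weight \<phi> \<xi> = ((adjugate2 (hessian \<phi> \<xi>) *v grad \<phi> \<xi>) \<bullet> grad \<phi> \<xi>) * \<phi> \<xi>"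

text \<open>
  The measure \<open>w(\<xi>)\<^bsup>1/3\<^esup> d\<xi> / \<phi>(\<xi>)\<close>. The value of the density at the origin is irrelevant,
  and \<open>w\<close> is non-negative elsewhere.
\<close>

definition cone_measure :: "(real^2 \<Rightarrow> real) \<Rightarrow> (real^2) measure" where
  "cone_measure \<phi> = density lborel (\<lambda>\<xi>. ennreal (weight \<phi> \<xi> powr (1/3) / \<phi> \<xi>))"

definition cone_point :: "(real^2 \<Rightarrow> real) \<Rightarrow> real^2 \<Rightarrow> real^3" where
  "cone_point \<phi> \<xi> = vector [\<xi> $ 1, \<xi> $ 2, \<phi> \<xi>]"

end

theory Submission
  imports Defs "HOL-Probability.Probability"
begin

text \<open>
  The cone is sliced by the lines \<open>\<xi>\<^sub>2 = const\<close> rather than by the level sets of \<open>\<phi>\<close>. For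
  \<open>\<xi> = l (x, \<plusminus>1)\<close> with \<open>l > 0\<close> put \<open>k(x) = \<phi>(x, \<plusminus>1)\<close>, a smooth convex function on the line. Then
  \<open>\<phi> = l k\<close> and \<open>w = k'' k\<^sup>3\<close>, so that \<open>w\<^bsup>1/3\<^esup> d\<xi> / \<phi> = k''\<^bsup>1/3\<^esup> dx dl\<close>: the slices are dilates of
  one convex graph carrying its affine arclength, and no case distinction on the shape of
  \<open>\<Sigma>\<close> is needed. For a convex graph the restriction estimate is uniform (Fefferman, Zygmund,
  Sjoelin): the square of the dual operator is a Fourier transform in the plane, and
  Hausdorff--Young reduces its \<open>L\<^bsup>p'/2\<^esup>\<close> bound to a Hardy--Littlewood--Sobolev inequality in the slope
  \<open>k'\<close>. The dilation costs a factor \<open>l\<^bsup>-2/3\<^esup>\<close>, which is exactly what Pitt's inequality in the slicing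
  variable absorbs.
\<close>

section \<open>Integrals of powers and substitution\<close>

text \<open>Write P for the conjugate exponent of p, so that p < 4/3 means P > 4. Three steps turn
  on this bound: Hausdorff--Young is applied to the square of the dual operator at the exponent P/2,
  which has to exceed 2; the Jacobian then enters to the power -2/(P - 2), which is locally
  integrable only if 2/(P - 2) < 1; and Pitt's inequality is an interpolation whose parameter is
  below 1 only for P > 4. The obstacle to uniformity is that the curvature may vanish, even on whole
  arcs. Then neither the slope k' nor the map (x, x') |-> (x + x', k x + k x') is injective, and
  nothing bounds k'' from below. Changes of variables are therefore used as one-sided statements: an
  image measure is dominated by a multiple of Lebesgue measure. Plancherel, Hausdorff--Young and
  Hardy--Littlewood--Sobolev are stated for maps with this property, so that only the multiple (1 or
  2) enters the constants, never the curve. Norms are replaced throughout by finite upper bounds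
  \<open>U\<close>, \<open>V\<close>, which keeps real powers meaningful; zero and infinite norms
  are split off at the end.\<close>

lemma nn_integral_powr_interpolation:
  fixes f g :: "'a \<Rightarrow> real"
  assumes [measurable]: "f \<in> borel_measurable M" "g \<in> borel_measurable M"
    and f0: "\<And>x. 0 \<le> f x" and g0: "\<And>x. 0 \<le> g x"
    and U: "(\<integral>\<^sup>+x. ennreal (f x) \<partial>M) \<le> ennreal U" and V: "(\<integral>\<^sup>+x. ennreal (g x) \<partial>M) \<le> ennreal V"
    and \<theta>: "0 < \<theta>" "\<theta> < 1" and UV: "0 \<le> U" "0 \<le> V"
  shows "(\<integral>\<^sup>+x. ennreal (f x powr \<theta> * g x powr (1 - \<theta>)) \<partial>M) \<le> ennreal (U powr \<theta> * V powr (1 - \<theta>))"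
proof (cases "U = 0 \<or> V = 0")
  case True
  then have "(\<integral>\<^sup>+x. ennreal (f x) \<partial>M) = 0 \<or> (\<integral>\<^sup>+x. ennreal (g x) \<partial>M) = 0"
    using U V by (auto simp: ennreal_0)
  then have "AE x in M. f x = 0 \<or> g x = 0"
  proof
    assume "(\<integral>\<^sup>+x. ennreal (f x) \<partial>M) = 0"
    then have "AE x in M. ennreal (f x) = 0"
      by (subst (asm) nn_integral_0_iff_AE) auto
    then show ?thesis by (rule eventually_mono) (use f0 in auto)
  next
    assume "(\<integral>\<^sup>+x. ennreal (g x) \<partial>M) = 0"
    then have "AE x in M. ennreal (g x) = 0"
      by (subst (asm) nn_integral_0_iff_AE) auto
    then show ?thesis by (rule eventually_mono) (use g0 in auto)
  qed
  then have "AE x in M. ennreal (f x powr \<theta> * g x powr (1 - \<theta>)) = 0"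
    by (rule eventually_mono) auto
  then have "(\<integral>\<^sup>+x. ennreal (f x powr \<theta> * g x powr (1 - \<theta>)) \<partial>M) = 0"
    by (subst nn_integral_0_iff_AE) auto
  then show ?thesis by simp
next
  case False
  then have pos: "0 < U" "0 < V" using UV by auto
  \<comment> \<open>Hoelder's inequality by normalisation: Young's inequality is applied to
    \<open>f x / U\<close> and \<open>g x / V\<close>, so that the two terms on the right integrate
    to at most \<theta> and \<open>1 - \<theta>\<close>, which add up to 1.\<close>
  let ?c = "U powr \<theta> * V powr (1 - \<theta>)"
  have pw: "f x powr \<theta> * g x powr (1 - \<theta>) \<le> ?c * (\<theta> / U * f x + (1 - \<theta>) / V * g x)" for x
  proof -
    have "(f x / U) powr \<theta> * (g x / V) powr (1 - \<theta>) \<le> \<theta> * (f x / U) + (1 - \<theta>) * (g x / V)"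
    proof (cases "f x = 0 \<or> g x = 0")
      case False
      then have "0 < f x / U" "0 < g x / V"
        using f0[of x] g0[of x] pos by auto
      then show ?thesis
        using Youngs_inequality_0[of \<theta> "1 - \<theta>" "f x / U" "g x / V"] \<theta> by simp
    qed (use \<theta> pos f0[of x] g0[of x] in auto)
    then have "?c * ((f x / U) powr \<theta> * (g x / V) powr (1 - \<theta>)) \<le> ?c * (\<theta> * (f x / U) + (1 - \<theta>) * (g x / V))"
      by (intro mult_left_mono) auto
    moreover have "?c * ((f x / U) powr \<theta> * (g x / V) powr (1 - \<theta>)) = f x powr \<theta> * g x powr (1 - \<theta>)"
      using pos f0 g0 by (simp add: powr_divide)
    ultimately show ?thesis by simp
  qed
  have "(\<integral>\<^sup>+x. ennreal (f x powr \<theta> * g x powr (1 - \<theta>)) \<partial>M)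
      \<le> (\<integral>\<^sup>+x. ennreal (?c * \<theta> / U) * ennreal (f x) + ennreal (?c * (1 - \<theta>) / V) * ennreal (g x) \<partial>M)"
  proof (intro nn_integral_mono)
    fix x
    have "ennreal (?c * \<theta> / U) * ennreal (f x) + ennreal (?c * (1 - \<theta>) / V) * ennreal (g x)
        = ennreal (?c * (\<theta> / U * f x + (1 - \<theta>) / V * g x))"
      using \<theta> pos f0[of x] g0[of x]
      by (simp add: distrib_left mult.assoc ennreal_plus[symmetric] ennreal_mult[symmetric] del: ennreal_plus)
    then show "ennreal (f x powr \<theta> * g x powr (1 - \<theta>))
        \<le> ennreal (?c * \<theta> / U) * ennreal (f x) + ennreal (?c * (1 - \<theta>) / V) * ennreal (g x)"
      using ennreal_leI[OF pw] by simp
  qed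
  also have "\<dots> = ennreal (?c * \<theta> / U) * (\<integral>\<^sup>+x. ennreal (f x) \<partial>M) + ennreal (?c * (1 - \<theta>) / V) * (\<integral>\<^sup>+x. ennreal (g x) \<partial>M)"
    by (subst nn_integral_add) (auto simp: nn_integral_cmult)
  also have "\<dots> \<le> ennreal (?c * \<theta> / U) * ennreal U + ennreal (?c * (1 - \<theta>) / V) * ennreal V"
    by (intro add_mono mult_left_mono U V) auto
  also have "\<dots> = ennreal ?c"
    using pos \<theta> by (simp add: field_simps flip: ennreal_mult ennreal_plus)
  finally show ?thesis .
qed

lemma nn_integral_powr_near_0:
  fixes a c :: real
  assumes "-1 < a" "0 \<le> c"
  shows "(\<integral>\<^sup>+x. ennreal (x powr a) * indicator {0<..c} x \<partial>lborel) = ennreal (c powr (a + 1) / (a + 1))"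
proof -
  have "((\<lambda>x. x powr a) has_integral (c powr (a + 1) / (a + 1))) {0<..c}"
    by (rule has_integral_spike_set_eq[THEN iffD1, OF _ _ has_integral_powr_from_0[OF assms]];
        rule negligible_subset[OF negligible_sing[of 0]]; force)
  from nn_integral_has_integral_lebesgue'[OF _ this] show ?thesis
    by simp
qed

lemma nn_integral_powr_near_infinity:
  fixes a c :: real
  assumes "a < -1" "0 < c"
  shows "(\<integral>\<^sup>+x. ennreal (x powr a) * indicator {c<..} x \<partial>lborel) = ennreal (c powr (a + 1) / (- a - 1))"
proof -
  have "((\<lambda>x. x powr a) has_integral (-(c powr (a + 1)) / (a + 1))) {c<..}"
    by (rule has_integral_spike_set_eq[THEN iffD1, OF _ _ has_integral_powr_to_inf[OF assms]];
        rule negligible_subset[OF negligible_sing[of c]]; force)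
  also have "- (c powr (a + 1)) / (a + 1) = c powr (a + 1) / (- a - 1)"
    using assms by (simp add: divide_simps) (simp add: algebra_simps)
  finally have "((\<lambda>x. x powr a) has_integral (c powr (a + 1) / (- a - 1))) {c<..}" .
  from nn_integral_has_integral_lebesgue'[OF _ this] show ?thesis
    by simp
qed

lemma nn_integral_abs:
  fixes f :: "real \<Rightarrow> ennreal"
  assumes [measurable]: "f \<in> borel_measurable borel"
  shows "(\<integral>\<^sup>+x. f \<bar>x\<bar> \<partial>lborel) = 2 * (\<integral>\<^sup>+x. f x * indicator {0<..} x \<partial>lborel)"
proof -
  have "(\<integral>\<^sup>+x. f \<bar>x\<bar> \<partial>lborel) = (\<integral>\<^sup>+x. f \<bar>x\<bar> * indicator {0<..} x + f \<bar>x\<bar> * indicator {..<0} x \<partial>lborel)"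
    using AE_lborel_singleton[of "0::real"] by (intro nn_integral_cong_AE) (auto split: split_indicator)
  also have "\<dots> = (\<integral>\<^sup>+x. f \<bar>x\<bar> * indicator {0<..} x \<partial>lborel) + (\<integral>\<^sup>+x. f \<bar>x\<bar> * indicator {..<0} x \<partial>lborel)"
    by (intro nn_integral_add) auto
  also have "(\<integral>\<^sup>+x. f \<bar>x\<bar> * indicator {..<0} x \<partial>lborel) = (\<integral>\<^sup>+x. f \<bar>x\<bar> * indicator {0<..} x \<partial>lborel)"
    by (subst nn_integral_real_affine[where c="-1" and t=0]) (auto intro!: nn_integral_cong split: split_indicator)
  also have "(\<integral>\<^sup>+x. f \<bar>x\<bar> * indicator {0<..} x \<partial>lborel) = (\<integral>\<^sup>+x. f x * indicator {0<..} x \<partial>lborel)"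
    by (auto intro!: nn_integral_cong split: split_indicator)
  finally show ?thesis by (simp add: mult_2)
qed

lemma nn_integral_le_exhaustion:
  assumes [measurable]: "f \<in> borel_measurable M" "\<And>n::nat. A n \<in> sets M"
    and A: "incseq A" "(\<Union>n. A n) = space M"
    and le: "\<And>n. (\<integral>\<^sup>+x. f x * indicator (A n) x \<partial>M) \<le> c"
  shows "(\<integral>\<^sup>+x. f x \<partial>M) \<le> c"
proof -
  have "(\<integral>\<^sup>+x. f x \<partial>M) = (\<integral>\<^sup>+x. (SUP n. f x * indicator (A n) x) \<partial>M)"
  proof (rule nn_integral_cong)
    fix x assume "x \<in> space M"
    then obtain n where "x \<in> A n" using A(2) by blast
    then have "f x \<le> f x * indicator (A n) x" by simp
    then show "f x = (SUP n. f x * indicator (A n) x)"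
      by (intro antisym SUP_least) (auto intro: SUP_upper2[of n] split: split_indicator)
  qed
  also have "\<dots> = (SUP n. \<integral>\<^sup>+x. f x * indicator (A n) x \<partial>M)"
    using A(1) by (intro nn_integral_monotone_convergence_SUP) (auto simp: incseq_def le_fun_def split: split_indicator)
  also have "\<dots> \<le> c" by (intro SUP_least le)
  finally show ?thesis .
qed

text \<open>Substitution is exact on each interval \<open>{c..c + n + 1}\<close> and yields the
  integral of \<open>G\<close> over a part of the line; the intervals then exhaust the half-line.
  Stretches where \<open>g\<close> is constant cost nothing, since the factor \<open>g'\<close>
  vanishes there.\<close>

lemma nn_integral_substitution_le:
  fixes g g' :: "real \<Rightarrow> real" and G :: "real \<Rightarrow> ennreal"
  assumes [measurable]: "G \<in> borel_measurable borel"
    and g: "\<And>x. (g has_real_derivative g' x) (at x)"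
    and cont: "continuous_on UNIV g'"
    and pos: "\<And>x. c \<le> x \<Longrightarrow> 0 \<le> g' x"
  shows "(\<integral>\<^sup>+x. G (g x) * ennreal (g' x) * indicator {c..} x \<partial>lborel) \<le> (\<integral>\<^sup>+x. G x \<partial>lborel)"
proof -
  have [measurable]: "g \<in> borel_measurable borel" "g' \<in> borel_measurable borel"
    using cont g by (auto intro!: borel_measurable_continuous_onI continuous_at_imp_continuous_on DERIV_isCont)
  have step: "(\<integral>\<^sup>+x. G (g x) * ennreal (g' x) * indicator {c..c + real (Suc n)} x \<partial>lborel) \<le> (\<integral>\<^sup>+x. G x \<partial>lborel)" for n
  proof -
    have "(\<integral>\<^sup>+x. G (g x) * ennreal (g' x) * indicator {c..c + real (Suc n)} x \<partial>lborel) =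
        (\<integral>\<^sup>+x. G x * indicator {g c..g (c + real (Suc n))} x \<partial>lborel)"
      using continuous_on_subset[OF cont] pos g
      by (intro nn_integral_substitution_aux[symmetric]) auto
    also have "\<dots> \<le> (\<integral>\<^sup>+x. G x \<partial>lborel)"
      by (intro nn_integral_mono) (auto split: split_indicator)
    finally show ?thesis .
  qed
  show ?thesis
  proof (rule nn_integral_le_exhaustion)
    show "(\<Union>n. {..c + real (Suc n)}) = space lborel"
    proof (intro equalityI subsetI UN_I)
      fix x :: real
      show "x \<in> {..c + real (Suc (nat \<lceil>x - c\<rceil>))}" by simp linarith
    qed simp_all
    show "(\<integral>\<^sup>+x. G (g x) * ennreal (g' x) * indicator {c..} x * indicator {..c + real (Suc n)} x \<partial>lborel) \<le> (\<integral>\<^sup>+x. G x \<partial>lborel)" for n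
      by (rule order.trans[OF eq_refl step[of n]]) (intro nn_integral_cong, simp split: split_indicator)
  qed (auto simp: incseq_def)
qed

lemma nn_integral_substitution_UNIV_le:
  fixes g g' :: "real \<Rightarrow> real" and G :: "real \<Rightarrow> ennreal"
  assumes [measurable]: "G \<in> borel_measurable borel"
    and g: "\<And>x. (g has_real_derivative g' x) (at x)"
    and cont: "continuous_on UNIV g'"
    and pos: "\<And>x. 0 \<le> g' x"
  shows "(\<integral>\<^sup>+x. G (g x) * ennreal (g' x) \<partial>lborel) \<le> (\<integral>\<^sup>+x. G x \<partial>lborel)"
proof -
  have [measurable]: "g \<in> borel_measurable borel" "g' \<in> borel_measurable borel"
    using cont g by (auto intro!: borel_measurable_continuous_onI continuous_at_imp_continuous_on DERIV_isCont)
  show ?thesis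
  proof (rule nn_integral_le_exhaustion)
    show "(\<Union>n. {- real n..}) = space lborel"
    proof (intro equalityI subsetI UN_I)
      fix x :: real
      show "x \<in> {- real (nat \<lceil>- x\<rceil>)..}" by simp linarith
    qed simp_all
    show "(\<integral>\<^sup>+x. G (g x) * ennreal (g' x) * indicator {- real n..} x \<partial>lborel) \<le> (\<integral>\<^sup>+x. G x \<partial>lborel)" for n
      by (intro nn_integral_substitution_le g cont pos) auto
  qed (auto simp: incseq_def)
qed

section \<open>Fourier integrals\<close>

definition echar :: "real \<Rightarrow> complex" where
  "echar t = cis (- (2 * pi * t))"

lemma norm_echar [simp]: "norm (echar t) = 1"
  by (simp add: echar_def)

lemma echar_add: "echar (s + t) = echar s * echar t"
  by (simp add: echar_def cis_mult algebra_simps)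

lemma cnj_echar: "cnj (echar t) = echar (- t)"
  by (simp add: echar_def cis_cnj)

lemma echar_diff: "echar (s - t) = echar s * cnj (echar t)"
  using echar_add[of s "- t"] by (simp add: cnj_echar)

lemma echar_eq_exp: "echar t = exp (- 2 * of_real pi * \<i> * of_real t)"
  by (simp add: echar_def cis_conv_exp mult_ac)

lemma borel_measurable_echar [measurable]: "echar \<in> borel_measurable borel"
  unfolding echar_def by (intro borel_measurable_continuous_onI continuous_intros)

lemma borel_measurable_cnj [measurable]: "cnj \<in> borel_measurable borel"
  by (intro borel_measurable_continuous_onI continuous_intros)

text \<open>The model is a Gaussian \<gamma> tending to 1 together with its Fourier transform
  \<Gamma>, a probability density. Recording just the properties that a regularised Plancherel
  argument uses lets one proof serve the line and, through products, the plane.\<close>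

definition fourier_kernel ::
  "(nat \<Rightarrow> 'a::euclidean_space \<Rightarrow> real) \<Rightarrow> (nat \<Rightarrow> 'a \<Rightarrow> real) \<Rightarrow> bool" where
  "fourier_kernel \<gamma> \<Gamma> \<longleftrightarrow>
     (\<forall>n. integrable lborel (\<gamma> n) \<and> \<Gamma> n \<in> borel_measurable borel \<and> integral\<^sup>N lborel (\<Gamma> n) = 1) \<and>
     (\<forall>n y. 0 \<le> \<gamma> n y \<and> 0 \<le> \<Gamma> n y \<and> \<Gamma> n (- y) = \<Gamma> n y) \<and>
     (\<forall>y. (\<lambda>n. \<gamma> n y) \<longlonglongrightarrow> 1) \<and>
     (\<forall>n z. (LINT y|lborel. \<gamma> n y *\<^sub>R echar (y \<bullet> z)) = complex_of_real (\<Gamma> n z))"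

lemma fourier_kernel_real: "\<exists>\<gamma> \<Gamma>. fourier_kernel \<gamma> (\<Gamma> :: nat \<Rightarrow> real \<Rightarrow> real)"
proof -
  define \<delta> :: "nat \<Rightarrow> real" where "\<delta> n = 1 / real (Suc n)" for n
  have \<delta>: "0 < \<delta> n" for n by (simp add: \<delta>_def)
  \<comment> \<open>\<open>\<Gamma> n z\<close> is
    \<open>exp (- pi * z^2 / \<delta>^2) / \<delta>\<close>, the Fourier transform of
    \<open>\<gamma> n\<close>. Written as a normal density it has mass 1 at once, and the rescaling
    by \<open>k n\<close> reduces the transform to the characteristic function of the standard
    normal law.\<close>
  define \<gamma> where "\<gamma> n y = exp (- pi * (\<delta> n)\<^sup>2 * y\<^sup>2)" for n and y :: real
  define \<Gamma> where "\<Gamma> n = normal_density 0 (\<delta> n / sqrt (2 * pi))" for n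
  define k where "k n = sqrt (2 * pi) * \<delta> n" for n
  have k: "0 < k n" for n using \<delta> by (simp add: k_def)
  have std: "std_normal_density (k n * y) = 1 / sqrt (2 * pi) * \<gamma> n y" for n y
    by (simp add: std_normal_density_def k_def \<gamma>_def power_mult_distrib algebra_simps)
  have "integrable lborel (\<gamma> n)" for n
  proof -
    have "integrable lborel (\<lambda>y. std_normal_density (0 + k n * y))"
      using k[of n] by (intro lborel_integrable_real_affine) auto
    then have "integrable lborel (\<lambda>y. sqrt (2 * pi) * std_normal_density (0 + k n * y))"
      by (intro integrable_mult_right)
    moreover have "sqrt (2 * pi) * std_normal_density (0 + k n * y) = \<gamma> n y" for y
      by (simp add: std)
    ultimately show ?thesis by (simp only:)
  qed
  moreover have "\<Gamma> n \<in> borel_measurable borel" for n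
    by (simp add: \<Gamma>_def)
  moreover have "integral\<^sup>N lborel (\<Gamma> n) = 1" for n
  proof -
    have "integral\<^sup>N lborel (\<Gamma> n) = ennreal (LINT x|lborel. \<Gamma> n x)"
      unfolding \<Gamma>_def using \<delta>[of n] by (intro nn_integral_eq_integral) auto
    also have "\<dots> = 1"
      unfolding \<Gamma>_def using \<delta>[of n] by simp
    finally show ?thesis .
  qed
  moreover have "0 \<le> \<gamma> n y" "0 \<le> \<Gamma> n y" "\<Gamma> n (- y) = \<Gamma> n y" for n y
    by (simp_all add: \<gamma>_def \<Gamma>_def normal_density_def)
  moreover have "(\<lambda>n. \<gamma> n y) \<longlonglongrightarrow> 1" for y
  proof -
    have "\<delta> \<longlonglongrightarrow> 0"
      unfolding \<delta>_def using LIMSEQ_inverse_real_of_nat by (simp add: inverse_eq_divide)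
    then have "(\<lambda>n. exp (- pi * (\<delta> n)\<^sup>2 * y\<^sup>2)) \<longlonglongrightarrow> exp (- pi * 0\<^sup>2 * y\<^sup>2)"
      by (intro tendsto_intros)
    then show ?thesis by (simp add: \<gamma>_def)
  qed
  moreover have "(LINT y|lborel. \<gamma> n y *\<^sub>R echar (y \<bullet> z)) = complex_of_real (\<Gamma> n z)" for n z
  proof -
    define t where "t = - (2 * pi * z / k n)"
    have "complex_of_real (exp (- (t\<^sup>2) / 2)) = (LINT x|std_normal_distribution. iexp (t * x))"
      using char_std_normal_distribution by (simp add: char_def fun_eq_iff)
    also have "\<dots> = (LINT x|lborel. std_normal_density x *\<^sub>R iexp (t * x))"
      by (intro integral_density) auto
    also have "\<dots> = k n *\<^sub>R (LINT y|lborel. std_normal_density (0 + k n * y) *\<^sub>R iexp (t * (0 + k n * y)))"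
      using k[of n] by (subst lborel_integral_real_affine[of "k n" _ 0]) auto
    also have "\<dots> = k n *\<^sub>R (LINT y|lborel. (1 / sqrt (2 * pi)) *\<^sub>R (\<gamma> n y *\<^sub>R echar (y \<bullet> z)))"
    proof -
      have *: "std_normal_density (0 + k n * y) *\<^sub>R iexp (t * (0 + k n * y)) =
          (1 / sqrt (2 * pi)) *\<^sub>R (\<gamma> n y *\<^sub>R echar (y \<bullet> z))" for y
      proof -
        have "iexp (t * (0 + k n * y)) = echar (y \<bullet> z)"
          using k[of n] by (simp add: echar_def cis_conv_exp t_def mult_ac)
        then show ?thesis
          using std[of n y] by (simp only: add_0 scaleR_scaleR)
      qed
      show ?thesis by (simp only: *)
    qed
    also have "\<dots> = (k n / sqrt (2 * pi)) *\<^sub>R (LINT y|lborel. \<gamma> n y *\<^sub>R echar (y \<bullet> z))"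
      by (subst integral_scaleR_right) simp
    finally have "complex_of_real (exp (- (t\<^sup>2) / 2)) = \<delta> n *\<^sub>R (LINT y|lborel. \<gamma> n y *\<^sub>R echar (y \<bullet> z))"
      by (simp add: k_def)
    then have "(LINT y|lborel. \<gamma> n y *\<^sub>R echar (y \<bullet> z)) = (1 / \<delta> n) *\<^sub>R complex_of_real (exp (- (t\<^sup>2) / 2))"
      using \<delta>[of n] by simp
    also have "(1 / \<delta> n) * exp (- (t\<^sup>2) / 2) = \<Gamma> n z"
    proof -
      have "t\<^sup>2 / 2 = z\<^sup>2 / (2 * (\<delta> n / sqrt (2 * pi))\<^sup>2)"
        using \<delta>[of n] by (simp add: t_def k_def power_divide power_mult_distrib power2_eq_square[of pi] field_simps)
      moreover have "sqrt (2 * pi * (\<delta> n / sqrt (2 * pi))\<^sup>2) = \<delta> n"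
        using \<delta>[of n] by (simp add: power_divide)
      ultimately show ?thesis
        by (simp add: \<Gamma>_def normal_density_def)
    qed
    then have "(1 / \<delta> n) *\<^sub>R complex_of_real (exp (- (t\<^sup>2) / 2)) = complex_of_real (\<Gamma> n z)"
      by (metis of_real_mult scaleR_conv_of_real)
    finally show ?thesis .
  qed
  ultimately show ?thesis
    unfolding fourier_kernel_def by blast
qed

lemma integrable_mult_pair:
  fixes f :: "'a \<Rightarrow> 'c::{real_normed_field,banach,second_countable_topology}"
  assumes "sigma_finite_measure M" "sigma_finite_measure N"
    and f: "integrable M f" and g: "integrable N g"
  shows "integrable (M \<Otimes>\<^sub>M N) (\<lambda>p. f (fst p) * g (snd p))"
proof -
  interpret pair_sigma_finite M N using assms by (simp add: pair_sigma_finite_def)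
  have [measurable]: "f \<in> borel_measurable M" "g \<in> borel_measurable N" using f g by auto
  show ?thesis
  proof (rule Fubini_integrable)
    show "integrable M (\<lambda>x. LINT y|N. norm (f (fst (x, y)) * g (snd (x, y))))"
      using f g by (simp add: norm_mult)
    show "AE x in M. integrable N (\<lambda>y. f (fst (x, y)) * g (snd (x, y)))"
      using g by simp
  qed measurable
qed

lemma integral_mult_pair:
  fixes f :: "'a \<Rightarrow> 'c::{real_normed_field,banach,second_countable_topology}"
  assumes "sigma_finite_measure M" "sigma_finite_measure N"
    and f: "integrable M f" and g: "integrable N g"
  shows "(LINT p|(M \<Otimes>\<^sub>M N). f (fst p) * g (snd p)) = (LINT x|M. f x) * (LINT y|N. g y)"
proof -
  interpret pair_sigma_finite M N using assms by (simp add: pair_sigma_finite_def)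
  have "(LINT p|(M \<Otimes>\<^sub>M N). f (fst p) * g (snd p)) = (LINT x|M. LINT y|N. f x * g y)"
    using integral_fst'[OF integrable_mult_pair[OF assms]] by simp
  also have "\<dots> = (LINT x|M. f x) * (LINT y|N. g y)"
    using f g by simp
  finally show ?thesis .
qed

lemma fourier_kernel_prod:
  fixes \<gamma>1 \<Gamma>1 :: "nat \<Rightarrow> 'a::euclidean_space \<Rightarrow> real" and \<gamma>2 \<Gamma>2 :: "nat \<Rightarrow> 'b::euclidean_space \<Rightarrow> real"
  assumes 1: "fourier_kernel \<gamma>1 \<Gamma>1" and 2: "fourier_kernel \<gamma>2 \<Gamma>2"
  shows "fourier_kernel (\<lambda>n p. \<gamma>1 n (fst p) * \<gamma>2 n (snd p)) (\<lambda>n p. \<Gamma>1 n (fst p) * \<Gamma>2 n (snd p))"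
proof -
  have [measurable]: "\<Gamma>1 n \<in> borel_measurable borel" "\<Gamma>2 n \<in> borel_measurable borel" for n
    using 1 2 by (auto simp: fourier_kernel_def)
  have sf: "sigma_finite_measure (lborel :: 'a measure)" "sigma_finite_measure (lborel :: 'b measure)"
    by unfold_locales
  have int: "integrable lborel (\<gamma>1 n)" "integrable lborel (\<gamma>2 n)" for n
    using 1 2 by (auto simp: fourier_kernel_def)
  have [measurable]: "\<gamma>1 n \<in> borel_measurable borel" "\<gamma>2 n \<in> borel_measurable borel" for n
    using int[THEN borel_measurable_integrable] by auto
  have "integrable lborel (\<lambda>p. \<gamma>1 n (fst p) * \<gamma>2 n (snd p))" for n
    using integrable_mult_pair[OF sf int, of n n] by (simp add: lborel_prod)
  moreover have "integral\<^sup>N lborel (\<lambda>p. \<Gamma>1 n (fst p) * \<Gamma>2 n (snd p)) = 1" for n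
  proof -
    have "integral\<^sup>N (lborel \<Otimes>\<^sub>M lborel) (\<lambda>p. ennreal (\<Gamma>1 n (fst p) * \<Gamma>2 n (snd p))) =
        (\<integral>\<^sup>+x. \<integral>\<^sup>+y. ennreal (\<Gamma>1 n x) * ennreal (\<Gamma>2 n y) \<partial>lborel \<partial>lborel)"
      using 1 2 by (subst lborel.nn_integral_fst[symmetric]) (auto simp: ennreal_mult' fourier_kernel_def)
    also have "\<dots> = 1"
      using 1 2 by (simp add: nn_integral_cmult fourier_kernel_def)
    finally show ?thesis by (simp add: lborel_prod)
  qed
  moreover have "(\<lambda>n. \<gamma>1 n (fst y) * \<gamma>2 n (snd y)) \<longlonglongrightarrow> 1" for y
    using tendsto_mult[of "\<lambda>n. \<gamma>1 n (fst y)" 1 sequentially "\<lambda>n. \<gamma>2 n (snd y)" 1] 1 2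
    by (simp add: fourier_kernel_def)
  moreover have "(LINT y|lborel. (\<gamma>1 n (fst y) * \<gamma>2 n (snd y)) *\<^sub>R echar (y \<bullet> z)) =
      complex_of_real (\<Gamma>1 n (fst z) * \<Gamma>2 n (snd z))" for n z
  proof -
    have "integrable lborel (\<lambda>y. \<gamma>1 n y *\<^sub>R echar (y \<bullet> fst z))"
      using int(1)[of n] by (rule Bochner_Integration.integrable_bound) auto
    moreover have "integrable lborel (\<lambda>y. \<gamma>2 n y *\<^sub>R echar (y \<bullet> snd z))"
      using int(2)[of n] by (rule Bochner_Integration.integrable_bound) auto
    ultimately have "(LINT p|(lborel \<Otimes>\<^sub>M lborel). (\<gamma>1 n (fst p) *\<^sub>R echar (fst p \<bullet> fst z)) * (\<gamma>2 n (snd p) *\<^sub>R echar (snd p \<bullet> snd z)))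
        = complex_of_real (\<Gamma>1 n (fst z)) * complex_of_real (\<Gamma>2 n (snd z))"
      using 1 2 by (subst integral_mult_pair[OF sf]) (auto simp: fourier_kernel_def)
    then show ?thesis
      by (simp add: lborel_prod inner_prod_def echar_add scaleR_conv_of_real mult_ac)
  qed
  moreover have "(\<lambda>p. \<Gamma>1 n (fst p) * \<Gamma>2 n (snd p)) \<in> borel_measurable borel" for n
    unfolding borel_prod[symmetric] by measurable
  ultimately show ?thesis
    using 1 2 by (simp add: fourier_kernel_def)
qed

section \<open>Plancherel and Hausdorff--Young inequalities for image measures dominated by Lebesgue
  measure\<close>

lemma nn_integral_lborel_translate:
  fixes G :: "'a::euclidean_space \<Rightarrow> ennreal"
  assumes "G \<in> borel_measurable borel"
  shows "(\<integral>\<^sup>+x. G (x + z) \<partial>lborel) = (\<integral>\<^sup>+x. G x \<partial>lborel)"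
proof -
  have "(\<integral>\<^sup>+x. G x \<partial>lborel) = (\<integral>\<^sup>+x. G x \<partial>distr lborel borel ((+) z))"
    by (simp add: lborel_distr_plus)
  also have "\<dots> = (\<integral>\<^sup>+x. G (z + x) \<partial>lborel)"
    using assms by (intro nn_integral_distr) auto
  finally show ?thesis by (simp add: add.commute)
qed

lemma norm_integral_le_nn_integral:
  fixes f :: "'a \<Rightarrow> 'b::{banach, second_countable_topology}"
  shows "ennreal (norm (LINT x|M. f x)) \<le> (\<integral>\<^sup>+x. ennreal (norm (f x)) \<partial>M)"
proof (cases "integrable M f")
  case True
  then show ?thesis by (rule integral_norm_bound_ennreal)
qed (simp add: not_integrable_integral_eq)

text \<open>The integral is the Fourier transform of the image of \<open>h \<nu>\<close> under
  \<Phi>. Multiplying its square by \<open>\<gamma> n\<close> and using Fubini gives a double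
  integral with kernel \<open>\<Gamma> n (\<Phi> x - \<Phi> y)\<close>. The inequality 2ab \<le> a^2
  + b^2 reduces this to the mass of a translate of \<open>\<Gamma> n\<close> under the image
  measure, which is at most \<open>c\<close> by \<open>push\<close> (Schur's test). Fatou's lemma
  then removes \<open>\<gamma> n\<close>.\<close>

lemma plancherel_le:
  fixes \<Phi> :: "'x \<Rightarrow> 'a::euclidean_space" and h :: "'x \<Rightarrow> complex"
  assumes K: "fourier_kernel \<gamma> (\<Gamma> :: nat \<Rightarrow> 'a \<Rightarrow> real)" and \<nu>: "sigma_finite_measure \<nu>"
    and [measurable]: "\<Phi> \<in> borel_measurable \<nu>"
    and push: "\<And>G::'a \<Rightarrow> ennreal. G \<in> borel_measurable borel \<Longrightarrow>
      (\<integral>\<^sup>+\<omega>. G (\<Phi> \<omega>) \<partial>\<nu>) \<le> ennreal c * (\<integral>\<^sup>+x. G x \<partial>lborel)"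
    and h: "integrable \<nu> h"
  shows "(\<integral>\<^sup>+y. ennreal ((norm (LINT \<omega>|\<nu>. h \<omega> * echar (y \<bullet> \<Phi> \<omega>)))\<^sup>2) \<partial>lborel)
      \<le> ennreal c * (\<integral>\<^sup>+\<omega>. ennreal ((norm (h \<omega>))\<^sup>2) \<partial>\<nu>)"
proof -
  interpret sigma_finite_measure \<nu> by (rule \<nu>)
  interpret pair_sigma_finite \<nu> \<nu> ..
  have \<nu>2: "sigma_finite_measure (\<nu> \<Otimes>\<^sub>M \<nu>)"
    by (intro sigma_finite_pair_measure \<nu>)
  interpret P: pair_sigma_finite "\<nu> \<Otimes>\<^sub>M \<nu>" "lborel :: 'a measure"
    by (intro pair_sigma_finite.intro \<nu>2 lborel.sigma_finite_measure_axioms)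
  have [measurable]: "h \<in> borel_measurable \<nu>" using h by simp
  have int: "integrable lborel (\<gamma> n)" for n using K by (simp add: fourier_kernel_def)
  have [measurable]: "\<Gamma> n \<in> borel_measurable borel" "\<gamma> n \<in> borel_measurable borel" for n
    using K int[THEN borel_measurable_integrable] by (auto simp: fourier_kernel_def)
  have nonneg: "0 \<le> \<gamma> n y" "0 \<le> \<Gamma> n y" and even: "\<Gamma> n (- y) = \<Gamma> n y" for n y
    using K by (auto simp: fourier_kernel_def)
  define T where "T y = (LINT \<omega>|\<nu>. h \<omega> * echar (y \<bullet> \<Phi> \<omega>))" for y
  have [measurable]: "T \<in> borel_measurable borel"
    unfolding T_def by measurable
  define H where "H p = h (fst p) * cnj (h (snd p))" for p
  define D where "D p = \<Phi> (fst p) - \<Phi> (snd p)" for p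
  have [measurable]: "H \<in> borel_measurable (\<nu> \<Otimes>\<^sub>M \<nu>)" "D \<in> borel_measurable (\<nu> \<Otimes>\<^sub>M \<nu>)"
    unfolding H_def D_def by measurable
  have hint: "integrable \<nu> (\<lambda>\<omega>. h \<omega> * echar (y \<bullet> \<Phi> \<omega>))" for y
    by (rule Bochner_Integration.integrable_bound[OF h]) (auto simp: norm_mult)
  have Hint: "integrable (\<nu> \<Otimes>\<^sub>M \<nu>) H"
    unfolding H_def using integrable_mult_pair[OF \<nu> \<nu> h, of "\<lambda>\<omega>. cnj (h \<omega>)"] h by simp
  have TT: "T y * cnj (T y) = (LINT p|(\<nu> \<Otimes>\<^sub>M \<nu>). H p * echar (y \<bullet> D p))" for y
  proof -
    have "T y * cnj (T y) = (LINT p|(\<nu> \<Otimes>\<^sub>M \<nu>). (h (fst p) * echar (y \<bullet> \<Phi> (fst p))) * cnj (h (snd p) * echar (y \<bullet> \<Phi> (snd p))))"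
      unfolding T_def Bochner_Integration.integral_cnj[symmetric]
      using hint by (intro integral_mult_pair[symmetric] \<nu>) (simp_all only: complex_integrable_cnj)
    also have "\<dots> = (LINT p|(\<nu> \<Otimes>\<^sub>M \<nu>). H p * echar (y \<bullet> D p))"
      by (intro Bochner_Integration.integral_cong)
         (auto simp: H_def D_def inner_diff_right echar_diff)
    finally show ?thesis .
  qed
  have \<Gamma>_le: "(\<integral>\<^sup>+\<omega>. ennreal (\<Gamma> n (\<Phi> \<omega> - z)) \<partial>\<nu>) \<le> ennreal c" for n z
  proof -
    have "(\<integral>\<^sup>+\<omega>. ennreal (\<Gamma> n (\<Phi> \<omega> - z)) \<partial>\<nu>) \<le> ennreal c * (\<integral>\<^sup>+x. ennreal (\<Gamma> n (x - z)) \<partial>lborel)"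
      by (intro push) measurable
    also have "(\<integral>\<^sup>+x. ennreal (\<Gamma> n (x - z)) \<partial>lborel) = 1"
      using nn_integral_lborel_translate[of "\<lambda>x. ennreal (\<Gamma> n x)" "- z"] K by (simp add: fourier_kernel_def)
    finally show ?thesis by simp
  qed
  have step: "(\<integral>\<^sup>+y. ennreal (\<gamma> n y * (norm (T y))\<^sup>2) \<partial>lborel) \<le> ennreal c * (\<integral>\<^sup>+\<omega>. ennreal ((norm (h \<omega>))\<^sup>2) \<partial>\<nu>)" for n
  proof -
    have Wint: "integrable ((\<nu> \<Otimes>\<^sub>M \<nu>) \<Otimes>\<^sub>M lborel) (\<lambda>(p, y). H p * (\<gamma> n y *\<^sub>R echar (y \<bullet> D p)))"
      by (rule Bochner_Integration.integrable_bound[OF integrable_mult_pair[OF \<nu>2 lborel.sigma_finite_measure_axioms Hint integrable_of_real[OF int[of n]]]])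
         (auto simp: norm_mult)
    have "T y * cnj (T y) = complex_of_real ((norm (T y))\<^sup>2)" for y
      by (rule complex_norm_square[symmetric])
    note TT2 = this
    have sq: "complex_of_real (\<gamma> n y * (norm (T y))\<^sup>2) = (LINT p|(\<nu> \<Otimes>\<^sub>M \<nu>). H p * (\<gamma> n y *\<^sub>R echar (y \<bullet> D p)))" for y
    proof -
      have "complex_of_real (\<gamma> n y * (norm (T y))\<^sup>2) = complex_of_real (\<gamma> n y) * (LINT p|(\<nu> \<Otimes>\<^sub>M \<nu>). H p * echar (y \<bullet> D p))"
        unfolding TT[of y, symmetric] TT2 by simp
      also have "\<dots> = (LINT p|(\<nu> \<Otimes>\<^sub>M \<nu>). complex_of_real (\<gamma> n y) * (H p * echar (y \<bullet> D p)))"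
        by (rule integral_mult_right_zero[symmetric])
      finally show ?thesis by (simp only: scaleR_conv_of_real mult.left_commute)
    qed
    have Tint: "integrable lborel (\<lambda>y. \<gamma> n y * (norm (T y))\<^sup>2)"
    proof -
      have "integrable lborel (\<lambda>y. complex_of_real (\<gamma> n y * (norm (T y))\<^sup>2))"
        unfolding sq using P.integrable_snd[OF Wint] by simp
      then show ?thesis by (simp only: complex_of_real_integrable_eq)
    qed
    have "complex_of_real (\<integral>y. \<gamma> n y * (norm (T y))\<^sup>2 \<partial>lborel) = (\<integral>y. complex_of_real (\<gamma> n y * (norm (T y))\<^sup>2) \<partial>lborel)"
      by (rule integral_of_real[symmetric, OF Tint])
    also have "\<dots> = (\<integral>y. (LINT p|(\<nu> \<Otimes>\<^sub>M \<nu>). H p * (\<gamma> n y *\<^sub>R echar (y \<bullet> D p))) \<partial>lborel)"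
      by (simp only: sq)
    also have "\<dots> = (LINT p|(\<nu> \<Otimes>\<^sub>M \<nu>). (\<integral>y. H p * (\<gamma> n y *\<^sub>R echar (y \<bullet> D p)) \<partial>lborel))"
      by (rule P.Fubini_integral[OF Wint])
    also have "\<dots> = (LINT p|(\<nu> \<Otimes>\<^sub>M \<nu>). H p * complex_of_real (\<Gamma> n (D p)))"
    proof -
      have "(LINT y|lborel. \<gamma> n y *\<^sub>R echar (y \<bullet> z)) = complex_of_real (\<Gamma> n z)" for z
        using K by (simp add: fourier_kernel_def)
      then show ?thesis by (simp only: integral_mult_right_zero)
    qed
    finally have eq: "complex_of_real (\<integral>y. \<gamma> n y * (norm (T y))\<^sup>2 \<partial>lborel) = (LINT p|(\<nu> \<Otimes>\<^sub>M \<nu>). H p * complex_of_real (\<Gamma> n (D p)))" .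
    have "(\<integral>\<^sup>+y. ennreal (\<gamma> n y * (norm (T y))\<^sup>2) \<partial>lborel) = ennreal (norm (complex_of_real (\<integral>y. \<gamma> n y * (norm (T y))\<^sup>2 \<partial>lborel)))"
      using nonneg by (subst nn_integral_eq_integral[OF Tint]) (auto intro!: abs_of_nonneg[symmetric] integral_nonneg)
    also have "\<dots> = ennreal (norm (LINT p|(\<nu> \<Otimes>\<^sub>M \<nu>). H p * complex_of_real (\<Gamma> n (D p))))"
      by (simp only: eq)
    also have "\<dots> \<le> (\<integral>\<^sup>+p. ennreal (norm (H p * complex_of_real (\<Gamma> n (D p)))) \<partial>(\<nu> \<Otimes>\<^sub>M \<nu>))"
      by (rule norm_integral_le_nn_integral)
    also have "\<dots> \<le> (\<integral>\<^sup>+p. (ennreal ((norm (h (fst p)))\<^sup>2) * ennreal (\<Gamma> n (\<Phi> (snd p) - \<Phi> (fst p))) +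
        ennreal ((norm (h (snd p)))\<^sup>2) * ennreal (\<Gamma> n (\<Phi> (fst p) - \<Phi> (snd p)))) * ennreal (1 / 2) \<partial>(\<nu> \<Otimes>\<^sub>M \<nu>))"
    proof (intro nn_integral_mono)
      fix p
      have "norm (h (fst p)) * norm (h (snd p)) \<le> ((norm (h (fst p)))\<^sup>2 + (norm (h (snd p)))\<^sup>2) * (1 / 2)"
        using sum_squares_bound[of "norm (h (fst p))" "norm (h (snd p))"] by simp
      from mult_right_mono[OF this nonneg(2)[of n "D p"]]
      have "norm (H p * complex_of_real (\<Gamma> n (D p))) \<le> ((norm (h (fst p)))\<^sup>2 + (norm (h (snd p)))\<^sup>2) * (1 / 2) * \<Gamma> n (D p)"
        using nonneg by (simp add: H_def norm_mult)
      moreover have "\<Gamma> n (\<Phi> (snd p) - \<Phi> (fst p)) = \<Gamma> n (D p)"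
        using even[of n "D p"] by (simp add: D_def)
      moreover have *: "ennreal ((X + Y) * (1 / 2) * G) = (ennreal X * ennreal G + ennreal Y * ennreal G) * ennreal (1 / 2)"
        if "0 \<le> X" "0 \<le> Y" "0 \<le> G" for X Y G :: real
      proof -
        have "(ennreal X * ennreal G + ennreal Y * ennreal G) * ennreal (1 / 2) = ennreal ((X * G + Y * G) * (1 / 2))"
          using that by (subst ennreal_mult, simp, simp, subst ennreal_plus, simp, simp, subst ennreal_mult, simp, simp, subst ennreal_mult, simp_all)
        moreover have "(X + Y) * (1 / 2) * G = (X * G + Y * G) * (1 / 2)"
          by (simp add: algebra_simps)
        ultimately show ?thesis by (simp only:)
      qed
      ultimately show "ennreal (norm (H p * complex_of_real (\<Gamma> n (D p)))) \<le> (ennreal ((norm (h (fst p)))\<^sup>2) * ennreal (\<Gamma> n (\<Phi> (snd p) - \<Phi> (fst p))) +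
        ennreal ((norm (h (snd p)))\<^sup>2) * ennreal (\<Gamma> n (\<Phi> (fst p) - \<Phi> (snd p)))) * ennreal (1 / 2)"
        using nonneg(2)[of n "D p"] by (simp only: D_def[symmetric] ennreal_leI flip: *) (simp only: ennreal_leI zero_le_power2 flip: *)
    qed
    also have "\<dots> = ((\<integral>\<^sup>+p. ennreal ((norm (h (fst p)))\<^sup>2) * ennreal (\<Gamma> n (\<Phi> (snd p) - \<Phi> (fst p))) \<partial>(\<nu> \<Otimes>\<^sub>M \<nu>)) +
        (\<integral>\<^sup>+p. ennreal ((norm (h (snd p)))\<^sup>2) * ennreal (\<Gamma> n (\<Phi> (fst p) - \<Phi> (snd p))) \<partial>(\<nu> \<Otimes>\<^sub>M \<nu>))) * ennreal (1 / 2)"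
      by (subst nn_integral_multc, simp, subst nn_integral_add, auto)
    also have "(\<integral>\<^sup>+p. ennreal ((norm (h (fst p)))\<^sup>2) * ennreal (\<Gamma> n (\<Phi> (snd p) - \<Phi> (fst p))) \<partial>(\<nu> \<Otimes>\<^sub>M \<nu>)) =
        (\<integral>\<^sup>+x. ennreal ((norm (h x))\<^sup>2) * (\<integral>\<^sup>+y. ennreal (\<Gamma> n (\<Phi> y - \<Phi> x)) \<partial>\<nu>) \<partial>\<nu>)"
      by (rule trans[OF sigma_finite_measure.nn_integral_fst[OF \<nu>, symmetric]]) (auto simp: nn_integral_cmult)
    also have "(\<integral>\<^sup>+p. ennreal ((norm (h (snd p)))\<^sup>2) * ennreal (\<Gamma> n (\<Phi> (fst p) - \<Phi> (snd p))) \<partial>(\<nu> \<Otimes>\<^sub>M \<nu>)) =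
        (\<integral>\<^sup>+x. ennreal ((norm (h x))\<^sup>2) * (\<integral>\<^sup>+y. ennreal (\<Gamma> n (\<Phi> y - \<Phi> x)) \<partial>\<nu>) \<partial>\<nu>)"
      by (rule trans[OF nn_integral_snd[symmetric]]) (auto simp: nn_integral_cmult)
    also have "(\<integral>\<^sup>+x. ennreal ((norm (h x))\<^sup>2) * (\<integral>\<^sup>+y. ennreal (\<Gamma> n (\<Phi> y - \<Phi> x)) \<partial>\<nu>) \<partial>\<nu>) \<le>
        (\<integral>\<^sup>+x. ennreal ((norm (h x))\<^sup>2) * ennreal c \<partial>\<nu>)"
      by (intro nn_integral_mono mult_left_mono \<Gamma>_le) auto
    also have "(\<integral>\<^sup>+x. ennreal ((norm (h x))\<^sup>2) * ennreal c \<partial>\<nu>) = ennreal c * (\<integral>\<^sup>+x. ennreal ((norm (h x))\<^sup>2) \<partial>\<nu>)"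
      by (subst nn_integral_multc) (auto simp: mult.commute)
    finally have *: "(\<integral>\<^sup>+y. ennreal (\<gamma> n y * (norm (T y))\<^sup>2) \<partial>lborel) \<le>
      (ennreal c * (\<integral>\<^sup>+x. ennreal ((norm (h x))\<^sup>2) \<partial>\<nu>) + ennreal c * (\<integral>\<^sup>+x. ennreal ((norm (h x))\<^sup>2) \<partial>\<nu>)) * ennreal (1 / 2)"
      by (simp add: add_mono mult_right_mono)
    have "(a + a) * ennreal (1 / 2) = a" for a :: ennreal
    proof -
      have "(a + a) * ennreal (1 / 2) = a * (2 * ennreal (1 / 2))" by (simp only: mult_2[symmetric] mult_ac)
      also have "2 * ennreal (1 / 2) = 1"
        by (metis ennreal_1 ennreal_mult' ennreal_numeral mult.commute nonzero_eq_divide_eq zero_le_numeral zero_neq_numeral)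
      finally show ?thesis by simp
    qed
    then show ?thesis using * by simp
  qed
  have "(\<integral>\<^sup>+y. ennreal ((norm (T y))\<^sup>2) \<partial>lborel) = (\<integral>\<^sup>+y. liminf (\<lambda>n. ennreal (\<gamma> n y * (norm (T y))\<^sup>2)) \<partial>lborel)"
  proof (intro nn_integral_cong)
    fix y
    have "(\<lambda>n. ennreal (\<gamma> n y * (norm (T y))\<^sup>2)) \<longlonglongrightarrow> ennreal (1 * (norm (T y))\<^sup>2)"
      using K by (intro tendsto_ennrealI tendsto_mult tendsto_const) (simp add: fourier_kernel_def)
    then show "ennreal ((norm (T y))\<^sup>2) = liminf (\<lambda>n. ennreal (\<gamma> n y * (norm (T y))\<^sup>2))"
      by (simp add: lim_imp_Liminf)
  qed
  also have "\<dots> \<le> liminf (\<lambda>n. \<integral>\<^sup>+y. ennreal (\<gamma> n y * (norm (T y))\<^sup>2) \<partial>lborel)"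
    by (intro nn_integral_liminf) auto
  also have "\<dots> \<le> liminf (\<lambda>n::nat. ennreal c * (\<integral>\<^sup>+\<omega>. ennreal ((norm (h \<omega>))\<^sup>2) \<partial>\<nu>))"
    by (intro Liminf_mono always_eventually allI step)
  also have "\<dots> = ennreal c * (\<integral>\<^sup>+\<omega>. ennreal ((norm (h \<omega>))\<^sup>2) \<partial>\<nu>)"
    by (simp add: Liminf_const)
  finally show ?thesis by (simp add: T_def)
qed

text \<open>
  Marcinkiewicz interpolation between \<open>L\<^sup>1 \<rightarrow> L\<^sup>\<infinity>\<close> and \<open>L\<^sup>2 \<rightarrow> L\<^sup>2\<close>: the truncation height is chosen such
  that the unbounded part of \<open>h\<close> contributes at most \<open>\<lambda>/2\<close> everywhere.
\<close>

lemma hausdorff_young_le: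
  fixes \<Phi> :: "'x \<Rightarrow> 'a::euclidean_space" and h :: "'x \<Rightarrow> complex"
  assumes K: "fourier_kernel \<gamma> (\<Gamma> :: nat \<Rightarrow> 'a \<Rightarrow> real)" and \<nu>: "sigma_finite_measure \<nu>"
    and [measurable]: "\<Phi> \<in> borel_measurable \<nu>"
    and push: "\<And>G::'a \<Rightarrow> ennreal. G \<in> borel_measurable borel \<Longrightarrow>
      (\<integral>\<^sup>+\<omega>. G (\<Phi> \<omega>) \<partial>\<nu>) \<le> ennreal c * (\<integral>\<^sup>+x. G x \<partial>lborel)"
    and c: "0 \<le> c"
    and h: "integrable \<nu> h"
    and S: "2 < S" and U: "(\<integral>\<^sup>+\<omega>. ennreal (norm (h \<omega>) powr (S / (S - 1))) \<partial>\<nu>) \<le> ennreal U" and "0 < U"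
  shows "(\<integral>\<^sup>+y. ennreal (norm (LINT \<omega>|\<nu>. h \<omega> * echar (y \<bullet> \<Phi> \<omega>)) powr S) \<partial>lborel)
      \<le> ennreal (4 * S * c / (S - 2) * 2 powr (S - 2) * U powr (S - 1))"
proof -
  interpret sigma_finite_measure \<nu> by (rule \<nu>)
  interpret N: pair_sigma_finite \<nu> "lborel :: real measure" ..
  have [measurable]: "h \<in> borel_measurable \<nu>" using h by simp
  define s where "s = S / (S - 1)"
  have s: "1 < s" "(s - 1) * (S - 1) = 1" "s * (S - 1) = S"
    using S by (auto simp: s_def field_simps)
  \<comment> \<open>With \<open>s\<close> conjugate to \<open>S\<close> this height satisfies
    \<open>\<eta> l powr (1 - s) = l / (2 * U)\<close>. Where \<open>norm (h \<omega>)\<close>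
    exceeds \<open>\<eta> l\<close>, it is at most
    \<open>\<eta> l powr (1 - s) * norm (h \<omega>) powr s\<close>, so the part cut off has
    integral at most \<open>l / 2\<close>.\<close>
  define \<eta> where "\<eta> l = (2 * U / l) powr (S - 1)" for l
  define g where "g l \<omega> = (if norm (h \<omega>) \<le> \<eta> l then h \<omega> else 0)" for l \<omega>
  define T where "T y = (LINT \<omega>|\<nu>. h \<omega> * echar (y \<bullet> \<Phi> \<omega>))" for y
  define R where "R y l = (LINT \<omega>|\<nu>. g l \<omega> * echar (y \<bullet> \<Phi> \<omega>))" for y l
  let ?d = "ennreal (4 * S / (S - 2) * (2 * U) powr (S - 2))"
  let ?c = "\<lambda>l. ennreal (4 * S * l powr (S - 3)) * indicator {0<..} l"
  have \<eta>m [measurable]: "\<eta> \<in> borel_measurable borel"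
    unfolding \<eta>_def by measurable
  have gm: "(\<lambda>p. g (fst p) (snd p)) \<in> borel_measurable (borel \<Otimes>\<^sub>M \<nu>)"
    unfolding g_def by measurable
  have [measurable]: "(\<lambda>x. g (f x) (k x)) \<in> borel_measurable M" if "f \<in> borel_measurable M" "k \<in> measurable M \<nu>" for f k and M :: "'z measure"
    using measurable_compose[OF measurable_Pair[OF that] gm] by simp
  have [measurable]: "T \<in> borel_measurable borel"
    unfolding T_def by measurable
  have Rm: "(\<lambda>p. R (fst p) (snd p)) \<in> borel_measurable (borel \<Otimes>\<^sub>M borel)"
    unfolding R_def by (rule borel_measurable_lebesgue_integral) measurable
  have [measurable]: "(\<lambda>x. R (f x) (k x)) \<in> borel_measurable M" if "f \<in> borel_measurable M" "k \<in> borel_measurable M" for f k and M :: "'z measure"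
    using measurable_compose[OF measurable_Pair[OF that] Rm] by simp
  have gint: "integrable \<nu> (g l)" for l
    by (rule Bochner_Integration.integrable_bound[OF h]) (auto simp: g_def)
  have close: "norm (T y - R y l) \<le> l / 2" if l: "0 < l" for y l
  proof -
    have i1: "integrable \<nu> (\<lambda>\<omega>. h \<omega> * echar (y \<bullet> \<Phi> \<omega>))"
      by (rule Bochner_Integration.integrable_bound[OF h]) (auto simp: norm_mult)
    have i2: "integrable \<nu> (\<lambda>\<omega>. g l \<omega> * echar (y \<bullet> \<Phi> \<omega>))"
      by (rule Bochner_Integration.integrable_bound[OF gint[of l]]) (auto simp: norm_mult)
    have \<eta>: "0 < \<eta> l" "\<eta> l powr (1 - s) = l / (2 * U)"
    proof -
      show "0 < \<eta> l" using l \<open>0 < U\<close> by (simp add: \<eta>_def)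
      have "(S - 1) * (1 - s) = - 1" using s by (simp add: algebra_simps)
      then have "\<eta> l powr (1 - s) = (2 * U / l) powr (- 1)"
        by (simp add: \<eta>_def powr_powr)
      then show "\<eta> l powr (1 - s) = l / (2 * U)"
        using l \<open>0 < U\<close> by (simp add: powr_minus_divide)
    qed
    have "T y - R y l = (LINT \<omega>|\<nu>. (h \<omega> - g l \<omega>) * echar (y \<bullet> \<Phi> \<omega>))"
      unfolding T_def R_def left_diff_distrib using i1 i2 by (rule Bochner_Integration.integral_diff[symmetric])
    then have "ennreal (norm (T y - R y l)) \<le> (\<integral>\<^sup>+\<omega>. ennreal (norm ((h \<omega> - g l \<omega>) * echar (y \<bullet> \<Phi> \<omega>))) \<partial>\<nu>)"
      by (simp add: norm_integral_le_nn_integral)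
    also have "\<dots> \<le> (\<integral>\<^sup>+\<omega>. ennreal (l / (2 * U)) * ennreal (norm (h \<omega>) powr s) \<partial>\<nu>)"
    proof (intro nn_integral_mono)
      fix \<omega>
      have "norm (h \<omega> - g l \<omega>) \<le> l / (2 * U) * norm (h \<omega>) powr s"
      proof (cases "norm (h \<omega>) \<le> \<eta> l")
        case False
        then have "norm (h \<omega>) powr (1 - s) \<le> \<eta> l powr (1 - s)"
          using \<eta> s by (intro powr_mono2') auto
        then have "norm (h \<omega>) powr (1 - s) * norm (h \<omega>) powr s \<le> \<eta> l powr (1 - s) * norm (h \<omega>) powr s"
          by (rule mult_right_mono) simp
        moreover have "norm (h \<omega>) powr (1 - s) * norm (h \<omega>) powr s = norm (h \<omega>)"
          by (simp flip: powr_add)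
        ultimately show ?thesis using False \<eta> by (simp add: g_def)
      qed (use l \<open>0 < U\<close> in \<open>simp add: g_def\<close>)
      then show "ennreal (norm ((h \<omega> - g l \<omega>) * echar (y \<bullet> \<Phi> \<omega>))) \<le> ennreal (l / (2 * U)) * ennreal (norm (h \<omega>) powr s)"
        using l \<open>0 < U\<close> by (subst ennreal_mult'[symmetric]) (auto simp: norm_mult intro!: ennreal_leI)
    qed
    also have "\<dots> \<le> ennreal (l / (2 * U)) * ennreal U"
      using U by (subst nn_integral_cmult) (auto simp: s_def intro!: mult_left_mono)
    also have "\<dots> = ennreal (l / 2)"
      using l \<open>0 < U\<close> by (simp flip: ennreal_mult')
    finally show ?thesis using l by simp
  qed
  \<comment> \<open>Layer-cake formula in \<open>l\<close>. For \<open>l \<le> norm (T y)\<close>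
    the bound \<open>close\<close> forces \<open>norm (R y l) \<ge> l / 2\<close>, so
    \<open>l powr (S - 1)\<close> may be traded for \<open>4 * l powr (S - 3)\<close> times the
    square of \<open>R y l\<close>, to which Plancherel applies.\<close>
  have layer: "ennreal (norm (T y) powr S) \<le> (\<integral>\<^sup>+l. ?c l * ennreal ((norm (R y l))\<^sup>2) \<partial>lborel)" for y
  proof -
    have "ennreal (norm (T y) powr S) = ennreal S * (\<integral>\<^sup>+l. ennreal (l powr (S - 1)) * indicator {0<..norm (T y)} l \<partial>lborel)"
      using S by (subst nn_integral_powr_near_0) (auto simp: ennreal_mult'[symmetric])
    also have "\<dots> = (\<integral>\<^sup>+l. ennreal S * (ennreal (l powr (S - 1)) * indicator {0<..norm (T y)} l) \<partial>lborel)"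
      by (subst nn_integral_cmult) auto
    also have "\<dots> \<le> (\<integral>\<^sup>+l. ?c l * ennreal ((norm (R y l))\<^sup>2) \<partial>lborel)"
    proof (intro nn_integral_mono)
      fix l :: real
      show "ennreal S * (ennreal (l powr (S - 1)) * indicator {0<..norm (T y)} l) \<le> ?c l * ennreal ((norm (R y l))\<^sup>2)"
      proof (cases "0 < l \<and> l \<le> norm (T y)")
        case True
        have "l / 2 \<le> norm (R y l)"
          using True close[of l y] norm_triangle_ineq2[of "T y" "R y l"] by auto
        then have "(l / 2)\<^sup>2 \<le> (norm (R y l))\<^sup>2"
          using True by (intro power_mono) auto
        then have "4 * S * l powr (S - 3) * (l / 2)\<^sup>2 \<le> 4 * S * l powr (S - 3) * (norm (R y l))\<^sup>2"
          using S by (intro mult_left_mono) auto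
        moreover have "4 * S * l powr (S - 3) * (l / 2)\<^sup>2 = S * l powr (S - 1)"
        proof -
          have "l powr (S - 1) = l powr (S - 3) * l\<^sup>2"
            using True powr_add[of l "S - 3" 2] by (simp add: powr_numeral)
          then show ?thesis by (simp add: power_divide)
        qed
        ultimately show ?thesis
          using True S by (simp add: ennreal_mult'[symmetric] ennreal_leI)
      qed (auto split: split_indicator)
    qed
    finally show ?thesis .
  qed
  have inner: "(\<integral>\<^sup>+l. ?c l * ennreal ((norm (g l \<omega>))\<^sup>2) \<partial>lborel)
      \<le> ?d * ennreal (norm (h \<omega>) powr s)" for \<omega>
  proof (cases "h \<omega> = 0")
    case True
    then have "g l \<omega> = 0" for l by (simp add: g_def)
    then show ?thesis by simp
  next
    case False
    define t where "t = norm (h \<omega>)"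
    have t: "0 < t" using False by (simp add: t_def)
    \<comment> \<open>The solution \<open>l\<close> of \<open>\<eta> l = t\<close>: the truncation
      keeps the value \<open>h \<omega>\<close> only for \<open>l \<le> B\<close>. Integrating
      \<open>l powr (S - 3)\<close> down to 0 converges because S > 2 and produces the factor
      \<open>1 / (S - 2)\<close>.\<close>
    define B where "B = 2 * U * t powr (1 - s)"
    have B: "0 < B" using t \<open>0 < U\<close> by (simp add: B_def)
    have "(\<integral>\<^sup>+l. ?c l * ennreal ((norm (g l \<omega>))\<^sup>2) \<partial>lborel)
        \<le> (\<integral>\<^sup>+l. ennreal (4 * S * t\<^sup>2) * (ennreal (l powr (S - 3)) * indicator {0<..B} l) \<partial>lborel)"
    proof (intro nn_integral_mono)
      fix l :: real
      show "?c l * ennreal ((norm (g l \<omega>))\<^sup>2)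
          \<le> ennreal (4 * S * t\<^sup>2) * (ennreal (l powr (S - 3)) * indicator {0<..B} l)"
      proof (cases "0 < l \<and> t \<le> \<eta> l")
        case True
        then have "t powr (s - 1) \<le> \<eta> l powr (s - 1)"
          using s t by (intro powr_mono2) auto
        also have "\<dots> = 2 * U / l"
          using s True \<open>0 < U\<close> by (simp add: \<eta>_def powr_powr mult.commute)
        finally have "l * t powr (s - 1) \<le> 2 * U"
          using True by (simp add: field_simps)
        then have "l * t powr (s - 1) * t powr (1 - s) \<le> B"
          unfolding B_def by (rule mult_right_mono) simp
        moreover have "l * t powr (s - 1) * t powr (1 - s) = l"
          using t by (simp add: mult.assoc flip: powr_add)
        ultimately have "l \<le> B" by simp
        then show ?thesis
          using True S by (simp add: g_def t_def[symmetric] ennreal_mult'[symmetric] mult_ac)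
      qed (auto simp: g_def t_def split: split_indicator)
    qed
    also have "\<dots> = ennreal (4 * S * t\<^sup>2) * ennreal (B powr (S - 2) / (S - 2))"
      using S B by (subst nn_integral_cmult) (auto simp: nn_integral_powr_near_0)
    also have "\<dots> = ennreal (4 * S / (S - 2) * (2 * U) powr (S - 2) * (t\<^sup>2 * t powr ((1 - s) * (S - 2))))"
      using S t \<open>0 < U\<close> by (simp add: ennreal_mult'[symmetric] B_def powr_mult powr_powr mult_ac)
    also have "t\<^sup>2 * t powr ((1 - s) * (S - 2)) = t powr s"
    proof -
      have "t\<^sup>2 * t powr ((1 - s) * (S - 2)) = t powr (2 + (1 - s) * (S - 2))"
        using t by (simp add: powr_add powr_numeral)
      also have "2 + (1 - s) * (S - 2) = s"
        using s(2) by (simp add: algebra_simps)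
      finally show ?thesis .
    qed
    also have "ennreal (4 * S / (S - 2) * (2 * U) powr (S - 2) * t powr s) =
        ?d * ennreal (norm (h \<omega>) powr s)"
      unfolding t_def by (intro ennreal_mult'') simp
    finally show ?thesis .
  qed
  have "(\<integral>\<^sup>+y. ennreal (norm (T y) powr S) \<partial>lborel) \<le>
      (\<integral>\<^sup>+y. \<integral>\<^sup>+l. ?c l * ennreal ((norm (R y l))\<^sup>2) \<partial>lborel \<partial>lborel)"
    by (intro nn_integral_mono layer)
  also have "\<dots> = (\<integral>\<^sup>+l. \<integral>\<^sup>+y. ?c l * ennreal ((norm (R y l))\<^sup>2) \<partial>lborel \<partial>lborel)"
    by (rule lborel_pair.Fubini'[symmetric]) measurable
  also have "\<dots> = (\<integral>\<^sup>+l. ?c l * (\<integral>\<^sup>+y. ennreal ((norm (R y l))\<^sup>2) \<partial>lborel) \<partial>lborel)"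
    by (intro nn_integral_cong nn_integral_cmult) measurable
  also have "\<dots> \<le> (\<integral>\<^sup>+l. ?c l * (ennreal c * (\<integral>\<^sup>+\<omega>. ennreal ((norm (g l \<omega>))\<^sup>2) \<partial>\<nu>)) \<partial>lborel)"
    unfolding R_def by (intro nn_integral_mono mult_left_mono plancherel_le[OF K \<nu> _ push] gint) auto
  also have "\<dots> = (\<integral>\<^sup>+l. \<integral>\<^sup>+\<omega>. ennreal c * (?c l * ennreal ((norm (g l \<omega>))\<^sup>2)) \<partial>\<nu> \<partial>lborel)"
    by (intro nn_integral_cong, simp add: nn_integral_cmult, simp add: mult_ac)
  also have "\<dots> = (\<integral>\<^sup>+\<omega>. \<integral>\<^sup>+l. ennreal c * (?c l * ennreal ((norm (g l \<omega>))\<^sup>2)) \<partial>lborel \<partial>\<nu>)"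
    by (rule N.Fubini') measurable
  also have "\<dots> \<le> (\<integral>\<^sup>+\<omega>. ennreal c * (?d * ennreal (norm (h \<omega>) powr s)) \<partial>\<nu>)"
  proof (intro nn_integral_mono)
    fix \<omega> assume "\<omega> \<in> space \<nu>"
    then have "(\<lambda>l. g l \<omega>) \<in> borel_measurable lborel"
      by measurable
    then have "(\<integral>\<^sup>+l. ennreal c * (?c l * ennreal ((norm (g l \<omega>))\<^sup>2)) \<partial>lborel)
        = ennreal c * (\<integral>\<^sup>+l. ?c l * ennreal ((norm (g l \<omega>))\<^sup>2) \<partial>lborel)"
      by (intro nn_integral_cmult) auto
    then show "(\<integral>\<^sup>+l. ennreal c * (?c l * ennreal ((norm (g l \<omega>))\<^sup>2)) \<partial>lborel)
        \<le> ennreal c * (?d * ennreal (norm (h \<omega>) powr s))"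
      by (simp only:) (intro mult_left_mono inner, simp)
  qed
  also have "\<dots> = ennreal c * (?d * (\<integral>\<^sup>+\<omega>. ennreal (norm (h \<omega>) powr s) \<partial>\<nu>))"
    by (simp add: nn_integral_cmult)
  also have "\<dots> \<le> ennreal c * (?d * ennreal U)"
    using U by (intro mult_left_mono) (auto simp: s_def)
  also have "\<dots> = ennreal (4 * S * c / (S - 2) * 2 powr (S - 2) * U powr (S - 1))"
  proof -
    have "U powr (S - 1) = U powr (S - 2) * U"
      using \<open>0 < U\<close> powr_add[of U "S - 2" 1] by simp
    then show ?thesis
      using S c \<open>0 < U\<close> by (simp add: ennreal_mult'[symmetric] powr_mult mult_ac)
  qed
  finally show ?thesis by (simp add: T_def)
qed

section \<open>Pitt's inequality\<close>

text \<open>Marcinkiewicz interpolation for the operator taking \<open>g\<close> to |r| times its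
  Fourier transform, over the measure dr / r^2. It is of weak type (1,1), because the transform is
  bounded by the \<open>L^1\<close> norm, and of strong type (2,2), because there the weights cancel
  and Plancherel applies. The two summands of the constant come from the values of \<open>g\<close>
  above and below the height \<open>l\<close>.\<close>

lemma hardy_littlewood_paley:
  fixes g :: "real \<Rightarrow> complex"
  assumes g: "integrable lborel g" and p: "1 < p" "p < 2"
    and U: "(\<integral>\<^sup>+t. ennreal (norm (g t) powr p) \<partial>lborel) \<le> ennreal U"
  shows "(\<integral>\<^sup>+r. ennreal (norm (LINT t|lborel. g t * echar (r * t)) powr p * \<bar>r\<bar> powr (p - 2)) \<partial>lborel)
      \<le> ennreal (4 * p / (p - 1) + 4 * p / (2 - p)) * ennreal U"
proof -
  have [measurable]: "g \<in> borel_measurable borel" using borel_measurable_integrable[OF g] by simp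
  obtain \<gamma> and \<Gamma> :: "nat \<Rightarrow> real \<Rightarrow> real" where K: "fourier_kernel \<gamma> \<Gamma>"
    using fourier_kernel_real by blast
  define T where "T r = (LINT t|lborel. g t * echar (r * t))" for r
  define k where "k l t = (if norm (g t) < l then g t else 0)" for l t
  define R where "R r l = (LINT t|lborel. k l t * echar (r * t))" for r l
  define m where "m l = (LINT t|lborel. norm (g t - k l t))" for l
  let ?a = "\<lambda>l. ennreal (p * l powr (p - 1)) * indicator {0<..} l"
  let ?b = "\<lambda>l. ennreal (4 * p * l powr (p - 3)) * indicator {0<..} l"
  let ?t = "\<lambda>l r. ennreal (\<bar>r\<bar> powr (- 2)) * indicator {x. l / 2 < \<bar>x\<bar> * m l} r"
  let ?k = "\<lambda>l t. ennreal (l powr (p - 2)) * indicator {0<..norm (g t)} l"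
  have [measurable]: "T \<in> borel_measurable borel"
    unfolding T_def by measurable
  have km: "(\<lambda>p. k (fst p) (snd p)) \<in> borel_measurable (borel \<Otimes>\<^sub>M borel)"
    unfolding k_def by measurable
  have [measurable]: "(\<lambda>x. k (f x) (f' x)) \<in> borel_measurable M" if "f \<in> borel_measurable M" "f' \<in> borel_measurable M" for f f' and M :: "'z measure"
    using measurable_compose[OF measurable_Pair[OF that] km] by simp
  have Rm: "(\<lambda>p. R (fst p) (snd p)) \<in> borel_measurable (borel \<Otimes>\<^sub>M borel)"
    unfolding R_def by (rule lborel.borel_measurable_lebesgue_integral) measurable
  have [measurable]: "(\<lambda>x. R (f x) (f' x)) \<in> borel_measurable M" if "f \<in> borel_measurable M" "f' \<in> borel_measurable M" for f f' and M :: "'z measure"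
    using measurable_compose[OF measurable_Pair[OF that] Rm] by simp
  have [measurable]: "m \<in> borel_measurable borel"
    unfolding m_def by measurable
  have kint: "integrable lborel (k l)" for l
    by (rule Bochner_Integration.integrable_bound[OF g]) (auto simp: k_def)
  have m0: "0 \<le> m l" for l by (simp add: m_def)
  have close: "norm (T r - R r l) \<le> m l" for r l
  proof -
    have i1: "integrable lborel (\<lambda>t. g t * echar (r * t))"
      by (rule Bochner_Integration.integrable_bound[OF g]) (auto simp: norm_mult)
    have i2: "integrable lborel (\<lambda>t. k l t * echar (r * t))"
      by (rule Bochner_Integration.integrable_bound[OF kint[of l]]) (auto simp: norm_mult)
    have "T r - R r l = (LINT t|lborel. (g t - k l t) * echar (r * t))"
      unfolding T_def R_def left_diff_distrib using i1 i2 by (rule Bochner_Integration.integral_diff[symmetric])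
    also have "norm \<dots> \<le> (LINT t|lborel. norm ((g t - k l t) * echar (r * t)))"
      by (rule integral_norm_bound)
    finally show ?thesis by (simp add: m_def norm_mult)
  qed
  \<comment> \<open>If \<open>l \<le> \<bar>r\<bar> * norm (T r)\<close>, then one of the two parts
    accounts for at least half of \<open>l\<close>: either
    \<open>\<bar>r\<bar> * m l > l / 2\<close>, where \<open>m l\<close> bounds the transform of the
    large values, or \<open>\<bar>r\<bar> * norm (R r l) \<ge> l / 2\<close>. The term
    \<open>?t\<close> records the first case, the square of \<open>R\<close> the second.\<close>
  have layer: "ennreal (norm (T r) powr p * \<bar>r\<bar> powr (p - 2)) \<le>
      (\<integral>\<^sup>+l. ?a l * (?t l r) +
        ?b l * ennreal ((norm (R r l))\<^sup>2) \<partial>lborel)"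
    if r: "r \<noteq> 0" for r
  proof -
    define x where "x = \<bar>r\<bar> * norm (T r)"
    have "norm (T r) powr p * \<bar>r\<bar> powr (p - 2) = \<bar>r\<bar> powr (- 2) * p * (x powr p / p)"
      using r p by (simp add: x_def powr_mult powr_diff powr_minus_divide)
    then have "ennreal (norm (T r) powr p * \<bar>r\<bar> powr (p - 2)) = ennreal (\<bar>r\<bar> powr (- 2) * p) * ennreal (x powr p / p)"
      using p by (simp add: ennreal_mult'[symmetric])
    also have "ennreal (x powr p / p) = (\<integral>\<^sup>+l. ennreal (l powr (p - 1)) * indicator {0<..x} l \<partial>lborel)"
      using p nn_integral_powr_near_0[of "p - 1" x] by (simp add: x_def)
    also have "ennreal (\<bar>r\<bar> powr (- 2) * p) * \<dots> = (\<integral>\<^sup>+l. ennreal (\<bar>r\<bar> powr (- 2) * p) * (ennreal (l powr (p - 1)) * indicator {0<..x} l) \<partial>lborel)"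
      by (subst nn_integral_cmult) auto
    also have "\<dots> \<le> (\<integral>\<^sup>+l. ?a l * (?t l r) +
        ?b l * ennreal ((norm (R r l))\<^sup>2) \<partial>lborel)"
    proof (intro nn_integral_mono)
      fix l :: real
      show "ennreal (\<bar>r\<bar> powr (- 2) * p) * (ennreal (l powr (p - 1)) * indicator {0<..x} l) \<le>
        ?a l * (?t l r) +
        ?b l * ennreal ((norm (R r l))\<^sup>2)" (is "?L \<le> ?A + ?B")
      proof (cases "0 < l \<and> l \<le> x")
        case True
        show ?thesis
        proof (cases "l / 2 < \<bar>r\<bar> * m l")
          case True
          then have "?L \<le> ?A"
            using \<open>0 < l \<and> l \<le> x\<close> p by (simp add: ennreal_mult'[symmetric] mult_ac)
          then show ?thesis by (rule order.trans) simp
        next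
          case False
          have "norm (T r) \<le> m l + norm (R r l)"
            using close[of r l] norm_triangle_ineq2[of "T r" "R r l"] by simp
          then have "x \<le> \<bar>r\<bar> * m l + \<bar>r\<bar> * norm (R r l)"
            unfolding x_def by (metis abs_ge_zero distrib_left mult_left_mono)
          then have "l / 2 \<le> \<bar>r\<bar> * norm (R r l)"
            using True False by linarith
          then have "(l / 2)\<^sup>2 \<le> (\<bar>r\<bar> * norm (R r l))\<^sup>2"
            using True by (intro power_mono) auto
          then have "l\<^sup>2 \<le> 4 * (r\<^sup>2 * (norm (R r l))\<^sup>2)"
            by (simp add: power_mult_distrib power_divide)
          then have "p * l powr (p - 3) / r\<^sup>2 * l\<^sup>2 \<le> p * l powr (p - 3) / r\<^sup>2 * (4 * (r\<^sup>2 * (norm (R r l))\<^sup>2))"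
            using p by (intro mult_left_mono) auto
          moreover have "p * l powr (p - 3) / r\<^sup>2 * l\<^sup>2 = \<bar>r\<bar> powr (- 2) * p * l powr (p - 1)"
          proof -
            have "l powr (p - 1) = l powr (p - 3) * l\<^sup>2"
              using True powr_add[of l "p - 3" 2] by (simp add: powr_numeral)
            moreover have "\<bar>r\<bar> powr (- 2) = 1 / r\<^sup>2"
              using r by (simp add: powr_minus_divide powr_numeral)
            ultimately show ?thesis by simp
          qed
          moreover have "p * l powr (p - 3) / r\<^sup>2 * (4 * (r\<^sup>2 * (norm (R r l))\<^sup>2)) = 4 * p * l powr (p - 3) * (norm (R r l))\<^sup>2"
            using r by simp
          ultimately have "?L \<le> ?B"
            using True p by (simp add: ennreal_mult'[symmetric] ennreal_leI mult.assoc)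
          then show ?thesis by (rule order.trans) simp
        qed
      qed (auto split: split_indicator)
    qed
    finally show ?thesis .
  qed
  \<comment> \<open>The weak-type bound: the set is |r| > l / (2 m(l)), and its measure for dr / r^2
    is 4 m(l) / l.\<close>
  have tail: "(\<integral>\<^sup>+r. ?t l r \<partial>lborel) \<le> ennreal (4 * m l / l)" if l: "0 < l" for l
  proof (cases "m l = 0")
    case True
    then show ?thesis using l by simp
  next
    case False
    then have m: "0 < m l" using m0[of l] by simp
    have "(\<integral>\<^sup>+r. ?t l r \<partial>lborel) =
        (\<integral>\<^sup>+r. (\<lambda>t. ennreal (t powr (- 2)) * indicator {l / (2 * m l)<..} t) \<bar>r\<bar> \<partial>lborel)"
      using m by (intro nn_integral_cong) (auto simp: field_simps split: split_indicator)
    also have "\<dots> = 2 * (\<integral>\<^sup>+r. ennreal (r powr (- 2)) * indicator {l / (2 * m l)<..} r * indicator {0<..} r \<partial>lborel)"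
      by (intro nn_integral_abs) measurable
    also have "(\<integral>\<^sup>+r. ennreal (r powr (- 2)) * indicator {l / (2 * m l)<..} r * indicator {0<..} r \<partial>lborel) \<le>
        (\<integral>\<^sup>+r. ennreal (r powr (- 2)) * indicator {l / (2 * m l)<..} r \<partial>lborel)"
      by (intro nn_integral_mono) (auto split: split_indicator)
    also have "\<dots> = ennreal (2 * m l / l)"
      using l m by (subst nn_integral_powr_near_infinity) (auto simp: powr_minus_divide)
    finally have "(\<integral>\<^sup>+r. ?t l r \<partial>lborel) \<le> 2 * ennreal (2 * m l / l)"
      by (simp add: mult_left_mono)
    also have "\<dots> = ennreal (4 * m l / l)"
      using l m by (simp add: ennreal_mult'[symmetric] flip: ennreal_numeral)
    finally show ?thesis .
  qed
  have m_eq: "ennreal (m l) = (\<integral>\<^sup>+t. ennreal (norm (g t)) * indicator {0<..norm (g t)} l \<partial>lborel)" if l: "0 < l" for l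
  proof -
    have "ennreal (m l) = (\<integral>\<^sup>+t. ennreal (norm (g t - k l t)) \<partial>lborel)"
      unfolding m_def using g kint[of l] by (intro nn_integral_eq_integral[symmetric]) auto
    also have "\<dots> = (\<integral>\<^sup>+t. ennreal (norm (g t)) * indicator {0<..norm (g t)} l \<partial>lborel)"
      using l by (intro nn_integral_cong) (auto simp: k_def split: split_indicator)
    finally show ?thesis .
  qed
  \<comment> \<open>By \<open>m_eq\<close>, \<open>m l\<close> is the integral of
    \<open>norm (g t)\<close> over the places where it is at least \<open>l\<close>. After
    exchanging the integrals, \<open>l powr (p - 2)\<close> is integrated from 0 to
    \<open>norm (g t)\<close>, which converges since p > 1.\<close>
  have A: "(\<integral>\<^sup>+l. ?a l * (\<integral>\<^sup>+r. ?t l r \<partial>lborel) \<partial>lborel)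
      \<le> ennreal (4 * p / (p - 1)) * ennreal U"
  proof -
    have "(\<integral>\<^sup>+l. ?a l * (\<integral>\<^sup>+r. ?t l r \<partial>lborel) \<partial>lborel) \<le>
        (\<integral>\<^sup>+l. \<integral>\<^sup>+t. ennreal (4 * p * norm (g t)) * (?k l t) \<partial>lborel \<partial>lborel)"
    proof (intro nn_integral_mono)
      fix l :: real
      show "?a l * (\<integral>\<^sup>+r. ?t l r \<partial>lborel) \<le>
        (\<integral>\<^sup>+t. ennreal (4 * p * norm (g t)) * (?k l t) \<partial>lborel)"
      proof (cases "0 < l")
        case True
        have "?a l * (\<integral>\<^sup>+r. ?t l r \<partial>lborel) \<le>
            ennreal (p * l powr (p - 1)) * ennreal (4 * m l / l)"
          using True by (intro mult_mono tail) (auto split: split_indicator)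
        also have "\<dots> = ennreal (4 * p * l powr (p - 2)) * ennreal (m l)"
        proof -
          have "l powr (p - 1) / l = l powr (p - 2)"
            using True powr_diff[of l "p - 1" 1] by simp
          then show ?thesis
            using p m0[of l] True by (simp add: ennreal_mult'[symmetric] mult_ac)
               (metis mult.commute times_divide_eq_left times_divide_eq_right)
        qed
        also have "\<dots> = (\<integral>\<^sup>+t. ennreal (4 * p * l powr (p - 2)) * (ennreal (norm (g t)) * indicator {0<..norm (g t)} l) \<partial>lborel)"
          unfolding m_eq[OF True] by (rule nn_integral_cmult[symmetric]) (unfold indicator_def greaterThanAtMost_iff, measurable)
        also have "\<dots> = (\<integral>\<^sup>+t. ennreal (4 * p * norm (g t)) * (?k l t) \<partial>lborel)"
          using p by (intro nn_integral_cong) (auto simp: ennreal_mult' mult_ac)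
        finally show ?thesis .
      qed simp
    qed
    also have "\<dots> = (\<integral>\<^sup>+t. \<integral>\<^sup>+l. ennreal (4 * p * norm (g t)) * (?k l t) \<partial>lborel \<partial>lborel)"
      by (rule lborel_pair.Fubini') (unfold indicator_def greaterThanAtMost_iff, measurable)
    also have "\<dots> = (\<integral>\<^sup>+t. ennreal (4 * p / (p - 1)) * ennreal (norm (g t) powr p) \<partial>lborel)"
    proof (intro nn_integral_cong)
      fix t :: real
      have "(\<integral>\<^sup>+l. ennreal (4 * p * norm (g t)) * (?k l t) \<partial>lborel) =
          ennreal (4 * p * norm (g t)) * ennreal (norm (g t) powr (p - 1) / (p - 1))"
        using p nn_integral_powr_near_0[of "p - 2" "norm (g t)"] by (subst nn_integral_cmult) auto
      also have "norm (g t) * norm (g t) powr (p - 1) = norm (g t) powr p"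
        using powr_add[of "norm (g t)" 1 "p - 1"] by (cases "g t = 0") auto
      then have "ennreal (4 * p * norm (g t)) * ennreal (norm (g t) powr (p - 1) / (p - 1)) = ennreal (4 * p / (p - 1)) * ennreal (norm (g t) powr p)"
        using p by (simp add: ennreal_mult'[symmetric] mult.assoc)
      finally show "(\<integral>\<^sup>+l. ennreal (4 * p * norm (g t)) * (?k l t) \<partial>lborel) =
          ennreal (4 * p / (p - 1)) * ennreal (norm (g t) powr p)" .
    qed
    also have "\<dots> \<le> ennreal (4 * p / (p - 1)) * ennreal U"
      using U by (simp add: nn_integral_cmult mult_left_mono)
    finally show ?thesis .
  qed
  \<comment> \<open>The small part is nonzero at \<open>t\<close> only for
    \<open>l > norm (g t)\<close>, so \<open>l powr (p - 3)\<close> is integrated up to infinity,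
    which converges since p < 2.\<close>
  have B: "(\<integral>\<^sup>+l. ?b l * (\<integral>\<^sup>+r. ennreal ((norm (R r l))\<^sup>2) \<partial>lborel) \<partial>lborel)
      \<le> ennreal (4 * p / (2 - p)) * ennreal U"
  proof -
    have "(\<integral>\<^sup>+r. ennreal ((norm (R r l))\<^sup>2) \<partial>lborel) \<le> ennreal 1 * (\<integral>\<^sup>+t. ennreal ((norm (k l t))\<^sup>2) \<partial>lborel)" for l
      using plancherel_le[OF K lborel.sigma_finite_measure_axioms, of "\<lambda>t. t" 1 "k l"] kint[of l]
      by (simp add: R_def)
    then have le: "(\<integral>\<^sup>+r. ennreal ((norm (R r l))\<^sup>2) \<partial>lborel) \<le> (\<integral>\<^sup>+t. ennreal ((norm (k l t))\<^sup>2) \<partial>lborel)" for l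
      by simp
    have "(\<integral>\<^sup>+l. ?b l * (\<integral>\<^sup>+r. ennreal ((norm (R r l))\<^sup>2) \<partial>lborel) \<partial>lborel) \<le>
        (\<integral>\<^sup>+l. ?b l * (\<integral>\<^sup>+t. ennreal ((norm (k l t))\<^sup>2) \<partial>lborel) \<partial>lborel)"
      by (rule nn_integral_mono, rule mult_left_mono[OF le]) simp
    also have "\<dots> = (\<integral>\<^sup>+l. \<integral>\<^sup>+t. ?b l * ennreal ((norm (k l t))\<^sup>2) \<partial>lborel \<partial>lborel)"
      by (simp add: nn_integral_cmult)
    also have "\<dots> = (\<integral>\<^sup>+t. \<integral>\<^sup>+l. ?b l * ennreal ((norm (k l t))\<^sup>2) \<partial>lborel \<partial>lborel)"
      by (rule lborel_pair.Fubini') measurable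
    also have "\<dots> \<le> (\<integral>\<^sup>+t. ennreal (4 * p / (2 - p)) * ennreal (norm (g t) powr p) \<partial>lborel)"
    proof (intro nn_integral_mono)
      fix t :: real
      show "(\<integral>\<^sup>+l. ?b l * ennreal ((norm (k l t))\<^sup>2) \<partial>lborel) \<le>
          ennreal (4 * p / (2 - p)) * ennreal (norm (g t) powr p)"
      proof (cases "g t = 0")
        case True
        then have "k l t = 0" for l by (simp add: k_def)
        then show ?thesis by simp
      next
        case False
        define x where "x = norm (g t)"
        have x: "0 < x" using False by (simp add: x_def)
        have "(\<integral>\<^sup>+l. ?b l * ennreal ((norm (k l t))\<^sup>2) \<partial>lborel) \<le>
            (\<integral>\<^sup>+l. ennreal (4 * p * x\<^sup>2) * (ennreal (l powr (p - 3)) * indicator {x<..} l) \<partial>lborel)"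
          using p by (intro nn_integral_mono) (auto simp: k_def x_def[symmetric] ennreal_mult'[symmetric] mult_ac split: split_indicator)
        also have "\<dots> = ennreal (4 * p * x\<^sup>2) * ennreal (x powr (p - 2) / (2 - p))"
          using p x nn_integral_powr_near_infinity[of "p - 3" x] by (subst nn_integral_cmult) auto
        also have "x\<^sup>2 * x powr (p - 2) = x powr p"
          using powr_add[of x 2 "p - 2"] x by (simp add: powr_numeral)
        then have "ennreal (4 * p * x\<^sup>2) * ennreal (x powr (p - 2) / (2 - p)) = ennreal (4 * p / (2 - p)) * ennreal (x powr p)"
          using p by (simp add: ennreal_mult'[symmetric] mult.assoc)
        finally show ?thesis by (simp add: x_def)
      qed
    qed
    also have "\<dots> \<le> ennreal (4 * p / (2 - p)) * ennreal U"
      using U by (simp add: nn_integral_cmult mult_left_mono)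
    finally show ?thesis .
  qed
  have "(\<integral>\<^sup>+r. ennreal (norm (T r) powr p * \<bar>r\<bar> powr (p - 2)) \<partial>lborel) \<le>
     (\<integral>\<^sup>+r. \<integral>\<^sup>+l. ?a l * (?t l r) +
        ?b l * ennreal ((norm (R r l))\<^sup>2) \<partial>lborel \<partial>lborel)"
    using AE_lborel_singleton[of "0::real"] by (intro nn_integral_mono_AE, elim eventually_mono) (rule layer)
  also have "\<dots> = (\<integral>\<^sup>+l. \<integral>\<^sup>+r. ?a l * (?t l r) +
        ?b l * ennreal ((norm (R r l))\<^sup>2) \<partial>lborel \<partial>lborel)"
    by (rule lborel_pair.Fubini') measurable
  also have "\<dots> = (\<integral>\<^sup>+l. ?a l * (\<integral>\<^sup>+r. ?t l r \<partial>lborel) +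
        ?b l * (\<integral>\<^sup>+r. ennreal ((norm (R r l))\<^sup>2) \<partial>lborel) \<partial>lborel)"
    by (intro nn_integral_cong) (simp add: nn_integral_add nn_integral_cmult)
  also have "\<dots> = (\<integral>\<^sup>+l. ?a l * (\<integral>\<^sup>+r. ?t l r \<partial>lborel) \<partial>lborel) +
        (\<integral>\<^sup>+l. ?b l * (\<integral>\<^sup>+r. ennreal ((norm (R r l))\<^sup>2) \<partial>lborel) \<partial>lborel)"
    by (rule nn_integral_add) measurable
  also have "\<dots> \<le> ennreal (4 * p / (p - 1)) * ennreal U + ennreal (4 * p / (2 - p)) * ennreal U"
    by (intro add_mono A B)
  also have "\<dots> = ennreal (4 * p / (p - 1) + 4 * p / (2 - p)) * ennreal U"
    using p by (simp add: distrib_right)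
  finally show ?thesis by (simp add: T_def)
qed

text \<open>Weighted geometric mean of the constant of \<open>hardy_littlewood_paley\<close> at
  \<open>p\<close> and of \<open>hausdorff_young_le\<close> at \<open>P\<close> with
  \<open>c = 1\<close>.\<close>

definition pitt_const :: "real \<Rightarrow> real" where
  "pitt_const P = (let p = P / (P - 1); \<theta> = 2 * (P - 1) / (3 * (P - 2)) in
     (4 * p / (p - 1) + 4 * p / (2 - p)) powr \<theta> * (4 * P / (P - 2) * 2 powr (P - 2)) powr (1 - \<theta>))"

lemma pitt_const_pos:
  assumes "4 < P"
  shows "0 < pitt_const P"
proof -
  define p where "p = P / (P - 1)"
  have p: "1 < p" "p < 2" using assms by (auto simp: p_def field_simps)
  then have "0 < 4 * p / (p - 1) + 4 * p / (2 - p)" by (intro add_pos_pos) auto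
  then show ?thesis using assms by (simp add: pitt_const_def Let_def p_def[symmetric])
qed

text \<open>Hoelder's inequality between the weighted estimate for
  \<open>norm (T r) powr p * \<bar>r\<bar> powr (p - 2)\<close> and the unweighted one for
  \<open>norm (T r) powr P\<close>. The parameter \<theta> is forced by the weight,
  \<open>(p - 2) * \<theta> = - 2 / 3\<close>; the power \<open>P / 3\<close> of the transform and
  the power \<open>(P - 1) / 3\<close> of \<open>U\<close> then come out automatically. The
  condition \<theta> < 1 is exactly P > 4.\<close>

lemma pitt:
  fixes g :: "real \<Rightarrow> complex"
  assumes P: "4 < P" and g: "integrable lborel g" and "0 < U"
    and U: "(\<integral>\<^sup>+t. ennreal (norm (g t) powr (P / (P - 1))) \<partial>lborel) \<le> ennreal U"
  shows "(\<integral>\<^sup>+r. ennreal (norm (LINT t|lborel. g t * echar (r * t)) powr (P / 3) * \<bar>r\<bar> powr (- 2 / 3)) \<partial>lborel)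
    \<le> ennreal (pitt_const P * U powr ((P - 1) / 3))"
proof -
  define p where "p = P / (P - 1)"
  have p: "1 < p" "p < 2" using P by (auto simp: p_def field_simps)
  define \<theta> where "\<theta> = 2 * (P - 1) / (3 * (P - 2))"
  have \<theta>: "0 < \<theta>" "\<theta> < 1" using P by (auto simp: \<theta>_def field_simps)
  define K1 where "K1 = 4 * p / (p - 1) + 4 * p / (2 - p)"
  define K2 where "K2 = 4 * P / (P - 2) * 2 powr (P - 2)"
  have K: "0 < K1" "0 < K2" using p P by (auto simp: K1_def K2_def intro!: add_pos_pos)
  obtain \<gamma> and \<Gamma> :: "nat \<Rightarrow> real \<Rightarrow> real" where kernel: "fourier_kernel \<gamma> \<Gamma>"
    using fourier_kernel_real by blast
  have e1: "p * \<theta> + P * (1 - \<theta>) = P / 3"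
  proof -
    have "(P - p) * \<theta> = 2 * P / 3"
      using P by (simp add: p_def \<theta>_def divide_simps) (simp add: algebra_simps)
    then show ?thesis by (simp add: algebra_simps)
  qed
  have e2: "(p - 2) * \<theta> = - 2 / 3"
    using P by (simp add: p_def \<theta>_def divide_simps) (simp add: algebra_simps)
  have e3: "\<theta> + (P - 1) * (1 - \<theta>) = (P - 1) / 3"
  proof -
    have "(P - 2) * \<theta> = 2 * (P - 1) / 3"
      using P by (simp add: \<theta>_def divide_simps)
    then show ?thesis by (simp add: algebra_simps)
  qed
  have [measurable]: "g \<in> borel_measurable borel" using borel_measurable_integrable[OF g] by simp
  define T where "T r = (LINT t|lborel. g t * echar (r * t))" for r
  have [measurable]: "T \<in> borel_measurable borel"
    unfolding T_def by measurable
  have 1: "(\<integral>\<^sup>+r. ennreal (norm (T r) powr p * \<bar>r\<bar> powr (p - 2)) \<partial>lborel) \<le> ennreal (K1 * U)"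
    using hardy_littlewood_paley[OF g p, of U] U K by (simp add: p_def[symmetric] K1_def[symmetric] T_def ennreal_mult')
  have 2: "(\<integral>\<^sup>+r. ennreal (norm (T r) powr P) \<partial>lborel) \<le> ennreal (K2 * U powr (P - 1))"
    using hausdorff_young_le[OF kernel lborel.sigma_finite_measure_axioms, of "\<lambda>t. t" 1 g P U] g U P \<open>0 < U\<close>
    by (simp add: T_def K2_def)
  have "norm (T r) powr (P / 3) * \<bar>r\<bar> powr (- 2 / 3) =
      (norm (T r) powr p * \<bar>r\<bar> powr (p - 2)) powr \<theta> * (norm (T r) powr P) powr (1 - \<theta>)" for r
    by (simp add: powr_mult powr_powr e2 flip: e1 powr_add)
  then have "(\<integral>\<^sup>+r. ennreal (norm (T r) powr (P / 3) * \<bar>r\<bar> powr (- 2 / 3)) \<partial>lborel) =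
      (\<integral>\<^sup>+r. ennreal ((norm (T r) powr p * \<bar>r\<bar> powr (p - 2)) powr \<theta> * (norm (T r) powr P) powr (1 - \<theta>)) \<partial>lborel)"
    by simp
  also have "\<dots> \<le> ennreal ((K1 * U) powr \<theta> * (K2 * U powr (P - 1)) powr (1 - \<theta>))"
    using 1 2 \<theta> K \<open>0 < U\<close> by (intro nn_integral_powr_interpolation) auto
  also have "(K1 * U) powr \<theta> * (K2 * U powr (P - 1)) powr (1 - \<theta>) = K1 powr \<theta> * K2 powr (1 - \<theta>) * U powr ((P - 1) / 3)"
    using K \<open>0 < U\<close> by (simp add: powr_mult powr_powr powr_add flip: e3)
  finally show ?thesis
    by (simp add: T_def pitt_const_def Let_def K1_def K2_def p_def \<theta>_def)
qed

section \<open>Fractional integrals\<close>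

text \<open>
  By symmetry only the pairs with \<open>B y \<le> B x\<close> matter. For fixed \<open>x\<close> the kernel is cut at distance
  \<open>V / B(x)\<^sup>a\<close>: near \<open>x\<close> one bounds \<open>B y\<close> by \<open>B x\<close>, far from \<open>x\<close> one uses Hoelder's inequality.
\<close>

lemma hardy_littlewood_sobolev:
  fixes v B :: "'x \<Rightarrow> real"
  assumes \<nu>: "sigma_finite_measure \<nu>" and [measurable]: "v \<in> borel_measurable \<nu>" "B \<in> borel_measurable \<nu>"
    and push: "\<And>G::real \<Rightarrow> ennreal. G \<in> borel_measurable borel \<Longrightarrow>
      (\<integral>\<^sup>+\<omega>. G (v \<omega>) \<partial>\<nu>) \<le> (\<integral>\<^sup>+x. G x \<partial>lborel)"
    and B0: "\<And>x. 0 \<le> B x" and g: "0 < g" "g < 1"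
    and V: "(\<integral>\<^sup>+x. ennreal (B x powr (2 / (2 - g))) \<partial>\<nu>) \<le> ennreal V" and "0 < V"
  shows "(\<integral>\<^sup>+x. \<integral>\<^sup>+y. ennreal (B x * B y * \<bar>v x - v y\<bar> powr (- g)) \<partial>\<nu> \<partial>\<nu>)
    \<le> ennreal (2 * (2 / (1 - g) + 2 powr (g / 2)) * V powr (2 - g))"
proof -
  interpret sigma_finite_measure \<nu> by (rule \<nu>)
  interpret pair_sigma_finite \<nu> \<nu> ..
  \<comment> \<open>The exponent dictated by scaling, \<open>2 / a + g = 2\<close>. The identities
    that follow say that the inner integral contributes \<open>B x powr (a * g / 2)\<close>, and
    that one more factor \<open>B x\<close> turns this into \<open>B x powr a\<close>, whose
    integral is bounded by \<open>V\<close>.\<close>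
  define a where "a = 2 / (2 - g)"
  have a: "0 < a" "1 / a = 1 - g / 2" "1 + a * g / 2 = a" "1 - a * (1 - g) = a * g / 2"
    using g by (auto simp: a_def field_simps)
  define K where "K x y = \<bar>v x - v y\<bar> powr (- g)" for x y
  define C where "C = 2 / (1 - g) + 2 powr (g / 2)"
  let ?h = "\<lambda>x y. ennreal (B x * B y * K x y) * indicator {p. B (snd p) \<le> B (fst p)} (x, y)"
  let ?h2 = "\<lambda>x y. ennreal (B y * B x * K y x) * indicator {p. B (snd p) \<le> B (fst p)} (y, x)"
  have inner: "(\<integral>\<^sup>+y. ennreal (B y * K x y) * indicator {y. B y \<le> B x} y \<partial>\<nu>) \<le> ennreal (C * V powr (1 - g) * B x powr (a * g / 2))"
    if Bx: "0 < B x" for x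
  proof -
    \<comment> \<open>This radius balances the two regions: the near bound, of size
      \<open>B x * r powr (1 - g)\<close>, and the far bound, of size
      \<open>V powr (1 / a) * r powr (- g / 2)\<close>, both become multiples of
      \<open>V powr (1 - g) * B x powr (a * g / 2)\<close>.\<close>
    define r where "r = V / B x powr a"
    have r: "0 < r" using \<open>0 < V\<close> Bx by (simp add: r_def)
    have reflect: "(\<integral>\<^sup>+t. f \<bar>v x - t\<bar> \<partial>lborel) = 2 * (\<integral>\<^sup>+t. f t * indicator {0<..} t \<partial>lborel)"
      if [measurable]: "f \<in> borel_measurable borel" for f :: "real \<Rightarrow> ennreal"
    proof -
      have "(\<integral>\<^sup>+t. f \<bar>v x - t\<bar> \<partial>lborel) = (\<integral>\<^sup>+t. f \<bar>t + - v x\<bar> \<partial>lborel)"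
        by (simp add: abs_minus_commute)
      also have "\<dots> = (\<integral>\<^sup>+t. f \<bar>t\<bar> \<partial>lborel)"
        by (rule nn_integral_lborel_translate) measurable
      finally show ?thesis by (simp add: nn_integral_abs)
    qed
    have near: "(\<integral>\<^sup>+y. ennreal (B x * K x y) * indicator {y. \<bar>v x - v y\<bar> \<le> r} y \<partial>\<nu>) \<le> ennreal (2 / (1 - g) * (B x * r powr (1 - g)))"
    proof -
      have "(\<integral>\<^sup>+y. ennreal (B x * K x y) * indicator {y. \<bar>v x - v y\<bar> \<le> r} y \<partial>\<nu>) =
          ennreal (B x) * (\<integral>\<^sup>+y. (\<lambda>t. ennreal (t powr (- g)) * indicator {..r} t) \<bar>v x - v y\<bar> \<partial>\<nu>)"
        using Bx by (subst nn_integral_cmult[symmetric])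
          (auto intro!: nn_integral_cong simp: K_def ennreal_mult' split: split_indicator)
      also have "(\<integral>\<^sup>+y. (\<lambda>t. ennreal (t powr (- g)) * indicator {..r} t) \<bar>v x - v y\<bar> \<partial>\<nu>) \<le>
          (\<integral>\<^sup>+t. (\<lambda>t. ennreal (t powr (- g)) * indicator {..r} t) \<bar>v x - t\<bar> \<partial>lborel)"
        by (rule push) measurable
      also have "\<dots> = 2 * (\<integral>\<^sup>+t. ennreal (t powr (- g)) * indicator {..r} t * indicator {0<..} t \<partial>lborel)"
        by (rule reflect) measurable
      also have "(\<integral>\<^sup>+t. ennreal (t powr (- g)) * indicator {..r} t * indicator {0<..} t \<partial>lborel) =
          (\<integral>\<^sup>+t. ennreal (t powr (- g)) * indicator {0<..r} t \<partial>lborel)"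
        by (intro nn_integral_cong) (auto split: split_indicator)
      also have "\<dots> = ennreal (r powr (1 - g) / (1 - g))"
        using g r nn_integral_powr_near_0[of "- g" r] by simp
      also have "ennreal (B x) * (2 * ennreal (r powr (1 - g) / (1 - g))) = ennreal (2 / (1 - g) * (B x * r powr (1 - g)))"
        using g Bx by (simp add: ennreal_mult'[symmetric] mult_ac flip: ennreal_numeral)
      finally show ?thesis by (simp add: mult_left_mono)
    qed
    have far: "(\<integral>\<^sup>+y. ennreal (B y * K x y) * indicator {y. r < \<bar>v x - v y\<bar>} y \<partial>\<nu>) \<le> ennreal (V powr (1 / a) * (2 / r) powr (g / 2))"
    proof -
      \<comment> \<open>The exponent conjugate to \<open>a\<close> is \<open>2 / g\<close>, and the
        kernel raised to it is the inverse square of the distance whatever \<open>g\<close> is; this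
        is integrable away from \<open>x\<close>.\<close>
      define f where "f y = \<bar>v x - v y\<bar> powr (- 2) * indicator {y. r < \<bar>v x - v y\<bar>} y" for y
      have [measurable]: "f \<in> borel_measurable \<nu>" unfolding f_def by measurable
      have "(\<integral>\<^sup>+y. ennreal (f y) \<partial>\<nu>) = (\<integral>\<^sup>+y. (\<lambda>t. ennreal (t powr (- 2)) * indicator {r<..} t) \<bar>v x - v y\<bar> \<partial>\<nu>)"
        by (intro nn_integral_cong) (auto simp: f_def split: split_indicator)
      also have "\<dots> \<le> (\<integral>\<^sup>+t. (\<lambda>t. ennreal (t powr (- 2)) * indicator {r<..} t) \<bar>v x - t\<bar> \<partial>lborel)"
        by (rule push) measurable
      also have "\<dots> = 2 * (\<integral>\<^sup>+t. ennreal (t powr (- 2)) * indicator {r<..} t * indicator {0<..} t \<partial>lborel)"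
        by (rule reflect) measurable
      also have "(\<integral>\<^sup>+t. ennreal (t powr (- 2)) * indicator {r<..} t * indicator {0<..} t \<partial>lborel) =
          (\<integral>\<^sup>+t. ennreal (t powr (- 2)) * indicator {r<..} t \<partial>lborel)"
        using r by (intro nn_integral_cong) (auto split: split_indicator)
      also have "\<dots> = ennreal (1 / r)"
        using r nn_integral_powr_near_infinity[of "- 2" r] by (simp add: powr_minus_divide)
      also have "2 * ennreal (1 / r) = ennreal (2 / r)"
        using r by (simp add: ennreal_mult'[symmetric] flip: ennreal_numeral)
      finally have f: "(\<integral>\<^sup>+y. ennreal (f y) \<partial>\<nu>) \<le> ennreal (2 / r)" .
      have "(\<integral>\<^sup>+y. ennreal (B y * K x y) * indicator {y. r < \<bar>v x - v y\<bar>} y \<partial>\<nu>) =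
          (\<integral>\<^sup>+y. ennreal ((B y powr a) powr (1 / a) * f y powr (1 - 1 / a)) \<partial>\<nu>)"
      proof (intro nn_integral_cong)
        fix y
        have "(B y powr a) powr (1 / a) = B y"
          using a(1) B0[of y] by (simp add: powr_powr)
        moreover have "f y powr (1 - 1 / a) = K x y * indicator {y. r < \<bar>v x - v y\<bar>} y"
          using a(2) by (auto simp: f_def K_def powr_powr split: split_indicator)
        ultimately show "ennreal (B y * K x y) * indicator {y. r < \<bar>v x - v y\<bar>} y =
            ennreal ((B y powr a) powr (1 / a) * f y powr (1 - 1 / a))"
          by (auto split: split_indicator)
      qed
      also have "\<dots> \<le> ennreal (V powr (1 / a) * (2 / r) powr (1 - 1 / a))"
        using f V \<open>0 < V\<close> r a g by (intro nn_integral_powr_interpolation) (auto simp: a_def f_def)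
      finally show ?thesis using a(2) by simp
    qed
    have "(\<integral>\<^sup>+y. ennreal (B y * K x y) * indicator {y. B y \<le> B x} y \<partial>\<nu>) \<le>
        (\<integral>\<^sup>+y. ennreal (B x * K x y) * indicator {y. \<bar>v x - v y\<bar> \<le> r} y + ennreal (B y * K x y) * indicator {y. r < \<bar>v x - v y\<bar>} y \<partial>\<nu>)"
      by (intro nn_integral_mono) (auto simp: K_def intro!: ennreal_leI mult_right_mono split: split_indicator)
    also have "\<dots> = (\<integral>\<^sup>+y. ennreal (B x * K x y) * indicator {y. \<bar>v x - v y\<bar> \<le> r} y \<partial>\<nu>) +
        (\<integral>\<^sup>+y. ennreal (B y * K x y) * indicator {y. r < \<bar>v x - v y\<bar>} y \<partial>\<nu>)"
      unfolding K_def by (rule nn_integral_add) measurable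
    also have "\<dots> \<le> ennreal (2 / (1 - g) * (B x * r powr (1 - g))) + ennreal (V powr (1 / a) * (2 / r) powr (g / 2))"
      by (intro add_mono near far)
    also have "\<dots> = ennreal (2 / (1 - g) * (B x * r powr (1 - g)) + V powr (1 / a) * (2 / r) powr (g / 2))"
      using g Bx by (intro ennreal_plus[symmetric]) auto
    also have "B x * r powr (1 - g) = V powr (1 - g) * B x powr (a * g / 2)"
    proof -
      have "B x * r powr (1 - g) = V powr (1 - g) * (B x powr 1 * B x powr (- (a * (1 - g))))"
        using Bx \<open>0 < V\<close> by (simp add: r_def powr_divide powr_powr powr_minus_divide)
      also have "B x powr 1 * B x powr (- (a * (1 - g))) = B x powr (a * g / 2)"
        by (simp only: powr_add[symmetric] add_uminus_conv_diff a(4))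
      finally show ?thesis .
    qed
    also have "V powr (1 / a) * (2 / r) powr (g / 2) = 2 powr (g / 2) * (V powr (1 - g) * B x powr (a * g / 2))"
    proof -
      have "(2 / r) powr (g / 2) = 2 powr (g / 2) * (V powr (- (g / 2)) * B x powr (a * g / 2))"
        using Bx \<open>0 < V\<close> by (simp add: r_def powr_divide powr_mult powr_powr powr_minus_divide)
      moreover have "V powr (1 / a) * V powr (- (g / 2)) = V powr (1 - g)"
        by (simp add: a(2) powr_add[symmetric])
      ultimately show ?thesis by (simp add: mult_ac)
    qed
    finally show ?thesis by (simp add: C_def algebra_simps)
  qed
  have half: "(\<integral>\<^sup>+x. \<integral>\<^sup>+y. ?h x y \<partial>\<nu> \<partial>\<nu>)
      \<le> ennreal (C * V powr (2 - g))"
  proof -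
    have "(\<integral>\<^sup>+x. \<integral>\<^sup>+y. ?h x y \<partial>\<nu> \<partial>\<nu>) \<le>
        (\<integral>\<^sup>+x. ennreal (C * V powr (1 - g)) * ennreal (B x powr a) \<partial>\<nu>)"
    proof (intro nn_integral_mono)
      fix x
      have "(\<integral>\<^sup>+y. ?h x y \<partial>\<nu>) =
          (\<integral>\<^sup>+y. ennreal (B x) * (ennreal (B y * K x y) * indicator {y. B y \<le> B x} y) \<partial>\<nu>)"
        using B0[of x] by (intro nn_integral_cong) (auto simp: ennreal_mult' mult.assoc split: split_indicator)
      also have "\<dots> = ennreal (B x) * (\<integral>\<^sup>+y. ennreal (B y * K x y) * indicator {y. B y \<le> B x} y \<partial>\<nu>)"
        unfolding K_def by (rule nn_integral_cmult) measurable
      also have "\<dots> \<le> ennreal (C * V powr (1 - g)) * ennreal (B x powr a)"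
      proof (cases "B x = 0")
        case False
        then have Bx: "0 < B x" using B0[of x] by simp
        have "ennreal (B x) * (\<integral>\<^sup>+y. ennreal (B y * K x y) * indicator {y. B y \<le> B x} y \<partial>\<nu>) \<le>
            ennreal (B x) * ennreal (C * V powr (1 - g) * B x powr (a * g / 2))"
          by (intro mult_left_mono inner Bx) simp
        also have "\<dots> = ennreal (C * V powr (1 - g) * (B x powr 1 * B x powr (a * g / 2)))"
          using Bx by (simp add: ennreal_mult'[symmetric] mult_ac)
        also have "B x powr 1 * B x powr (a * g / 2) = B x powr a"
          by (simp only: powr_add[symmetric] a(3))
        finally show ?thesis by (simp add: ennreal_mult'')
      qed simp
      finally show "(\<integral>\<^sup>+y. ?h x y \<partial>\<nu>)
        \<le> ennreal (C * V powr (1 - g)) * ennreal (B x powr a)" .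
    qed
    also have "\<dots> \<le> ennreal (C * V powr (1 - g)) * ennreal V"
      using V by (simp add: nn_integral_cmult a_def mult_left_mono)
    also have "\<dots> = ennreal (C * (V powr (1 - g) * V powr 1))"
      using \<open>0 < V\<close> by (simp add: ennreal_mult''[symmetric] mult.assoc)
    also have "V powr (1 - g) * V powr 1 = V powr (2 - g)"
      using \<open>0 < V\<close> powr_add[of V "1 - g" 1] by simp
    finally show ?thesis .
  qed
  have C0: "0 \<le> C" using g by (simp add: C_def)
  have "(\<integral>\<^sup>+x. \<integral>\<^sup>+y. ennreal (B x * B y * K x y) \<partial>\<nu> \<partial>\<nu>) \<le>
      (\<integral>\<^sup>+x. \<integral>\<^sup>+y. ?h x y +
        ?h2 x y \<partial>\<nu> \<partial>\<nu>)"
    by (intro nn_integral_mono) (auto simp: K_def abs_minus_commute mult.commute split: split_indicator)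
  also have "\<dots> = (\<integral>\<^sup>+x. (\<integral>\<^sup>+y. ?h x y \<partial>\<nu>) +
        (\<integral>\<^sup>+y. ?h2 x y \<partial>\<nu>) \<partial>\<nu>)"
    unfolding K_def indicator_def by (intro nn_integral_cong nn_integral_add) measurable
  also have "\<dots> = (\<integral>\<^sup>+x. (\<integral>\<^sup>+y. ?h x y \<partial>\<nu>) \<partial>\<nu>) +
        (\<integral>\<^sup>+x. (\<integral>\<^sup>+y. ?h2 x y \<partial>\<nu>) \<partial>\<nu>)"
    unfolding K_def indicator_def by (intro nn_integral_add) measurable
  also have "(\<integral>\<^sup>+x. (\<integral>\<^sup>+y. ?h2 x y \<partial>\<nu>) \<partial>\<nu>) =
      (\<integral>\<^sup>+y. (\<integral>\<^sup>+x. ?h2 x y \<partial>\<nu>) \<partial>\<nu>)"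
    unfolding K_def indicator_def by (rule Fubini') measurable
  also have "(\<integral>\<^sup>+x. (\<integral>\<^sup>+y. ?h x y \<partial>\<nu>) \<partial>\<nu>) +
      (\<integral>\<^sup>+y. (\<integral>\<^sup>+x. ?h2 x y \<partial>\<nu>) \<partial>\<nu>)
      \<le> ennreal (C * V powr (2 - g)) + ennreal (C * V powr (2 - g))"
    by (intro add_mono half)
  also have "\<dots> = ennreal (2 * C * V powr (2 - g))"
    using C0 by (simp add: ennreal_plus[symmetric] mult.assoc del: ennreal_plus)
  finally show ?thesis by (simp add: K_def C_def)
qed

section \<open>Restriction to convex graphs\<close>

text \<open>The Hausdorff--Young constant at the exponent \<open>P / 2\<close> for an image measure
  bounded by twice Lebesgue measure, times the Hardy--Littlewood--Sobolev constant for the kernel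
  exponent \<open>2 / (P - 2)\<close> raised to the power \<open>P / 2 - 1\<close>.\<close>

definition extension_const :: "real \<Rightarrow> real" where
  "extension_const P = 4 * (P / 2) * 2 / (P / 2 - 2) * 2 powr (P / 2 - 2) *
     (2 * (2 / (1 - 2 / (P - 2)) + 2 powr (1 / (P - 2)))) powr (P / 2 - 1)"

lemma extension_const_pos:
  assumes "4 < P"
  shows "0 < extension_const P"
proof -
  have "0 < 1 - 2 / (P - 2)" using assms by (simp add: field_simps)
  then have "0 < 2 * (2 / (1 - 2 / (P - 2)) + 2 powr (1 / (P - 2)))"
    by (intro mult_pos_pos add_pos_pos divide_pos_pos) auto
  then show ?thesis
    using assms by (auto simp: extension_const_def intro!: mult_pos_pos divide_pos_pos)
qed

locale convex_curve =
  fixes k k' k'' :: "real \<Rightarrow> real"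
  assumes deriv_k: "\<And>x. (k has_real_derivative k' x) (at x)"
    and deriv_k': "\<And>x. (k' has_real_derivative k'' x) (at x)"
    and continuous_k'': "continuous_on UNIV k''"
    and k''_nonneg: "\<And>x. 0 \<le> k'' x"
begin

lemma continuous_k: "continuous_on UNIV k" and continuous_k': "continuous_on UNIV k'"
  using deriv_k deriv_k' by (auto intro!: continuous_at_imp_continuous_on DERIV_isCont)

lemma measurable_k [measurable]:
  "k \<in> borel_measurable borel" "k' \<in> borel_measurable borel" "k'' \<in> borel_measurable borel"
  by (auto intro!: borel_measurable_continuous_onI continuous_k continuous_k' continuous_k'')

lemma k'_mono: "x \<le> y \<Longrightarrow> k' x \<le> k' y"
  by (rule DERIV_nonneg_imp_nondecreasing) (use deriv_k' k''_nonneg in blast)+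

text \<open>Equal slopes make \<open>k'\<close> constant in between, whereas
  \<open>k'' x > 0\<close> would make it increase to the right of \<open>x\<close>. Consequently the
  affine density vanishes at one of two distinct points whenever the Jacobian of the sum map
  vanishes.\<close>

lemma k''_eq_0:
  assumes "x < y" "k' x = k' y"
  shows "k'' x = 0"
proof (rule ccontr)
  assume "k'' x \<noteq> 0"
  then have "0 < k'' x" using k''_nonneg[of x] by simp
  from DERIV_pos_inc_right[OF deriv_k' this]
  obtain d where d: "0 < d" "\<And>h. 0 < h \<Longrightarrow> h < d \<Longrightarrow> k' x < k' (x + h)" by blast
  define h where "h = min (d / 2) (y - x)"
  have "0 < h" "h < d" "x + h \<le> y" using d assms by (auto simp: h_def)
  then have "k' x < k' y" using d(2)[of h] k'_mono[of "x + h" y] by simp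
  then show False using assms by simp
qed

definition affine_density :: "real \<Rightarrow> real" where
  "affine_density x = k'' x powr (1 / 3)"

lemma affine_density_nonneg [simp]: "0 \<le> affine_density x"
  by (simp add: affine_density_def)

lemma measurable_affine_density [measurable]: "affine_density \<in> borel_measurable borel"
  unfolding affine_density_def by measurable

text \<open>The factor 2 accounts for swapping the two points. For a fixed sum \<open>a\<close> the
  function \<open>k x + k (a - x)\<close> is symmetric about \<open>a / 2\<close> and nondecreasing
  beyond it, with derivative \<open>k' x - k' (a - x)\<close>. A substitution in one variable on
  each half therefore replaces the planar change of variables.\<close>

lemma nn_integral_sum_map_le:
  fixes G :: "real \<times> real \<Rightarrow> ennreal"
  assumes [measurable]: "G \<in> borel_measurable borel"
  shows "(\<integral>\<^sup>+p. ennreal \<bar>k' (fst p) - k' (snd p)\<bar> * G (fst p + snd p, k (fst p) + k (snd p)) \<partial>(lborel \<Otimes>\<^sub>M lborel))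
    \<le> 2 * (\<integral>\<^sup>+z. G z \<partial>lborel)"
proof -
  have Gm [measurable]: "G \<in> borel_measurable (borel \<Otimes>\<^sub>M borel)" by (simp add: borel_prod)
  have fixed_sum: "(\<integral>\<^sup>+x. ennreal \<bar>k' x - k' (a - x)\<bar> * G (a, k x + k (a - x)) \<partial>lborel) \<le> 2 * (\<integral>\<^sup>+b. G (a, b) \<partial>lborel)" for a
  proof -
    define F where "F x = ennreal \<bar>k' x - k' (a - x)\<bar> * G (a, k x + k (a - x))" for x
    have [measurable]: "F \<in> borel_measurable borel" unfolding F_def by measurable
    have F_sym: "F (a - x) = F x" for x
      by (simp add: F_def abs_minus_commute add.commute)
    have upper: "(\<integral>\<^sup>+x. F x * indicator {a / 2..} x \<partial>lborel) \<le> (\<integral>\<^sup>+b. G (a, b) \<partial>lborel)"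
    proof -
      have "(\<integral>\<^sup>+x. F x * indicator {a / 2..} x \<partial>lborel) =
          (\<integral>\<^sup>+x. G (a, k x + k (a - x)) * ennreal (k' x - k' (a - x)) * indicator {a / 2..} x \<partial>lborel)"
      proof (intro nn_integral_cong)
        fix x
        show "F x * indicator {a / 2..} x = G (a, k x + k (a - x)) * ennreal (k' x - k' (a - x)) * indicator {a / 2..} x"
          using k'_mono[of "a - x" x] by (auto simp: F_def mult.commute split: split_indicator)
      qed
      also have "\<dots> \<le> (\<integral>\<^sup>+b. G (a, b) \<partial>lborel)"
      proof (rule nn_integral_substitution_le[where G="\<lambda>b. G (a, b)" and g="\<lambda>x. k x + k (a - x)"])
        show "((\<lambda>x. k x + k (a - x)) has_real_derivative k' x - k' (a - x)) (at x)" for x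
        proof -
          have "((\<lambda>x. k (a - x)) has_real_derivative k' (a - x) * (- 1)) (at x)"
            by (rule DERIV_chain2[where f=k and g="\<lambda>x. a - x", OF deriv_k]) (auto intro!: derivative_eq_intros)
          from DERIV_add[OF deriv_k this] show ?thesis by simp
        qed
        show "continuous_on UNIV (\<lambda>x. k' x - k' (a - x))"
          by (intro continuous_intros continuous_on_compose2[OF continuous_k']) auto
      qed (use k'_mono[of "a - x" x for x] in auto)
      finally show ?thesis .
    qed
    have "(\<integral>\<^sup>+x. F x \<partial>lborel) \<le> (\<integral>\<^sup>+x. F x * indicator {a / 2..} x + F x * indicator {..a / 2} x \<partial>lborel)"
      by (intro nn_integral_mono) (auto split: split_indicator)
    also have "\<dots> = (\<integral>\<^sup>+x. F x * indicator {a / 2..} x \<partial>lborel) + (\<integral>\<^sup>+x. F x * indicator {..a / 2} x \<partial>lborel)"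
      by (rule nn_integral_add) measurable
    also have "(\<integral>\<^sup>+x. F x * indicator {..a / 2} x \<partial>lborel) = (\<integral>\<^sup>+x. F x * indicator {a / 2..} x \<partial>lborel)"
      by (subst nn_integral_real_affine[where c="-1" and t=a])
         (auto simp: F_sym intro!: nn_integral_cong split: split_indicator)
    finally have "(\<integral>\<^sup>+x. F x \<partial>lborel) \<le> 2 * (\<integral>\<^sup>+x. F x * indicator {a / 2..} x \<partial>lborel)"
      by (simp add: mult_2)
    also have "\<dots> \<le> 2 * (\<integral>\<^sup>+b. G (a, b) \<partial>lborel)"
      by (intro mult_left_mono upper) simp
    finally show ?thesis by (simp add: F_def)
  qed
  have "(\<integral>\<^sup>+p. ennreal \<bar>k' (fst p) - k' (snd p)\<bar> * G (fst p + snd p, k (fst p) + k (snd p)) \<partial>(lborel \<Otimes>\<^sub>M lborel)) =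
      (\<integral>\<^sup>+x. \<integral>\<^sup>+y. ennreal \<bar>k' x - k' y\<bar> * G (x + y, k x + k y) \<partial>lborel \<partial>lborel)"
    by (subst lborel.nn_integral_fst[symmetric]) auto
  also have "\<dots> = (\<integral>\<^sup>+x. \<integral>\<^sup>+a. ennreal \<bar>k' x - k' (a - x)\<bar> * G (a, k x + k (a - x)) \<partial>lborel \<partial>lborel)"
  proof (rule nn_integral_cong)
    fix x :: real
    show "(\<integral>\<^sup>+y. ennreal \<bar>k' x - k' y\<bar> * G (x + y, k x + k y) \<partial>lborel) =
        (\<integral>\<^sup>+a. ennreal \<bar>k' x - k' (a - x)\<bar> * G (a, k x + k (a - x)) \<partial>lborel)"
      by (subst nn_integral_real_affine[where c=1 and t="- x"]) auto
  qed
  also have "\<dots> = (\<integral>\<^sup>+a. \<integral>\<^sup>+x. ennreal \<bar>k' x - k' (a - x)\<bar> * G (a, k x + k (a - x)) \<partial>lborel \<partial>lborel)"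
    by (rule lborel_pair.Fubini') measurable
  also have "\<dots> \<le> (\<integral>\<^sup>+a. 2 * (\<integral>\<^sup>+b. G (a, b) \<partial>lborel) \<partial>lborel)"
    by (intro nn_integral_mono fixed_sum)
  also have "\<dots> = 2 * (\<integral>\<^sup>+a. \<integral>\<^sup>+b. G (a, b) \<partial>lborel \<partial>lborel)"
    by (rule nn_integral_cmult) measurable
  also have "(\<integral>\<^sup>+a. \<integral>\<^sup>+b. G (a, b) \<partial>lborel \<partial>lborel) = (\<integral>\<^sup>+z. G z \<partial>lborel)"
    by (subst lborel.nn_integral_fst) (auto simp: lborel_prod)
  finally show ?thesis .
qed

definition extension :: "(real \<Rightarrow> complex) \<Rightarrow> real \<times> real \<Rightarrow> complex" where
  "extension f y = (LINT x|lborel. (f x * complex_of_real (affine_density x)) * echar (fst y * x + snd y * k x))"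

text \<open>
  \<open>(extension f)\<^sup>2\<close> is the Fourier transform of the image of \<open>f \<otimes> f\<close> under
  \<open>(x, x') \<mapsto> (x + x', k x + k x')\<close>, whose Jacobian is \<open>|k' x - k' x'|\<close>. After Hausdorff--Young
  the Jacobian is the kernel of a fractional integral in the slope variable \<open>k'\<close>.
\<close>

lemma extension_le:
  assumes P: "4 < P" and [measurable]: "f \<in> borel_measurable borel"
    and int: "integrable lborel (\<lambda>x. f x * complex_of_real (affine_density x))"
    and V: "(\<integral>\<^sup>+x. ennreal (norm (f x) powr (P / (P - 3)) * affine_density x) \<partial>lborel) \<le> ennreal V" and "0 < V"
  shows "(\<integral>\<^sup>+y. ennreal (norm (extension f y) powr P) \<partial>lborel) \<le> ennreal (extension_const P * V powr (P - 3))"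
proof -
  \<comment> \<open>The power P of the extension is the power \<open>S\<close> of its square, so
    Hausdorff--Young asks for the power \<open>s\<close> of \<open>h\<close>, with \<open>s\<close>
    conjugate to \<open>S\<close>. As \<open>h\<close> is a product divided by the Jacobian
    \<open>J\<close> and \<nu> has density \<open>J\<close>, what is left of the Jacobian is
    \<open>J powr (1 - s)\<close>, that is \<open>J powr (- g)\<close>.\<close>
  define S where "S = P / 2"
  define s where "s = S / (S - 1)"
  define g where "g = s - 1"
  have S: "2 < S" using P by (simp add: S_def)
  have g: "g = 2 / (P - 2)" "0 < g" "g < 1" and s: "s = P / (P - 2)" "0 < s"
    using P by (auto simp: g_def s_def S_def field_simps)
  have a: "2 / (2 - g) = (P - 2) / (P - 3)"
    using P by (simp add: g divide_simps) (simp add: algebra_simps)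
  define F where "F x = f x * complex_of_real (affine_density x)" for x
  let ?r = "(2 / (2 - g))"
  let ?e = "\<lambda>y p. (F (fst p) * echar (fst y * fst p + snd y * k (fst p))) * (F (snd p) * echar (fst y * snd p + snd y * k (snd p)))"
  have [measurable]: "F \<in> borel_measurable borel" unfolding F_def by measurable
  have intF: "integrable lborel F" using int by (simp add: F_def[abs_def])
  define J where "J p = \<bar>k' (fst p) - k' (snd p)\<bar>" for p :: "real \<times> real"
  have [measurable]: "J \<in> borel_measurable (borel \<Otimes>\<^sub>M borel)" unfolding J_def by measurable
  define \<Phi> where "\<Phi> p = (fst p + snd p, k (fst p) + k (snd p))" for p
  have \<Phi>m: "\<Phi> \<in> measurable (borel \<Otimes>\<^sub>M borel) (borel \<Otimes>\<^sub>M borel)" unfolding \<Phi>_def by measurable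
  then have [measurable]: "\<Phi> \<in> borel_measurable (borel \<Otimes>\<^sub>M borel)" by (simp add: borel_prod)
  \<comment> \<open>Where \<open>J p = 0\<close> the quotient is 0 by convention. Off the diagonal,
    which is a null set, this is the right value: the product of the two values of \<open>F\<close>
    vanishes there too, by \<open>k''_eq_0\<close>.\<close>
  define h where "h p = F (fst p) * F (snd p) / complex_of_real (J p)" for p
  have [measurable]: "h \<in> borel_measurable (borel \<Otimes>\<^sub>M borel)" unfolding h_def by measurable
  define \<nu> where "\<nu> = density (lborel \<Otimes>\<^sub>M lborel) (\<lambda>p. ennreal (J p))"
  have sf: "sigma_finite_measure ((lborel :: real measure) \<Otimes>\<^sub>M (lborel :: real measure))"
    by (intro sigma_finite_pair_measure lborel.sigma_finite_measure_axioms)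
  have \<nu>: "sigma_finite_measure \<nu>"
    unfolding \<nu>_def by (subst sigma_finite_measure.sigma_finite_iff_density_finite[OF sf]) auto
  \<comment> \<open>The fractional integral is taken over this measure because its image under the
    slope \<open>k'\<close> is dominated by Lebesgue measure, as
    \<open>hardy_littlewood_sobolev\<close> requires.\<close>
  define \<mu> where "\<mu> = density lborel (\<lambda>x. ennreal (k'' x))"
  have \<mu>: "sigma_finite_measure \<mu>"
    unfolding \<mu>_def by (subst sigma_finite_measure.sigma_finite_iff_density_finite[OF lborel.sigma_finite_measure_axioms]) auto
  obtain \<gamma> and \<Gamma> :: "nat \<Rightarrow> real \<times> real \<Rightarrow> real" where K: "fourier_kernel \<gamma> \<Gamma>"
    using fourier_kernel_real fourier_kernel_prod by blast
  have J0: "0 \<le> J p" for p by (simp add: J_def)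
  have pair_int: "integrable (lborel \<Otimes>\<^sub>M lborel) (\<lambda>p. F (fst p) * F (snd p))"
    by (intro integrable_mult_pair lborel.sigma_finite_measure_axioms intF)
  have hint: "integrable \<nu> h"
    unfolding \<nu>_def
  proof (subst integrable_density)
    show "integrable (lborel \<Otimes>\<^sub>M lborel) (\<lambda>p. J p *\<^sub>R h p)"
      by (rule Bochner_Integration.integrable_bound[OF pair_int]) (auto simp: h_def scaleR_conv_of_real)
  qed (auto simp: J0)
  have square: "(extension f y)\<^sup>2 = (LINT p|\<nu>. h p * echar (y \<bullet> \<Phi> p))" for y
  proof -
    have i: "integrable lborel (\<lambda>x. F x * echar (fst y * x + snd y * k x))"
      by (rule Bochner_Integration.integrable_bound[OF intF]) (auto simp: norm_mult)
    have "(extension f y)\<^sup>2 = (LINT p|(lborel \<Otimes>\<^sub>M lborel). (?e y p))"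
      unfolding power2_eq_square extension_def F_def[symmetric]
      by (intro integral_mult_pair[symmetric] lborel.sigma_finite_measure_axioms i)
    also have "\<dots> = (LINT p|(lborel \<Otimes>\<^sub>M lborel). J p *\<^sub>R (h p * echar (y \<bullet> \<Phi> p)))"
    proof (rule integral_cong_AE)
      have "AE p in lborel \<Otimes>\<^sub>M lborel. fst p \<noteq> (snd p :: real)"
      proof (rule lborel_pair.AE_pair_measure)
        show "AE x in lborel. AE y in lborel. fst (x, y) \<noteq> (snd (x, y) :: real)"
          using AE_lborel_singleton by (auto simp: eq_commute)
      qed measurable
      then show "AE p in lborel \<Otimes>\<^sub>M lborel. (?e y p) =
          J p *\<^sub>R (h p * echar (y \<bullet> \<Phi> p))"
      proof (rule eventually_mono)
        fix p :: "real \<times> real" assume ne: "fst p \<noteq> snd p"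
        have "F (fst p) * F (snd p) = J p *\<^sub>R h p"
        proof (cases "J p = 0")
          case True
          then have "k'' (fst p) = 0 \<or> k'' (snd p) = 0"
            using ne k''_eq_0[of "fst p" "snd p"] k''_eq_0[of "snd p" "fst p"]
            by (cases "fst p < snd p") (auto simp: J_def)
          then have "F (fst p) * F (snd p) = 0"
            by (auto simp: F_def affine_density_def)
          then show ?thesis by (simp add: True)
        qed (simp add: h_def scaleR_conv_of_real)
        moreover have "echar (y \<bullet> \<Phi> p) = echar (fst y * fst p + snd y * k (fst p)) * echar (fst y * snd p + snd y * k (snd p))"
          by (simp add: \<Phi>_def inner_prod_def algebra_simps flip: echar_add)
        then have "(?e y p) =
            (F (fst p) * F (snd p)) * echar (y \<bullet> \<Phi> p)"
          by (simp only: mult_ac)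
        ultimately show "(?e y p) =
          J p *\<^sub>R (h p * echar (y \<bullet> \<Phi> p))"
          by (simp only: mult_scaleR_left)
      qed
    qed measurable
    also have "\<dots> = (LINT p|\<nu>. h p * echar (y \<bullet> \<Phi> p))"
      unfolding \<nu>_def by (rule integral_density[symmetric]) (auto simp: J0)
    finally show ?thesis .
  qed
  define C where "C = 2 * (2 / (1 - g) + 2 powr (g / 2))"
  have C: "0 < C" using g by (simp add: C_def add_pos_pos)
  have hnorm: "(\<integral>\<^sup>+p. ennreal (norm (h p) powr s) \<partial>\<nu>) \<le> ennreal (C * V powr (2 - g))"
  proof -
    \<comment> \<open>where \<open>k'' x = 0\<close> also \<open>F x = 0\<close>, so that \<open>0 / 0 = 0\<close> is the right value\<close>
    define B where "B x = norm (F x) powr s / k'' x" for x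
    have [measurable]: "B \<in> borel_measurable borel" unfolding B_def by measurable
    have Bk: "B x * k'' x = norm (F x) powr s" for x
      by (auto simp: B_def F_def affine_density_def)
    have B0: "0 \<le> B x" for x using k''_nonneg[of x] by (simp add: B_def)
    have "(\<integral>\<^sup>+x. ennreal (B x powr ?r) \<partial>\<mu>) = (\<integral>\<^sup>+x. ennreal (k'' x) * ennreal (B x powr ?r) \<partial>lborel)"
      unfolding \<mu>_def by (rule nn_integral_density) measurable
    also have "\<dots> = (\<integral>\<^sup>+x. ennreal (norm (f x) powr (P / (P - 3)) * affine_density x) \<partial>lborel)"
    proof (intro nn_integral_cong)
      fix x
      have "k'' x * B x powr ?r = norm (f x) powr (P / (P - 3)) * affine_density x"
      proof (cases "k'' x = 0")
        case False
        then have kpos: "0 < k'' x" using k''_nonneg[of x] by simp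
        have sa: "s * ?r = P / (P - 3)"
          using P by (simp add: a s)
        \<comment> \<open>This is what the cube root in the affine density is for: the powers of
          \<open>k''\<close> combine, for every P, so that the norm of \<open>B\<close> over
          \<open>k'' dx\<close> is the norm of \<open>f\<close> over the affine density
          again.\<close>
        have e: "1 + (1 / 3) * (s * ?r) - 2 / (2 - g) = 1 / 3"
        proof -
          have "1 + (1 / 3) * (P / (P - 3)) - (P - 2) / (P - 3) = 1 / 3"
            using P by (simp add: divide_simps) (simp add: algebra_simps)
          then show ?thesis unfolding sa by (simp only: a)
        qed
        have "B x powr ?r = norm (f x) powr (s * ?r) * (k'' x powr ((1 / 3) * (s * ?r)) / k'' x powr ?r)"
          using kpos by (simp add: B_def F_def norm_mult affine_density_def powr_mult powr_divide powr_powr)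
        then have "k'' x * B x powr ?r = norm (f x) powr (s * ?r) * (k'' x powr 1 * k'' x powr ((1 / 3) * (s * ?r)) / k'' x powr ?r)"
          using kpos by simp
        also have "k'' x powr 1 * k'' x powr ((1 / 3) * (s * ?r)) / k'' x powr ?r = affine_density x"
          unfolding powr_add[symmetric] powr_diff[symmetric] e affine_density_def ..
        finally show ?thesis by (simp only: sa)
      qed (simp add: affine_density_def)
      then show "ennreal (k'' x) * ennreal (B x powr ?r) = ennreal (norm (f x) powr (P / (P - 3)) * affine_density x)"
        using k''_nonneg[of x] by (simp add: ennreal_mult'[symmetric])
    qed
    finally have BV: "(\<integral>\<^sup>+x. ennreal (B x powr ?r) \<partial>\<mu>) \<le> ennreal V"
      using V by simp
    have push: "(\<integral>\<^sup>+x. G (k' x) \<partial>\<mu>) \<le> (\<integral>\<^sup>+x. G x \<partial>lborel)" if [measurable]: "G \<in> borel_measurable borel" for G :: "real \<Rightarrow> ennreal"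
    proof -
      have "(\<integral>\<^sup>+x. G (k' x) \<partial>\<mu>) = (\<integral>\<^sup>+x. G (k' x) * ennreal (k'' x) \<partial>lborel)"
        unfolding \<mu>_def by (subst nn_integral_density) (auto simp: mult.commute)
      also have "\<dots> \<le> (\<integral>\<^sup>+x. G x \<partial>lborel)"
        by (intro nn_integral_substitution_UNIV_le deriv_k' continuous_k'' k''_nonneg that)
      finally show ?thesis .
    qed
    have HLS: "(\<integral>\<^sup>+x. \<integral>\<^sup>+y. ennreal (B x * B y * \<bar>k' x - k' y\<bar> powr (- g)) \<partial>\<mu> \<partial>\<mu>) \<le> ennreal (C * V powr (2 - g))"
      unfolding C_def by (rule hardy_littlewood_sobolev[OF \<mu> _ _ push B0 g(2,3) BV \<open>0 < V\<close>]) (auto simp: \<mu>_def)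
    have "(\<integral>\<^sup>+p. ennreal (norm (h p) powr s) \<partial>\<nu>) = (\<integral>\<^sup>+p. ennreal (J p) * ennreal (norm (h p) powr s) \<partial>(lborel \<Otimes>\<^sub>M lborel))"
      unfolding \<nu>_def by (rule nn_integral_density) measurable
    also have "\<dots> = (\<integral>\<^sup>+p. ennreal (B (fst p) * B (snd p) * J p powr (- g)) * ennreal (k'' (snd p)) * ennreal (k'' (fst p)) \<partial>(lborel \<Otimes>\<^sub>M lborel))"
    proof (intro nn_integral_cong)
      fix p
      have "J p * norm (h p) powr s = norm (F (fst p)) powr s * norm (F (snd p)) powr s * J p powr (- g)"
      proof (cases "J p = 0")
        case False
        then have "0 < J p" using J0[of p] by simp
        then have "J p * norm (h p) powr s = norm (F (fst p)) powr s * norm (F (snd p)) powr s * (J p powr 1 / J p powr s)"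
          by (simp add: h_def norm_mult norm_divide powr_mult powr_divide)
        also have "J p powr 1 / J p powr s = J p powr (- g)"
          by (simp only: powr_diff[symmetric]) (simp add: g_def)
        finally show ?thesis .
      qed (simp add: h_def)
      also have "\<dots> = B (fst p) * B (snd p) * J p powr (- g) * k'' (snd p) * k'' (fst p)"
        by (simp add: Bk[symmetric] mult_ac)
      finally show "ennreal (J p) * ennreal (norm (h p) powr s) = ennreal (B (fst p) * B (snd p) * J p powr (- g)) * ennreal (k'' (snd p)) * ennreal (k'' (fst p))"
        using J0[of p] B0 k''_nonneg by (simp add: ennreal_mult'[symmetric] ennreal_mult''[symmetric])
    qed
    also have "\<dots> = (\<integral>\<^sup>+x. \<integral>\<^sup>+y. ennreal (B x * B y * \<bar>k' x - k' y\<bar> powr (- g)) * ennreal (k'' y) * ennreal (k'' x) \<partial>lborel \<partial>lborel)"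
      by (subst lborel.nn_integral_fst[symmetric]) (auto simp: J_def)
    also have "\<dots> = (\<integral>\<^sup>+x. (\<integral>\<^sup>+y. ennreal (B x * B y * \<bar>k' x - k' y\<bar> powr (- g)) \<partial>\<mu>) \<partial>\<mu>)"
      unfolding \<mu>_def
      by (simp add: nn_integral_density)
         (rule nn_integral_cong, subst nn_integral_cmult[symmetric], auto intro!: nn_integral_cong simp: mult_ac)
    finally show ?thesis using HLS by simp
  qed
  have push2: "(\<integral>\<^sup>+p. G (\<Phi> p) \<partial>\<nu>) \<le> ennreal 2 * (\<integral>\<^sup>+z. G z \<partial>lborel)" if [measurable]: "G \<in> borel_measurable borel" for G :: "real \<times> real \<Rightarrow> ennreal"
  proof -
    have "(\<integral>\<^sup>+p. G (\<Phi> p) \<partial>\<nu>) = (\<integral>\<^sup>+p. ennreal (J p) * G (\<Phi> p) \<partial>(lborel \<Otimes>\<^sub>M lborel))"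
      unfolding \<nu>_def by (rule nn_integral_density) measurable
    also have "\<dots> \<le> 2 * (\<integral>\<^sup>+z. G z \<partial>lborel)"
      unfolding J_def \<Phi>_def by (rule nn_integral_sum_map_le[OF that])
    finally show ?thesis by simp
  qed
  have "(\<integral>\<^sup>+y. ennreal (norm (extension f y) powr P) \<partial>lborel) = (\<integral>\<^sup>+y. ennreal (norm (LINT p|\<nu>. h p * echar (y \<bullet> \<Phi> p)) powr S) \<partial>lborel)"
  proof (intro nn_integral_cong)
    fix y
    have "norm (extension f y) powr P = (norm (extension f y) powr 2) powr S"
      by (simp only: powr_powr S_def) simp
    also have "norm (extension f y) powr 2 = norm ((extension f y)\<^sup>2)"
      by (simp add: norm_power powr_numeral)
    finally show "ennreal (norm (extension f y) powr P) = ennreal (norm (LINT p|\<nu>. h p * echar (y \<bullet> \<Phi> p)) powr S)"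
      by (simp add: square)
  qed
  also have "\<dots> \<le> ennreal (4 * S * 2 / (S - 2) * 2 powr (S - 2) * (C * V powr (2 - g)) powr (S - 1))"
    using hnorm C \<open>0 < V\<close> by (intro hausdorff_young_le[OF K \<nu> _ push2 _ hint S]) (auto simp: \<nu>_def s_def)
  also have "(C * V powr (2 - g)) powr (S - 1) = C powr (S - 1) * V powr (P - 3)"
  proof -
    have "(2 - g) * (S - 1) = P - 3"
      using P by (simp add: g(1) S_def field_simps)
    then show ?thesis using C \<open>0 < V\<close> by (simp add: powr_mult powr_powr)
  qed
  also have "4 * S * 2 / (S - 2) * 2 powr (S - 2) * (C powr (S - 1) * V powr (P - 3)) = extension_const P * V powr (P - 3)"
  proof -
    have "g / 2 = 1 / (P - 2)" using P by (simp add: g(1) field_simps)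
    then have "C = 2 * (2 / (1 - 2 / (P - 2)) + 2 powr (1 / (P - 2)))"
      by (simp only: C_def) (simp only: g(1))
    then show ?thesis by (simp only: extension_const_def S_def mult.assoc)
  qed
  finally show ?thesis .
qed

text \<open>By duality: \<open>extension_le\<close> is applied to \<open>|g|\<^bsup>q-2\<^esup> cnj g\<close>, where \<open>g\<close> is the restricted Fourier transform, cut off to make all integrals finite.\<close>

lemma restriction_le:
  fixes G :: "real \<times> real \<Rightarrow> complex"
  assumes P: "4 < P" and G: "integrable lborel G"
    and U: "(\<integral>\<^sup>+y. ennreal (norm (G y) powr (P / (P - 1))) \<partial>lborel) \<le> ennreal U" and "0 \<le> U"
  shows "(\<integral>\<^sup>+x. ennreal (norm (LINT y|lborel. G y * echar (fst y * x + snd y * k x)) powr (P / 3) * affine_density x) \<partial>lborel)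
      \<le> ennreal (extension_const P powr (1 / 3) * U powr ((P - 1) / 3))"
proof -
  define q where "q = P / 3"
  have q: "1 < q" using P by (simp add: q_def)
  define L where "L = extension_const P"
  have L: "0 < L" using extension_const_pos[OF P] by (simp add: L_def)
  have Gm [measurable]: "G \<in> borel_measurable (borel \<Otimes>\<^sub>M borel)"
    using borel_measurable_integrable[OF G] by (simp add: borel_prod)
  have G_powr: "(\<lambda>y. norm (G y) powr (P / (P - 1))) \<in> borel_measurable borel"
    unfolding borel_prod[symmetric] by measurable
  define g where "g x = (LINT y|lborel. G y * echar (fst y * x + snd y * k x))" for x
  have [measurable]: "g \<in> borel_measurable borel"
    unfolding g_def lborel_prod[symmetric] by (intro lborel_pair.P.borel_measurable_lebesgue_integral) measurable
  define M where "M = (LINT y|lborel. norm (G y))"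
  let ?I = "\<lambda>n. {- real n..real n}"
  let ?a = "\<lambda>x. complex_of_real (affine_density x)"
  have g_le: "norm (g x) \<le> M" for x
  proof -
    have "norm (g x) \<le> (LINT y|lborel. norm (G y * echar (fst y * x + snd y * k x)))"
      unfolding g_def by (rule integral_norm_bound)
    then show ?thesis by (simp add: M_def norm_mult)
  qed
  have M0: "0 \<le> M" by (simp add: M_def)
  have step: "(\<integral>\<^sup>+x. ennreal (norm (g x) powr q * affine_density x) * indicator (?I n) x \<partial>lborel)
      \<le> ennreal (L powr (1 / 3) * U powr ((P - 1) / 3))" for n :: nat
  proof -
    \<comment> \<open>With q = P/3 one has \<open>(q - 1) * (P / (P - 3)) = q\<close>, so the norm
      of \<open>f\<close> that \<open>extension_le\<close> asks for is the integral \<open>I\<close>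
      to be estimated. The exponent \<open>q - 2\<close> may be negative; at zeros of
      \<open>g\<close> the function \<open>f\<close> is 0 and the identities below still
      hold.\<close>
    define f where "f x = cnj (g x) * complex_of_real (norm (g x) powr (q - 2) * indicator (?I n) x)" for x
    have [measurable]: "f \<in> borel_measurable borel" unfolding f_def by measurable
    have f_norm: "norm (f x) = norm (g x) powr (q - 1) * indicator (?I n) x" for x
    proof (cases "g x = 0")
      case False
      then have "norm (g x) * norm (g x) powr (q - 2) = norm (g x) powr (q - 1)"
        using powr_add[of "norm (g x)" 1 "q - 2"] by simp
      then show ?thesis by (simp add: f_def norm_mult mult.assoc[symmetric])
    qed (simp add: f_def)
    have gf: "g x * f x = complex_of_real (norm (g x) powr q * indicator (?I n) x)" for x
    proof (cases "g x = 0")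
      case False
      have "g x * f x = complex_of_real ((norm (g x))\<^sup>2 * norm (g x) powr (q - 2) * indicator (?I n) x)"
      proof -
        have "g x * cnj (g x) = (complex_of_real (norm (g x)))\<^sup>2"
          by (simp only: complex_norm_square[symmetric] of_real_power)
        then show ?thesis by (simp add: f_def mult.assoc[symmetric])
      qed
      also have "(norm (g x))\<^sup>2 * norm (g x) powr (q - 2) = norm (g x) powr q"
        using False powr_add[of "norm (g x)" 2 "q - 2"] by (simp add: powr_numeral)
      finally show ?thesis .
    qed (simp add: f_def)
    have cont: "continuous_on (?I n) affine_density"
      unfolding affine_density_def
      by (intro continuous_on_powr' continuous_on_subset[OF continuous_k''] continuous_on_const) (auto simp: k''_nonneg)
    obtain D where "\<forall>y\<in>affine_density ` (?I n). norm y \<le> D"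
      using compact_imp_bounded[OF compact_continuous_image[OF cont compact_Icc]]
      unfolding bounded_iff by blast
    then have D: "affine_density x \<le> D" if "x \<in> (?I n)" for x
      using that by force
    have int_ind: "integrable lborel (\<lambda>x. c * indicator (?I n) x :: real)" for c :: real
      by (intro integrable_mult_right) (simp add: integrable_indicator_iff)
    have bound: "norm (f x * ?a x) \<le> norm (M powr (q - 1) * D * indicator (?I n) x)" for x
    proof (cases "x \<in> (?I n)")
      case True
      have "norm (g x) powr (q - 1) * affine_density x \<le> M powr (q - 1) * D"
        using q g_le[of x] D[OF True] by (intro mult_mono powr_mono2) auto
      then show ?thesis using True by (simp add: norm_mult f_norm)
    qed (simp add: f_norm norm_mult)
    have fint: "integrable lborel (\<lambda>x. f x * ?a x)"
      by (rule Bochner_Integration.integrable_bound[OF int_ind[of "M powr (q - 1) * D"]]) (use bound in auto)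
    have int_gq: "integrable lborel (\<lambda>x. norm (g x) powr q * indicator (?I n) x * affine_density x)"
    proof (rule Bochner_Integration.integrable_bound[OF int_ind[of "M powr q * D"]])
      show "AE x in lborel. norm (norm (g x) powr q * indicator (?I n) x * affine_density x) \<le> norm (M powr q * D * indicator (?I n) x)"
      proof (intro always_eventually allI)
        fix x
        show "norm (norm (g x) powr q * indicator (?I n) x * affine_density x) \<le> norm (M powr q * D * indicator (?I n) x)"
        proof (cases "x \<in> (?I n)")
          case True
          have "norm (g x) powr q * affine_density x \<le> M powr q * D"
            using q g_le[of x] D[OF True] by (intro mult_mono powr_mono2) auto
          then show ?thesis using True by simp
        qed simp
      qed
    qed measurable
    define I where "I = (LINT x|lborel. norm (g x) powr q * indicator (?I n) x * affine_density x)"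
    have I0: "0 \<le> I" unfolding I_def by (intro Bochner_Integration.integral_nonneg) auto
    have I_nn: "(\<integral>\<^sup>+x. ennreal (norm (g x) powr q * affine_density x) * indicator (?I n) x \<partial>lborel) = ennreal I"
    proof -
      have "(\<integral>\<^sup>+x. ennreal (norm (g x) powr q * affine_density x) * indicator (?I n) x \<partial>lborel) =
          (\<integral>\<^sup>+x. ennreal (norm (g x) powr q * indicator (?I n) x * affine_density x) \<partial>lborel)"
        by (intro nn_integral_cong) (auto split: split_indicator)
      also have "\<dots> = ennreal I"
        unfolding I_def by (intro nn_integral_eq_integral int_gq) auto
      finally show ?thesis .
    qed
    have "I \<le> L powr (1 / 3) * U powr ((P - 1) / 3)"
    proof (cases "I = 0")
      case True
      then show ?thesis using L by simp
    next
      case False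
      then have I: "0 < I" using I0 by simp
      have W: "integrable (lborel \<Otimes>\<^sub>M lborel) (\<lambda>(x, y). (f x * ?a x) * (G y * echar (fst y * x + snd y * k x)))"
        by (rule Bochner_Integration.integrable_bound[OF integrable_mult_pair[OF lborel.sigma_finite_measure_axioms lborel.sigma_finite_measure_axioms fint G]])
           (auto simp: norm_mult lborel_prod[symmetric])
      have "complex_of_real I = (LINT x|lborel. complex_of_real (norm (g x) powr q * indicator (?I n) x * affine_density x))"
        unfolding I_def by (rule integral_complex_of_real[symmetric])
      also have "\<dots> = (LINT x|lborel. (f x * ?a x) * g x)"
      proof (rule Bochner_Integration.integral_cong)
        fix x
        show "complex_of_real (norm (g x) powr q * indicator (?I n) x * affine_density x) = (f x * ?a x) * g x"
          unfolding of_real_mult[of _ "affine_density x"] gf[of x, symmetric] by (simp only: mult_ac)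
      qed simp
      also have "\<dots> = (LINT x|lborel. LINT y|lborel. (f x * ?a x) * (G y * echar (fst y * x + snd y * k x)))"
        unfolding g_def by simp
      also have "\<dots> = (LINT y|lborel. LINT x|lborel. (f x * ?a x) * (G y * echar (fst y * x + snd y * k x)))"
        by (rule lborel_pair.Fubini_integral[OF W, symmetric])
      also have "\<dots> = (LINT y|lborel. G y * extension f y)"
        unfolding extension_def
        by (intro Bochner_Integration.integral_cong refl, subst integral_mult_right_zero[symmetric])
           (simp only: mult_ac)
      finally have "ennreal I = ennreal (norm (LINT y|lborel. G y * extension f y))"
        using I0 by (metis abs_of_nonneg norm_of_real)
      also have "\<dots> \<le> (\<integral>\<^sup>+y. ennreal (norm (G y * extension f y)) \<partial>lborel)"
        by (rule norm_integral_le_nn_integral)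
      also have "\<dots> = (\<integral>\<^sup>+y. ennreal ((norm (G y) powr (P / (P - 1))) powr (1 - 1 / P) * (norm (extension f y) powr P) powr (1 - (1 - 1 / P))) \<partial>lborel)"
      proof (intro nn_integral_cong)
        fix y
        have "P / (P - 1) * (1 - 1 / P) = 1" using P by (simp add: field_simps)
        then show "ennreal (norm (G y * extension f y)) =
            ennreal ((norm (G y) powr (P / (P - 1))) powr (1 - 1 / P) * (norm (extension f y) powr P) powr (1 - (1 - 1 / P)))"
          using P by (simp add: norm_mult powr_powr)
      qed
      also have "\<dots> \<le> ennreal (U powr (1 - 1 / P) * (L * I powr (P - 3)) powr (1 - (1 - 1 / P)))"
      proof (rule nn_integral_powr_interpolation)
        have em: "extension f \<in> borel_measurable (borel \<Otimes>\<^sub>M borel)"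
          unfolding extension_def[abs_def] by measurable
        then show "(\<lambda>y. norm (extension f y) powr P) \<in> borel_measurable lborel"
          by (simp add: borel_prod)
        have "norm (f x) powr (P / (P - 3)) * affine_density x = norm (g x) powr q * indicator (?I n) x * affine_density x" for x
        proof -
          have "(q - 1) * (P / (P - 3)) = q" using P by (simp add: q_def field_simps)
          then show ?thesis by (auto simp: f_norm powr_powr split: split_indicator)
        qed
        then have "(\<integral>\<^sup>+x. ennreal (norm (f x) powr (P / (P - 3)) * affine_density x) \<partial>lborel) =
            (\<integral>\<^sup>+x. ennreal (norm (g x) powr q * indicator (?I n) x * affine_density x) \<partial>lborel)"
          by (simp only:)
        also have "\<dots> = ennreal I"
          unfolding I_def by (intro nn_integral_eq_integral int_gq) auto
        finally have "(\<integral>\<^sup>+x. ennreal (norm (f x) powr (P / (P - 3)) * affine_density x) \<partial>lborel) = ennreal I" .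
        then show "(\<integral>\<^sup>+y. ennreal (norm (extension f y) powr P) \<partial>lborel) \<le> ennreal (L * I powr (P - 3))"
          unfolding L_def by (intro extension_le P fint I) auto
      qed (use U \<open>0 \<le> U\<close> P L G_powr in auto)
      \<comment> \<open>Now \<open>I\<close> stands on both sides, on the right with total exponent
        \<open>1 - 3 / P\<close>. The cutoff has made \<open>I\<close> finite and it is positive in
        this case, so that power can be divided out, leaving \<open>I powr (3 / P)\<close> on the
        left.\<close>
      finally have "I \<le> U powr (1 - 1 / P) * (L * I powr (P - 3)) powr (1 / P)"
        by (subst (asm) ennreal_le_iff) simp_all
      also have "\<dots> = U powr (1 - 1 / P) * L powr (1 / P) * I powr (1 - 3 / P)"
        using L I P by (simp add: powr_mult powr_powr diff_divide_distrib)
      finally have "I * I powr (3 / P - 1) \<le> U powr (1 - 1 / P) * L powr (1 / P) * I powr (1 - 3 / P) * I powr (3 / P - 1)"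
        by (rule mult_right_mono) simp
      then have "I powr 1 * I powr (3 / P - 1) \<le> U powr (1 - 1 / P) * L powr (1 / P) * (I powr (1 - 3 / P) * I powr (3 / P - 1))"
        using I by (simp add: mult.assoc)
      then have "I powr (3 / P) \<le> U powr (1 - 1 / P) * L powr (1 / P)"
        using I by (simp only: powr_add[symmetric]) simp
      then have "(I powr (3 / P)) powr (P / 3) \<le> (U powr (1 - 1 / P) * L powr (1 / P)) powr (P / 3)"
        using P by (intro powr_mono2) auto
      also have "\<dots> = L powr (1 / 3) * U powr ((P - 1) / 3)"
      proof -
        have "(1 - 1 / P) * (P / 3) = (P - 1) / 3" "1 / P * (P / 3) = 1 / 3" using P by (simp_all add: field_simps)
        then show ?thesis using \<open>0 \<le> U\<close> L by (simp add: powr_mult powr_powr mult.commute)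
      qed
      also have "(I powr (3 / P)) powr (P / 3) = I"
        using I P by (simp add: powr_powr)
      finally show ?thesis .
    qed
    then show ?thesis unfolding I_nn by (rule ennreal_leI)
  qed
  have "(\<integral>\<^sup>+x. ennreal (norm (g x) powr q * affine_density x) \<partial>lborel) \<le> ennreal (L powr (1 / 3) * U powr ((P - 1) / 3))"
  proof (rule nn_integral_le_exhaustion[OF _ _ _ _ step])
    show "(\<Union>n. (?I n)) = space lborel"
    proof (intro equalityI subsetI UN_I)
      fix x :: real
      show "x \<in> {- real (nat \<lceil>\<bar>x\<bar>\<rceil>)..real (nat \<lceil>\<bar>x\<bar>\<rceil>)}" by simp linarith
    qed simp_all
  qed (auto simp: incseq_def)
  then show ?thesis by (simp add: g_def q_def L_def)
qed

text \<open>The dilate of the graph by \<open>l\<close> is the convex graph of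
  \<open>l * k (x / l)\<close>, to which \<open>restriction_le\<close> applies with the same
  constant. Its affine density at \<open>l * x\<close> is \<open>l powr (- 1 / 3)\<close> times the
  old one at \<open>x\<close>, and the substitution contributes another \<open>l\<close>; hence
  \<open>l powr (2 / 3)\<close> times the integral is bounded uniformly.\<close>

lemma dilated_restriction_le:
  fixes G :: "real \<times> real \<Rightarrow> complex"
  assumes P: "4 < P" and G: "integrable lborel G" and l: "0 < l"
    and U: "(\<integral>\<^sup>+y. ennreal (norm (G y) powr (P / (P - 1))) \<partial>lborel) \<le> ennreal U" and "0 \<le> U"
  shows "(\<integral>\<^sup>+x. ennreal (norm (LINT y|lborel. G y * echar (fst y * (l * x) + snd y * (l * k x))) powr (P / 3) * affine_density x) \<partial>lborel)
      \<le> ennreal (l powr (- 2 / 3) * extension_const P powr (1 / 3) * U powr ((P - 1) / 3))"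
proof -
  interpret S: convex_curve "\<lambda>x. l * k (x / l)" "\<lambda>x. k' (x / l)" "\<lambda>x. k'' (x / l) / l"
  proof
    fix x
    have inner: "((\<lambda>x. x / l) has_real_derivative 1 / l) (at x)"
      using l by (auto intro!: derivative_eq_intros)
    show "((\<lambda>x. l * k (x / l)) has_real_derivative k' (x / l)) (at x)"
      using DERIV_cmult[OF DERIV_chain2[where f=k, OF deriv_k inner], of l] l by simp
    show "((\<lambda>x. k' (x / l)) has_real_derivative k'' (x / l) / l) (at x)"
      using DERIV_chain2[where f=k', OF deriv_k' inner] by simp
    show "0 \<le> k'' (x / l) / l" using l k''_nonneg by simp
  next
    show "continuous_on UNIV (\<lambda>x. k'' (x / l) / l)"
      using l by (intro continuous_intros continuous_on_compose2[OF continuous_k'']) auto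
  qed
  define g where "g x = (LINT y|lborel. G y * echar (fst y * x + snd y * (l * k (x / l))))" for x
  have Gm [measurable]: "G \<in> borel_measurable (borel \<Otimes>\<^sub>M borel)"
    using borel_measurable_integrable[OF G] by (simp add: borel_prod)
  have [measurable]: "g \<in> borel_measurable borel"
    unfolding g_def lborel_prod[symmetric] by (intro lborel_pair.P.borel_measurable_lebesgue_integral) measurable
  have "ennreal (l powr (2 / 3)) * (\<integral>\<^sup>+x. ennreal (norm (LINT y|lborel. G y * echar (fst y * (l * x) + snd y * (l * k x))) powr (P / 3) * affine_density x) \<partial>lborel)
      = ennreal (l powr (2 / 3)) * (\<integral>\<^sup>+x. ennreal (norm (g (0 + l * x)) powr (P / 3) * affine_density x) \<partial>lborel)"
    using l by (simp add: g_def)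
  also have "\<dots> = ennreal l * (\<integral>\<^sup>+x. ennreal (norm (g (0 + l * x)) powr (P / 3) * S.affine_density (0 + l * x)) \<partial>lborel)"
  proof -
    have e: "S.affine_density (0 + l * x) = l powr (- 1 / 3) * affine_density x" for x
      using l k''_nonneg[of x] by (simp add: S.affine_density_def affine_density_def powr_divide powr_minus_divide)
    have "(\<integral>\<^sup>+x. ennreal (norm (g (0 + l * x)) powr (P / 3) * S.affine_density (0 + l * x)) \<partial>lborel) =
        (\<integral>\<^sup>+x. ennreal (l powr (- 1 / 3)) * ennreal (norm (g (0 + l * x)) powr (P / 3) * affine_density x) \<partial>lborel)"
      unfolding e by (intro nn_integral_cong) (simp add: ennreal_mult'[symmetric] mult_ac)
    also have "\<dots> = ennreal (l powr (- 1 / 3)) * (\<integral>\<^sup>+x. ennreal (norm (g (0 + l * x)) powr (P / 3) * affine_density x) \<partial>lborel)"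
      by (rule nn_integral_cmult) measurable
    finally have "ennreal l * (\<integral>\<^sup>+x. ennreal (norm (g (0 + l * x)) powr (P / 3) * S.affine_density (0 + l * x)) \<partial>lborel)
        = ennreal (l * l powr (- 1 / 3)) * (\<integral>\<^sup>+x. ennreal (norm (g (0 + l * x)) powr (P / 3) * affine_density x) \<partial>lborel)"
      using l by (simp add: ennreal_mult' mult.assoc)
    also have "l * l powr (- 1 / 3) = l powr (2 / 3)"
      using l powr_add[of l 1 "- 1 / 3"] by simp
    finally show ?thesis ..
  qed
  also have "\<dots> = (\<integral>\<^sup>+x. ennreal (norm (g x) powr (P / 3) * S.affine_density x) \<partial>lborel)"
    using l nn_integral_real_affine[of "\<lambda>x. ennreal (norm (g x) powr (P / 3) * S.affine_density x)" l 0] by simp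
  also have "\<dots> \<le> ennreal (extension_const P powr (1 / 3) * U powr ((P - 1) / 3))"
    unfolding g_def by (rule S.restriction_le[OF P G U \<open>0 \<le> U\<close>])
  finally have "ennreal (l powr (- 2 / 3)) * (ennreal (l powr (2 / 3)) * (\<integral>\<^sup>+x. ennreal (norm (LINT y|lborel. G y * echar (fst y * (l * x) + snd y * (l * k x))) powr (P / 3) * affine_density x) \<partial>lborel))
     \<le> ennreal (l powr (- 2 / 3)) * ennreal (extension_const P powr (1 / 3) * U powr ((P - 1) / 3))"
    by (rule mult_left_mono) simp
  moreover have "ennreal (l powr (- 2 / 3)) * ennreal (l powr (2 / 3)) = 1"
    using l by (simp add: ennreal_mult'[symmetric] powr_add[symmetric])
  ultimately show ?thesis
    by (simp add: ennreal_mult'[symmetric] mult.assoc[symmetric])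
qed

end

text \<open>
  Slices \<open>\<xi>\<^sub>2 = \<epsilon> l\<close> of the cone are dilates of one planar curve. Hoelder's inequality with the weight
  \<open>M(y) = \<integral> |F(y, s)|\<^sup>p ds\<close> replaces Minkowski's inequality, and Pitt's inequality absorbs the
  factor \<open>l\<^bsup>-2/3\<^esup>\<close> coming from the dilation. The slicing coordinate \<open>s\<close> is written last:
  \<open>F ((y\<^sub>1, y\<^sub>3), s)\<close> stands for \<open>F(y\<^sub>1, s, y\<^sub>3)\<close>.
\<close>

lemma (in convex_curve) cone_restriction_le:
  fixes F :: "(real \<times> real) \<times> real \<Rightarrow> complex"
  assumes P: "4 < P" and \<epsilon>: "\<bar>\<epsilon>\<bar> = 1" and F: "integrable lborel F" and V0: "0 < V"
    and V: "(\<integral>\<^sup>+z. ennreal (norm (F z) powr (P / (P - 1))) \<partial>lborel) \<le> ennreal V"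
  shows "(\<integral>\<^sup>+l. (\<integral>\<^sup>+x. ennreal (norm (LINT z|lborel. F z * echar (fst (fst z) * (l * x) + snd (fst z) * (l * k x) + snd z * (\<epsilon> * l))) powr (P / 3)
        * k'' x powr (1 / 3)) \<partial>lborel) * indicator {0<..} l \<partial>lborel)
      \<le> ennreal (extension_const P powr (1 / 3) * pitt_const P * V powr ((P - 1) / 3))"
proof -
  define Cp where "Cp = pitt_const P"
  have Cp: "0 < Cp" using pitt_const_pos[OF P] by (simp add: Cp_def)
  define p where "p = P / (P - 1)"
  define q where "q = P / 3"
  \<comment> \<open>The ratio of the exponents \<open>q\<close> and \<open>p\<close>. It exceeds 1
    because P > 4, so the weight \<open>M y powr (1 - \<alpha>)\<close> below is a negative
    power.\<close>
  define \<alpha> where "\<alpha> = (P - 1) / 3"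
  have p: "0 < p" and q: "0 < q" and \<alpha>: "1 < \<alpha>" "q * (1 / \<alpha>) = p"
    using P by (auto simp: p_def q_def \<alpha>_def field_simps)
  define L where "L = extension_const P powr (1 / 3)"
  have L: "0 < L" using extension_const_pos[OF P] by (simp add: L_def)
  have Fm [measurable]: "F \<in> borel_measurable ((borel \<Otimes>\<^sub>M borel) \<Otimes>\<^sub>M borel)"
    using borel_measurable_integrable[OF F] by (simp add: borel_prod)
  have Fym: "(\<lambda>s. F (y, s)) \<in> borel_measurable borel" for y
    using measurable_Pair2[OF Fm, of y] by (simp add: space_pair_measure)
  have F': "integrable (lborel \<Otimes>\<^sub>M lborel) F"
    using F by (simp add: lborel_prod)
  define G where "G l y = (LINT s|lborel. F (y, s) * echar (s * (\<epsilon> * l)))" for l y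
  have Gm: "(\<lambda>z. G (fst z) (snd z)) \<in> borel_measurable (borel \<Otimes>\<^sub>M (borel \<Otimes>\<^sub>M borel))"
    unfolding G_def by measurable
  have [measurable]: "(\<lambda>x. G (f x) (f' x)) \<in> borel_measurable M" if "f \<in> borel_measurable M" "f' \<in> measurable M (borel \<Otimes>\<^sub>M borel)" for f f' and M :: "'z measure"
    using measurable_compose[OF measurable_Pair[OF that] Gm] by simp
  have Fe: "integrable (lborel \<Otimes>\<^sub>M lborel) (\<lambda>z. F z * echar (u (fst z) + snd z * (\<epsilon> * l)))"
    if [measurable]: "u \<in> borel_measurable (borel \<Otimes>\<^sub>M borel)" for u l
    by (rule Bochner_Integration.integrable_bound[OF F']) (auto simp: norm_mult lborel_prod[symmetric])
  have Gint: "integrable lborel (G l)" for l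
    using lborel_pair.integrable_fst'[OF Fe[of "\<lambda>_. 0" l]] by (simp add: G_def[abs_def])
  have slice: "(LINT z|lborel. F z * echar (fst (fst z) * (l * x) + snd (fst z) * (l * k x) + snd z * (\<epsilon> * l))) =
      (LINT y|lborel. G l y * echar (fst y * (l * x) + snd y * (l * k x)))" for l x
  proof -
    have "(LINT z|lborel. F z * echar (fst (fst z) * (l * x) + snd (fst z) * (l * k x) + snd z * (\<epsilon> * l))) =
        (LINT y|lborel. LINT s|lborel. F (y, s) * echar (fst y * (l * x) + snd y * (l * k x) + s * (\<epsilon> * l)))"
      using lborel_pair.integral_fst'[OF Fe[of "\<lambda>y. fst y * (l * x) + snd y * (l * k x)" l]] by (simp add: lborel_prod)
    also have "\<dots> = (LINT y|lborel. LINT s|lborel. F (y, s) * echar (s * (\<epsilon> * l)) * echar (fst y * (l * x) + snd y * (l * k x)))"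
      by (simp only: echar_add mult_ac)
    also have "\<dots> = (LINT y|lborel. G l y * echar (fst y * (l * x) + snd y * (l * k x)))"
      by (simp add: G_def)
    finally show ?thesis .
  qed
  define m where "m y = (\<integral>\<^sup>+s. ennreal (norm (F (y, s)) powr p) \<partial>lborel)" for y
  have [measurable]: "m \<in> borel_measurable (borel \<Otimes>\<^sub>M borel)" unfolding m_def by measurable
  define M where "M y = enn2real (m y)" for y
  have [measurable]: "M \<in> borel_measurable (borel \<Otimes>\<^sub>M borel)" unfolding M_def by measurable
  have M0: "0 \<le> M y" for y by (simp add: M_def)
  have mint: "(\<integral>\<^sup>+y. m y \<partial>lborel) \<le> ennreal V"
  proof -
    have "(\<integral>\<^sup>+y. m y \<partial>lborel) = (\<integral>\<^sup>+z. ennreal (norm (F z) powr p) \<partial>(lborel \<Otimes>\<^sub>M lborel))"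
      unfolding m_def by (subst lborel.nn_integral_fst[symmetric]) (auto simp: lborel_prod[symmetric])
    then show ?thesis using V by (simp add: lborel_prod p_def)
  qed
  have m_fin: "AE y in lborel. m y = ennreal (M y)"
  proof -
    have "AE y in lborel. m y \<noteq> \<infinity>"
      using mint by (intro nn_integral_noteq_infinite) (auto simp: lborel_prod[symmetric] top_unique)
    then show ?thesis
      by (rule eventually_mono) (simp add: M_def less_top)
  qed
  have F_slice: "AE y in lborel. integrable lborel (\<lambda>s. F (y, s))"
    using lborel_pair.AE_integrable_fst'[OF F'] by simp
  have Mint: "(\<integral>\<^sup>+y. ennreal (M y) \<partial>lborel) \<le> ennreal V"
  proof -
    have "(\<integral>\<^sup>+y. ennreal (M y) \<partial>lborel) = (\<integral>\<^sup>+y. m y \<partial>lborel)"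
      using m_fin by (intro nn_integral_cong_AE) (auto elim: eventually_mono)
    then show ?thesis using mint by simp
  qed
  \<comment> \<open>Since \<open>0 powr (1 - \<alpha>) = 0\<close>, the splitting of
    \<open>norm (G l y) powr p\<close> below could fail where \<open>M y = 0\<close>. There
    \<open>F (y, s)\<close> is 0 for almost every \<open>s\<close>, hence its transform
    \<open>G l y\<close> is 0 for every \<open>l\<close>.\<close>
  have M_zero: "AE y in lborel. M y = 0 \<longrightarrow> (\<forall>l. G l y = 0)"
    using m_fin
  proof (rule eventually_mono)
    fix y assume "m y = ennreal (M y)"
    show "M y = 0 \<longrightarrow> (\<forall>l. G l y = 0)"
    proof (intro impI allI)
      fix l assume "M y = 0"
      with \<open>m y = ennreal (M y)\<close> have "(\<integral>\<^sup>+s. ennreal (norm (F (y, s)) powr p) \<partial>lborel) = 0"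
        by (simp add: m_def)
      then have "AE s in lborel. ennreal (norm (F (y, s)) powr p) = 0"
        using Fym[of y] by (subst (asm) nn_integral_0_iff_AE) simp_all
      then have "AE s in lborel. F (y, s) * echar (s * (\<epsilon> * l)) = 0"
        by (rule eventually_mono) simp
      then show "G l y = 0"
        unfolding G_def by (rule integral_eq_zero_AE)
    qed
  qed
  \<comment> \<open>Hoelder's inequality with exponent \<alpha> splits
    \<open>norm (G l y) powr p\<close> into the integrand of \<open>W l\<close> to the power
    \<open>1 / \<alpha>\<close> and \<open>M y powr (1 - 1 / \<alpha>)\<close>; the second factor is
    controlled by \<open>V\<close>. After raising to the power \<alpha> the bound is linear in
    \<open>W l\<close>, so the integrals over \<open>l\<close> and \<open>y\<close> can be
    exchanged.\<close>
  define W where "W l = (\<integral>\<^sup>+y. ennreal (norm (G l y) powr q * M y powr (1 - \<alpha>)) \<partial>lborel)" for l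
  let ?w = "\<lambda>l y. ennreal (l powr (- 2 / 3)) * ennreal (norm (G l y) powr q * M y powr (1 - \<alpha>)) * indicator {0<..} l"
  let ?F = "\<lambda>l x. (LINT z|lborel. F z * echar (fst (fst z) * (l * x) + snd (fst z) * (l * k x) + snd z * (\<epsilon> * l)))"
  have slice_le: "(\<integral>\<^sup>+x. ennreal (norm (?F l x) powr q
      * k'' x powr (1 / 3)) \<partial>lborel) \<le> ennreal (l powr (- 2 / 3) * L * V powr (\<alpha> - 1)) * W l" if l: "0 < l" for l
  proof (cases "W l = \<infinity>")
    case True
    then show ?thesis using l L V0 by (simp add: ennreal_mult_top)
  next
    case False
    then obtain w where w: "W l = ennreal w" "0 \<le> w" by (cases "W l") auto
    have "(\<integral>\<^sup>+y. ennreal (norm (G l y) powr p) \<partial>lborel) =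
        (\<integral>\<^sup>+y. ennreal ((norm (G l y) powr q * M y powr (1 - \<alpha>)) powr (1 / \<alpha>) * M y powr (1 - 1 / \<alpha>)) \<partial>lborel)"
    proof (rule nn_integral_cong_AE)
      show "AE y in lborel. ennreal (norm (G l y) powr p) =
          ennreal ((norm (G l y) powr q * M y powr (1 - \<alpha>)) powr (1 / \<alpha>) * M y powr (1 - 1 / \<alpha>))"
        using M_zero
      proof (rule eventually_mono)
        fix y assume z: "M y = 0 \<longrightarrow> (\<forall>l. G l y = 0)"
        show "ennreal (norm (G l y) powr p) =
          ennreal ((norm (G l y) powr q * M y powr (1 - \<alpha>)) powr (1 / \<alpha>) * M y powr (1 - 1 / \<alpha>))"
        proof (cases "M y = 0")
          case False
          have "(1 - \<alpha>) * (1 / \<alpha>) + (1 - 1 / \<alpha>) = 0" using \<alpha>(1) by (simp add: field_simps)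
          then have "M y powr ((1 - \<alpha>) * (1 / \<alpha>)) * M y powr (1 - 1 / \<alpha>) = 1"
            using False by (simp only: powr_add[symmetric]) simp
          moreover have "(norm (G l y) powr q * M y powr (1 - \<alpha>)) powr (1 / \<alpha>) = norm (G l y) powr p * M y powr ((1 - \<alpha>) * (1 / \<alpha>))"
            by (simp only: powr_mult powr_powr \<alpha>(2))
          ultimately show ?thesis by (simp add: mult.assoc)
        qed (use z in simp)
      qed
    qed
    also have "\<dots> \<le> ennreal (w powr (1 / \<alpha>) * V powr (1 - 1 / \<alpha>))"
      using w \<alpha> Mint V0 M0 by (intro nn_integral_powr_interpolation) (auto simp: W_def lborel_prod[symmetric])
    finally have "(\<integral>\<^sup>+y. ennreal (norm (G l y) powr (P / (P - 1))) \<partial>lborel) \<le> ennreal (w powr (1 / \<alpha>) * V powr (1 - 1 / \<alpha>))"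
      by (simp add: p_def)
    from dilated_restriction_le[OF P Gint l this]
    have "(\<integral>\<^sup>+x. ennreal (norm (LINT y|lborel. G l y * echar (fst y * (l * x) + snd y * (l * k x))) powr q * affine_density x) \<partial>lborel)
        \<le> ennreal (l powr (- 2 / 3) * L * (w powr (1 / \<alpha>) * V powr (1 - 1 / \<alpha>)) powr \<alpha>)"
      by (simp add: q_def L_def \<alpha>_def)
    also have "(w powr (1 / \<alpha>) * V powr (1 - 1 / \<alpha>)) powr \<alpha> = w * V powr (\<alpha> - 1)"
    proof -
      have "(1 - 1 / \<alpha>) * \<alpha> = \<alpha> - 1" using \<alpha>(1) by (simp add: field_simps)
      then show ?thesis using w \<alpha>(1) by (simp add: powr_mult powr_powr)
    qed
    also have "ennreal (l powr (- 2 / 3) * L * (w * V powr (\<alpha> - 1))) = ennreal (l powr (- 2 / 3) * L * V powr (\<alpha> - 1)) * W l"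
      using w L by (simp add: ennreal_mult'[symmetric] mult_ac)
    finally show ?thesis by (simp only: slice affine_density_def)
  qed
  \<comment> \<open>Pitt's inequality for the function \<open>F (y, s)\<close> of \<open>s\<close>
    gives a multiple of \<open>M y powr \<alpha>\<close>. The weight
    \<open>M y powr (1 - \<alpha>)\<close> reduces this to a multiple of \<open>M y\<close>, whose
    integral is at most \<open>V\<close>.\<close>
  have inner: "AE y in lborel. (\<integral>\<^sup>+l. ?w l y \<partial>lborel) \<le> ennreal (Cp * M y)"
    using m_fin F_slice M_zero
  proof eventually_elim
    fix y assume my: "m y = ennreal (M y)" and Fy: "integrable lborel (\<lambda>s. F (y, s))" and z: "M y = 0 \<longrightarrow> (\<forall>l. G l y = 0)"
    show "(\<integral>\<^sup>+l. ?w l y \<partial>lborel) \<le> ennreal (Cp * M y)"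
    proof (cases "M y = 0")
      case True
      then show ?thesis using z by simp
    next
      case False
      then have Mpos: "0 < M y" using M0[of y] by simp
      define g where "g r = (LINT s|lborel. F (y, s) * echar (r * s))" for r
      have [measurable]: "(\<lambda>s. F (y, s)) \<in> borel_measurable borel" by (rule Fym)
      have [measurable]: "g \<in> borel_measurable borel" unfolding g_def by measurable
      have "(\<integral>\<^sup>+l. ?w l y \<partial>lborel) \<le>
          (\<integral>\<^sup>+l. ennreal (M y powr (1 - \<alpha>)) * ennreal (norm (g (0 + \<epsilon> * l)) powr q * \<bar>0 + \<epsilon> * l\<bar> powr (- 2 / 3)) \<partial>lborel)"
        by (intro nn_integral_mono)
           (auto simp: g_def G_def abs_mult \<epsilon> mult.commute[of _ "\<epsilon> * _"] ennreal_mult'[symmetric] ennreal_mult''[symmetric] mult_ac split: split_indicator)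
      also have "\<dots> = ennreal (M y powr (1 - \<alpha>)) * (\<integral>\<^sup>+l. ennreal (norm (g (0 + \<epsilon> * l)) powr q * \<bar>0 + \<epsilon> * l\<bar> powr (- 2 / 3)) \<partial>lborel)"
        by (rule nn_integral_cmult) measurable
      also have "(\<integral>\<^sup>+l. ennreal (norm (g (0 + \<epsilon> * l)) powr q * \<bar>0 + \<epsilon> * l\<bar> powr (- 2 / 3)) \<partial>lborel) =
          (\<integral>\<^sup>+r. ennreal (norm (g r) powr q * \<bar>r\<bar> powr (- 2 / 3)) \<partial>lborel)"
        using \<epsilon> by (subst nn_integral_real_affine[where c=\<epsilon> and t=0]) auto
      also have "\<dots> \<le> ennreal (Cp * M y powr \<alpha>)"
        using pitt[OF P Fy Mpos] my by (simp add: Cp_def g_def q_def \<alpha>_def m_def p_def)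
      also have "ennreal (M y powr (1 - \<alpha>)) * ennreal (Cp * M y powr \<alpha>) = ennreal (Cp * (M y powr (1 - \<alpha>) * M y powr \<alpha>))"
        using Cp by (simp add: ennreal_mult'[symmetric] mult_ac)
      also have "M y powr (1 - \<alpha>) * M y powr \<alpha> = M y"
        using Mpos by (simp add: powr_add[symmetric])
      finally show ?thesis by (simp add: mult_left_mono)
    qed
  qed
  have "(\<integral>\<^sup>+l. (\<integral>\<^sup>+x. ennreal (norm (?F l x) powr q
      * k'' x powr (1 / 3)) \<partial>lborel) * indicator {0<..} l \<partial>lborel) \<le>
      (\<integral>\<^sup>+l. ennreal (L * V powr (\<alpha> - 1)) * (\<integral>\<^sup>+y. ?w l y \<partial>lborel) \<partial>lborel)"
  proof (rule nn_integral_mono)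
    fix l :: real
    show "(\<integral>\<^sup>+x. ennreal (norm (?F l x) powr q
      * k'' x powr (1 / 3)) \<partial>lborel) * indicator {0<..} l \<le>
      ennreal (L * V powr (\<alpha> - 1)) * (\<integral>\<^sup>+y. ?w l y \<partial>lborel)"
    proof (cases "0 < l")
      case True
      have "(\<integral>\<^sup>+y. ?w l y \<partial>lborel) = ennreal (l powr (- 2 / 3)) * W l"
        using True unfolding W_def lborel_prod[symmetric] by (simp add: nn_integral_cmult)
      then show ?thesis
        using slice_le[OF True] True L by (simp add: ennreal_mult' mult_ac)
    qed simp
  qed
  also have "\<dots> = ennreal (L * V powr (\<alpha> - 1)) * (\<integral>\<^sup>+l. (\<integral>\<^sup>+y. ?w l y \<partial>lborel) \<partial>lborel)"
    unfolding lborel_prod[symmetric] by (rule nn_integral_cmult) measurable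
  also have "(\<integral>\<^sup>+l. (\<integral>\<^sup>+y. ?w l y \<partial>lborel) \<partial>lborel) =
      (\<integral>\<^sup>+y. (\<integral>\<^sup>+l. ?w l y \<partial>lborel) \<partial>lborel)"
  proof (rule lborel_pair.Fubini')
    show "(\<lambda>(y, l). ?w l y) \<in>
      borel_measurable (lborel \<Otimes>\<^sub>M lborel)"
      unfolding lborel_prod[symmetric] by measurable
  qed
  also have "\<dots> \<le> (\<integral>\<^sup>+y. ennreal Cp * ennreal (M y) \<partial>lborel)"
    using inner Cp by (intro nn_integral_mono_AE) (simp add: ennreal_mult')
  also have "\<dots> = ennreal Cp * (\<integral>\<^sup>+y. ennreal (M y) \<partial>lborel)"
    unfolding lborel_prod[symmetric] by (rule nn_integral_cmult) measurable
  also have "\<dots> \<le> ennreal Cp * ennreal V"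
    by (intro mult_left_mono Mint) simp
  also have "ennreal (L * V powr (\<alpha> - 1)) * (ennreal Cp * ennreal V) = ennreal (L * Cp * (V powr (\<alpha> - 1) * V powr 1))"
    using L Cp V0 by (simp add: ennreal_mult'[symmetric] mult_ac)
  also have "V powr (\<alpha> - 1) * V powr 1 = V powr \<alpha>"
    by (simp only: powr_add[symmetric]) simp
  finally show ?thesis
    by (simp add: q_def \<alpha>_def L_def Cp_def mult_left_mono)
qed

section \<open>Geometry of the cone\<close>

lemma vector_2_eq: "(vector [a, b] :: real^2) = a *\<^sub>R axis 1 1 + b *\<^sub>R axis 2 1"
  by (simp add: vec_eq_iff forall_2 axis_def)

lemma vector_3_eq: "(vector [a, b, c] :: real^3) = a *\<^sub>R axis 1 1 + b *\<^sub>R axis 2 1 + c *\<^sub>R axis 3 1"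
  by (simp add: vec_eq_iff forall_3 axis_def)

lemma measurable_vector_2 [measurable]:
  assumes [measurable]: "f \<in> borel_measurable M" "g \<in> borel_measurable M"
  shows "(\<lambda>x. vector [f x, g x] :: real^2) \<in> borel_measurable M"
  unfolding vector_2_eq by measurable

lemma measurable_vector_3 [measurable]:
  assumes [measurable]: "f \<in> borel_measurable M" "g \<in> borel_measurable M" "h \<in> borel_measurable M"
  shows "(\<lambda>x. vector [f x, g x, h x] :: real^3) \<in> borel_measurable M"
  unfolding vector_3_eq by measurable

lemma prod_Basis_cart:
  fixes f :: "real^'n \<Rightarrow> 'b::comm_monoid_mult"
  shows "(\<Prod>b\<in>Basis. f b) = (\<Prod>i\<in>UNIV. f (axis i 1))"
proof -
  have B: "Basis = (\<lambda>i::'n. axis i (1::real)) ` UNIV"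
    by (auto simp: Basis_vec_def)
  show ?thesis
    unfolding B by (rule prod.reindex_cong[where l="\<lambda>i. axis i 1"]) (auto simp: inj_on_def axis_eq_axis)
qed

lemma lborel_eq_distr_vector_2:
  "(lborel :: (real^2) measure) = distr (lborel \<Otimes>\<^sub>M lborel) borel (\<lambda>p. vector [fst p, snd p])"
proof (rule lborel_eqI)
  fix l u :: "real^2" assume le: "\<And>b. b \<in> Basis \<Longrightarrow> l \<bullet> b \<le> u \<bullet> b"
  have le': "l $ i \<le> u $ i" for i
    using le[of "axis i 1"] by (simp add: inner_axis)
  have "(\<lambda>p. vector [fst p, snd p] :: real^2) -` box l u \<inter> space (lborel \<Otimes>\<^sub>M lborel) = {l $ 1<..<u $ 1} \<times> {l $ 2<..<u $ 2}"
    by (auto simp: mem_box_cart forall_2 space_pair_measure)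
  then have "emeasure (distr (lborel \<Otimes>\<^sub>M lborel) borel (\<lambda>p. vector [fst p, snd p])) (box l u) =
      emeasure (lborel \<Otimes>\<^sub>M lborel) ({l $ 1<..<u $ 1} \<times> {l $ 2<..<u $ 2})"
    by (subst emeasure_distr) auto
  also have "\<dots> = ennreal (u $ 1 - l $ 1) * ennreal (u $ 2 - l $ 2)"
    using le' by (subst lborel.emeasure_pair_measure_Times) auto
  also have "\<dots> = ennreal (\<Prod>b\<in>Basis. (u - l) \<bullet> b)"
    using le' by (simp add: prod_Basis_cart UNIV_2 inner_axis ennreal_mult'[symmetric])
  finally show "emeasure (distr (lborel \<Otimes>\<^sub>M lborel) borel (\<lambda>p. vector [fst p, snd p])) (box l u) = ennreal (\<Prod>b\<in>Basis. (u - l) \<bullet> b)" .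
qed simp

lemma lborel_eq_distr_vector_3:
  "(lborel :: (real^3) measure) = distr ((lborel \<Otimes>\<^sub>M lborel) \<Otimes>\<^sub>M lborel) borel (\<lambda>p. vector [fst (fst p), snd p, snd (fst p)])"
proof (rule lborel_eqI)
  fix l u :: "real^3" assume le: "\<And>b. b \<in> Basis \<Longrightarrow> l \<bullet> b \<le> u \<bullet> b"
  have le': "l $ i \<le> u $ i" for i
    using le[of "axis i 1"] by (simp add: inner_axis)
  have "(\<lambda>p. vector [fst (fst p), snd p, snd (fst p)] :: real^3) -` box l u \<inter> space ((lborel \<Otimes>\<^sub>M lborel) \<Otimes>\<^sub>M lborel) =
      ({l $ 1<..<u $ 1} \<times> {l $ 3<..<u $ 3}) \<times> {l $ 2<..<u $ 2}"
    by (auto simp: mem_box_cart forall_3 space_pair_measure)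
  then have "emeasure (distr ((lborel \<Otimes>\<^sub>M lborel) \<Otimes>\<^sub>M lborel) borel (\<lambda>p. vector [fst (fst p), snd p, snd (fst p)])) (box l u) =
      emeasure ((lborel \<Otimes>\<^sub>M lborel) \<Otimes>\<^sub>M lborel) (({l $ 1<..<u $ 1} \<times> {l $ 3<..<u $ 3}) \<times> {l $ 2<..<u $ 2})"
    by (subst emeasure_distr) auto
  also have "\<dots> = ennreal (u $ 1 - l $ 1) * ennreal (u $ 3 - l $ 3) * ennreal (u $ 2 - l $ 2)"
    using le' by (subst lborel.emeasure_pair_measure_Times, simp, simp, subst lborel.emeasure_pair_measure_Times) auto
  also have "\<dots> = ennreal (\<Prod>b\<in>Basis. (u - l) \<bullet> b)"
  proof -
    have prod_3: "(\<Prod>i\<in>UNIV. f i) = f 1 * f 2 * f 3" for f :: "3 \<Rightarrow> real"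
      unfolding UNIV_3 by (simp add: ac_simps)
    have "(\<Prod>b\<in>Basis. (u - l) \<bullet> b) = (u $ 1 - l $ 1) * (u $ 2 - l $ 2) * (u $ 3 - l $ 3)"
      by (simp add: prod_Basis_cart prod_3 inner_axis)
    also have "\<dots> = (u $ 1 - l $ 1) * (u $ 3 - l $ 3) * (u $ 2 - l $ 2)"
      by (simp only: mult.assoc mult.commute[of "u $ 2 - l $ 2"])
    finally show ?thesis
      using le' by (simp only: ennreal_mult mult_nonneg_nonneg diff_ge_0_iff_ge)
  qed
  finally show "emeasure (distr ((lborel \<Otimes>\<^sub>M lborel) \<Otimes>\<^sub>M lborel) borel (\<lambda>p. vector [fst (fst p), snd p, snd (fst p)])) (box l u) =
      ennreal (\<Prod>b\<in>Basis. (u - l) \<bullet> b)" .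
qed simp

text \<open>Here \<epsilon> is the sign of the second coordinate, \<open>l\<close> its absolute
  value and \<open>x\<close> the first coordinate divided by \<open>l\<close>; the factor
  \<open>l\<close> is the Jacobian. The line where the second coordinate vanishes is a null
  set.\<close>

lemma nn_integral_real_2_sectors:
  fixes f :: "real^2 \<Rightarrow> ennreal"
  assumes [measurable]: "f \<in> borel_measurable borel"
  shows "(\<integral>\<^sup>+\<xi>. f \<xi> \<partial>lborel) = (\<Sum>\<epsilon>\<in>{1, -1::real}. \<integral>\<^sup>+l. (\<integral>\<^sup>+x. ennreal l * f (vector [l * x, \<epsilon> * l]) \<partial>lborel) * indicator {0<..} l \<partial>lborel)"
proof -
  have scale: "(\<integral>\<^sup>+u. f (vector [u, v]) \<partial>lborel) = (\<integral>\<^sup>+x. ennreal l * f (vector [l * x, v]) \<partial>lborel)" if "0 < l" for l v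
    using that by (subst nn_integral_real_affine[where c=l and t=0]) (auto simp: nn_integral_cmult)
  have "(\<integral>\<^sup>+\<xi>. f \<xi> \<partial>lborel) = (\<integral>\<^sup>+p. f (vector [fst p, snd p]) \<partial>(lborel \<Otimes>\<^sub>M lborel))"
    by (subst lborel_eq_distr_vector_2) (simp add: nn_integral_distr)
  also have "\<dots> = (\<integral>\<^sup>+v. \<integral>\<^sup>+u. f (vector [u, v]) \<partial>lborel \<partial>lborel)"
    by (subst lborel_pair.nn_integral_snd[symmetric]) auto
  also have "\<dots> = (\<integral>\<^sup>+v. (\<integral>\<^sup>+u. f (vector [u, v]) \<partial>lborel) * indicator {0<..} v + (\<integral>\<^sup>+u. f (vector [u, v]) \<partial>lborel) * indicator {..<0} v \<partial>lborel)"
    using AE_lborel_singleton[of "0::real"] by (intro nn_integral_cong_AE) (auto split: split_indicator)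
  also have "\<dots> = (\<integral>\<^sup>+v. (\<integral>\<^sup>+u. f (vector [u, v]) \<partial>lborel) * indicator {0<..} v \<partial>lborel) + (\<integral>\<^sup>+v. (\<integral>\<^sup>+u. f (vector [u, v]) \<partial>lborel) * indicator {..<0} v \<partial>lborel)"
    by (intro nn_integral_add) measurable
  also have "(\<integral>\<^sup>+v. (\<integral>\<^sup>+u. f (vector [u, v]) \<partial>lborel) * indicator {..<0} v \<partial>lborel) =
      (\<integral>\<^sup>+v. (\<integral>\<^sup>+u. f (vector [u, - v]) \<partial>lborel) * indicator {0<..} v \<partial>lborel)"
    by (subst nn_integral_real_affine[where c="-1" and t=0]) (auto intro!: nn_integral_cong split: split_indicator)
  also have "(\<integral>\<^sup>+v. (\<integral>\<^sup>+u. f (vector [u, v]) \<partial>lborel) * indicator {0<..} v \<partial>lborel) =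
      (\<integral>\<^sup>+l. (\<integral>\<^sup>+x. ennreal l * f (vector [l * x, 1 * l]) \<partial>lborel) * indicator {0<..} l \<partial>lborel)"
    by (intro nn_integral_cong) (auto simp: scale split: split_indicator)
  also have "(\<integral>\<^sup>+v. (\<integral>\<^sup>+u. f (vector [u, - v]) \<partial>lborel) * indicator {0<..} v \<partial>lborel) =
      (\<integral>\<^sup>+l. (\<integral>\<^sup>+x. ennreal l * f (vector [l * x, - 1 * l]) \<partial>lborel) * indicator {0<..} l \<partial>lborel)"
    by (intro nn_integral_cong) (auto simp: scale split: split_indicator)
  finally show ?thesis by simp
qed

section \<open>The generator as a gauge function, its slices and the weight\<close>

locale cone_generator =
  fixes \<Omega> :: "(real^2) set" and \<phi> :: "real^2 \<Rightarrow> real"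
  assumes admissible: "admissible_domain \<Omega>" and generator: "homogeneous_generator (frontier \<Omega>) \<phi>"
begin

lemma nonneg: "0 \<le> \<phi> \<xi>"
  and smooth: "smooth_on (- {0}) \<phi>"
  and homogeneous: "0 \<le> t \<Longrightarrow> \<phi> (t *\<^sub>R \<xi>) = t * \<phi> \<xi>"
  and level_set: "\<phi> \<xi> = 1 \<longleftrightarrow> \<xi> \<in> frontier \<Omega>"
  using generator by (auto simp: homogeneous_generator_def)

lemma ray:
  assumes "\<xi> \<noteq> 0"
  obtains d where "0 < d" "d *\<^sub>R \<xi> \<in> frontier \<Omega>" "d * \<phi> \<xi> = 1"
proof -
  have "bounded \<Omega>" "0 \<in> interior \<Omega>"
    using admissible by (auto simp: admissible_domain_def compact_imp_bounded)
  from ray_to_frontier[OF this assms]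
  obtain d where d: "0 < d" "0 + d *\<^sub>R \<xi> \<in> frontier \<Omega>" by metis
  then have "\<phi> (d *\<^sub>R \<xi>) = 1" by (simp add: level_set)
  then show ?thesis using that[of d] d homogeneous[of d \<xi>] by simp
qed

lemma pos: "\<xi> \<noteq> 0 \<Longrightarrow> 0 < \<phi> \<xi>"
  using ray[of \<xi>] by (metis nonneg less_eq_real_def mult_zero_right zero_neq_one)

text \<open>This identifies \<phi>, given only by homogeneity and its level set, as the Minkowski
  gauge of \<Omega>. If a point \<xi> of \<Omega> had value above 1, its ray would meet the frontier
  at \<open>d *\<^sub>R \<xi>\<close> with \<open>d < 1\<close>, strictly between \<xi> and the
  interior point 0; by convexity such a point is interior.\<close>

lemma sublevel_iff: "\<phi> \<xi> \<le> 1 \<longleftrightarrow> \<xi> \<in> \<Omega>"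
proof (cases "\<xi> = 0")
  case True
  moreover have "\<phi> 0 = 0" using homogeneous[of 0 0] by simp
  moreover have "0 \<in> \<Omega>" using admissible interior_subset by (auto simp: admissible_domain_def)
  ultimately show ?thesis by simp
next
  case False
  have \<Omega>: "closed \<Omega>" "convex \<Omega>" "0 \<in> interior \<Omega>" "0 \<in> \<Omega>"
    using admissible interior_subset by (auto simp: admissible_domain_def compact_imp_closed)
  obtain d where d: "0 < d" "d *\<^sub>R \<xi> \<in> frontier \<Omega>" "d * \<phi> \<xi> = 1" using ray[OF False] by blast
  have d\<Omega>: "d *\<^sub>R \<xi> \<in> \<Omega>" "d *\<^sub>R \<xi> \<notin> interior \<Omega>"
    using d(2) \<Omega>(1) by (auto simp: frontier_def)
  show ?thesis
  proof
    assume "\<phi> \<xi> \<le> 1"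
    then have "(1 - \<phi> \<xi>) *\<^sub>R 0 + \<phi> \<xi> *\<^sub>R (d *\<^sub>R \<xi>) \<in> \<Omega>"
      using \<Omega> d\<Omega> nonneg by (intro convexD) auto
    moreover have "\<phi> \<xi> *\<^sub>R (d *\<^sub>R \<xi>) = \<xi>" using d(3) by (simp add: mult.commute)
    ultimately show "\<xi> \<in> \<Omega>" by simp
  next
    assume \<xi>: "\<xi> \<in> \<Omega>"
    show "\<phi> \<xi> \<le> 1"
    proof (rule ccontr)
      assume "\<not> \<phi> \<xi> \<le> 1"
      then have "d < 1" using d by (smt (verit) mult_less_cancel_left2 mult.commute)
      then have "\<xi> - (1 - d) *\<^sub>R (\<xi> - 0) \<in> interior \<Omega>"
        using d by (intro mem_interior_convex_shrink \<Omega> \<xi>) auto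
      then show False using d\<Omega> by (simp add: algebra_simps)
    qed
  qed
qed

text \<open>The usual gauge argument: both vectors are normalised into \<Omega> and combined
  convexly with weights proportional to their gauges.\<close>

lemma subadditive: "\<phi> (\<xi> + \<eta>) \<le> \<phi> \<xi> + \<phi> \<eta>"
proof (cases "\<xi> = 0 \<or> \<eta> = 0")
  case True
  then show ?thesis using nonneg by auto
next
  case False
  then have p: "0 < \<phi> \<xi>" "0 < \<phi> \<eta>" using pos by auto
  define s where "s = \<phi> \<xi> + \<phi> \<eta>"
  have s: "0 < s" using p by (simp add: s_def)
  have on: "(1 / \<phi> \<zeta>) *\<^sub>R \<zeta> \<in> \<Omega>" if "0 < \<phi> \<zeta>" for \<zeta>
    using that homogeneous[of "1 / \<phi> \<zeta>" \<zeta>] by (simp add: sublevel_iff[symmetric])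
  have "convex \<Omega>" using admissible by (simp add: admissible_domain_def)
  then have "(\<phi> \<xi> / s) *\<^sub>R ((1 / \<phi> \<xi>) *\<^sub>R \<xi>) + (\<phi> \<eta> / s) *\<^sub>R ((1 / \<phi> \<eta>) *\<^sub>R \<eta>) \<in> \<Omega>"
    using p s by (intro convexD on) (auto simp: s_def add_divide_distrib[symmetric])
  then have "(1 / s) *\<^sub>R (\<xi> + \<eta>) \<in> \<Omega>"
    using p by (simp add: scaleR_add_right)
  then have "\<phi> ((1 / s) *\<^sub>R (\<xi> + \<eta>)) \<le> 1" by (simp add: sublevel_iff)
  then have "\<phi> (\<xi> + \<eta>) \<le> s" using s homogeneous[of "1 / s" "\<xi> + \<eta>"] by (simp add: divide_le_eq)
  then show ?thesis by (simp add: s_def)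
qed

lemma differentiable_partial:
  assumes "\<xi> \<noteq> 0"
  shows "iterated_partial (map (\<lambda>i. axis i 1) js) \<phi> differentiable (at \<xi>)"
proof -
  have "map (\<lambda>i. axis i 1) js \<in> lists (Basis :: (real^2) set)"
    by (auto simp: axis_in_Basis_iff)
  then show ?thesis using smooth assms by (auto simp: smooth_on_def)
qed

text \<open>Smoothness gives continuity away from the origin; altering a function at one point
  preserves Borel measurability, whatever value the derivative takes at 0.\<close>

lemma measurable_partial:
  "iterated_partial (map (\<lambda>i. axis i 1) js) \<phi> \<in> borel_measurable borel"
proof -
  let ?f = "iterated_partial (map (\<lambda>i. axis i 1) js) \<phi>"
  have "continuous_on (- {0}) ?f"
    by (intro continuous_at_imp_continuous_on ballI differentiable_imp_continuous_within differentiable_partial) auto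
  then have "(\<lambda>x. indicator (- {0}) x *\<^sub>R ?f x) \<in> borel_measurable borel"
    by (intro borel_measurable_continuous_on_indicator) auto
  then have "(\<lambda>x. if x = 0 then ?f 0 else indicator (- {0}) x *\<^sub>R ?f x) \<in> borel_measurable borel"
    by measurable
  also have "(\<lambda>x. if x = 0 then ?f 0 else indicator (- {0}) x *\<^sub>R ?f x) = ?f"
    by auto
  finally show ?thesis .
qed

lemma measurable_\<phi> [measurable]: "\<phi> \<in> borel_measurable borel"
  using measurable_partial[where js="[]"] by simp

lemma measurable_weight [measurable]: "weight \<phi> \<in> borel_measurable borel"
proof -
  have [measurable]: "(\<lambda>\<xi>. grad \<phi> \<xi> $ i) \<in> borel_measurable borel"
      "(\<lambda>\<xi>. hessian \<phi> \<xi> $ i $ j) \<in> borel_measurable borel" for i j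
    using measurable_partial[where js="[i]"] measurable_partial[where js="[i, j]"] by (simp_all add: grad_def hessian_def)
  show ?thesis
    unfolding weight_def[abs_def] adjugate2_def inner_vec_def matrix_vector_mult_def
    by (simp add: sum_2)
qed

lemma measurable_cone_point [measurable]: "cone_point \<phi> \<in> borel_measurable borel"
proof -
  have [measurable]: "(\<lambda>\<xi>::real^2. \<xi> $ i) \<in> borel_measurable borel" for i
    by (intro borel_measurable_continuous_onI continuous_intros)
  show ?thesis unfolding cone_point_def[abs_def] by measurable
qed

definition slice :: "real \<Rightarrow> real \<Rightarrow> real" where
  "slice \<epsilon> x = \<phi> (vector [x, \<epsilon>])"

definition slice' :: "real \<Rightarrow> real \<Rightarrow> real" where
  "slice' \<epsilon> x = iterated_partial [axis 1 1] \<phi> (vector [x, \<epsilon>])"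

definition slice'' :: "real \<Rightarrow> real \<Rightarrow> real" where
  "slice'' \<epsilon> x = iterated_partial [axis 1 1, axis 1 1] \<phi> (vector [x, \<epsilon>])"

lemma DERIV_horizontal:
  fixes f :: "real^2 \<Rightarrow> real"
  assumes "f differentiable (at (vector [x, \<epsilon>]))"
  shows "((\<lambda>x. f (vector [x, \<epsilon>])) has_real_derivative frechet_derivative f (at (vector [x, \<epsilon>])) (axis 1 1)) (at x)"
proof -
  define D where "D = frechet_derivative f (at (vector [x, \<epsilon>]))"
  have D: "(f has_derivative D) (at (vector [x, \<epsilon>]))"
    using assms by (simp add: D_def frechet_derivative_works[symmetric])
  have "((\<lambda>x. vector [x, \<epsilon>] :: real^2) has_derivative (\<lambda>h. h *\<^sub>R axis 1 1)) (at x)"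
    unfolding vector_2_eq by (auto intro!: derivative_eq_intros)
  from has_derivative_compose[OF this D]
  have "((\<lambda>x. f (vector [x, \<epsilon>])) has_derivative (\<lambda>h. D (h *\<^sub>R axis 1 1))) (at x)" .
  moreover have "D (h *\<^sub>R axis 1 1) = D (axis 1 1) * h" for h
    using linear_cmul[OF has_derivative_linear[OF D], of h] by (simp add: mult.commute)
  ultimately show ?thesis
    by (simp add: has_field_derivative_def D_def)
qed

lemma convex_curve_slice:
  assumes "\<bar>\<epsilon>\<bar> = 1"
  shows "convex_curve (slice \<epsilon>) (slice' \<epsilon>) (slice'' \<epsilon>)"
proof
  have ne: "(vector [x, \<epsilon>] :: real^2) \<noteq> 0" for x
  proof -
    have "(vector [x, \<epsilon>] :: real^2) $ 2 \<noteq> 0" using assms by auto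
    then show ?thesis by (metis zero_index)
  qed
  show d1: "(slice \<epsilon> has_real_derivative slice' \<epsilon> x) (at x)" for x
    using DERIV_horizontal[OF differentiable_partial[where js="[]", OF ne]]
    by (simp add: slice_def[abs_def] slice'_def)
  show d2: "(slice' \<epsilon> has_real_derivative slice'' \<epsilon> x) (at x)" for x
    using DERIV_horizontal[OF differentiable_partial[where js="[1]", OF ne]]
    by (simp add: slice'_def[abs_def] slice''_def)
  show "continuous_on UNIV (slice'' \<epsilon>)"
    using DERIV_horizontal[OF differentiable_partial[where js="[1, 1]", OF ne]]
    by (intro continuous_at_imp_continuous_on ballI DERIV_isCont) (simp add: slice''_def[abs_def])
  have conv: "convex_on UNIV (slice \<epsilon>)"
  proof (intro convex_onI)
    fix t x y :: real assume t: "0 < t" "t < 1"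
    have "(vector [(1 - t) *\<^sub>R x + t *\<^sub>R y, \<epsilon>] :: real^2) = (1 - t) *\<^sub>R vector [x, \<epsilon>] + t *\<^sub>R vector [y, \<epsilon>]"
      by (simp add: vec_eq_iff forall_2 algebra_simps)
    then show "slice \<epsilon> ((1 - t) *\<^sub>R x + t *\<^sub>R y) \<le> (1 - t) * slice \<epsilon> x + t * slice \<epsilon> y"
      using t subadditive[of "(1 - t) *\<^sub>R vector [x, \<epsilon>]" "t *\<^sub>R vector [y, \<epsilon>]"]
      by (simp add: slice_def homogeneous)
  qed simp
  \<comment> \<open>Adding the tangent inequalities at two points shows that the derivative is
    monotone, which gives the sign of the second derivative.\<close>
  have tangent: "slice' \<epsilon> x * (y - x) \<le> slice \<epsilon> y - slice \<epsilon> x" for x y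
    by (rule convex_on_imp_above_tangent[OF conv]) (auto intro: d1)
  have "mono_on UNIV (slice' \<epsilon>)"
  proof (rule mono_onI)
    fix x y :: real assume xy: "x \<le> y"
    have "(slice' \<epsilon> y - slice' \<epsilon> x) * (y - x) \<ge> 0"
      using tangent[of x y] tangent[of y x] by (simp add: algebra_simps)
    then show "slice' \<epsilon> x \<le> slice' \<epsilon> y"
      using xy by (cases "x = y") (auto simp: zero_le_mult_iff)
  qed
  then show "0 \<le> slice'' \<epsilon> x" for x
    by (rule mono_on_imp_deriv_nonneg[OF _ d2]) simp
qed

lemma sector:
  assumes "\<bar>\<epsilon>\<bar> = 1" and "0 < \<epsilon> * \<xi> $ 2"
  shows "\<phi> \<xi> = \<epsilon> * \<xi> $ 2 * slice \<epsilon> (\<xi> $ 1 / (\<epsilon> * \<xi> $ 2))"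
proof -
  have "\<epsilon> * \<epsilon> = 1" using assms(1) by (metis abs_mult_self_eq mult_1)
  then have "\<xi> = (\<epsilon> * \<xi> $ 2) *\<^sub>R vector [\<xi> $ 1 / (\<epsilon> * \<xi> $ 2), \<epsilon>]"
    using assms(2) by (auto simp: vec_eq_iff forall_2 mult_ac)
  then show ?thesis
    unfolding slice_def using homogeneous assms(2) by (metis less_imp_le)
qed

text \<open>Write k for the slice and s for the first coordinate divided by l. Then \<phi> = l k(s)
  has gradient (k', \<epsilon> (k - s k')) and the rank-one Hessian k''/l times the matrix with rows
  (1, -\<epsilon> s) and (-\<epsilon> s, s^2). The adjugate form at the gradient collapses to k''/l
  times the square of s k' + (k - s k') = k, and the last factor of the weight is \<phi> = l
  k.\<close>

lemma weight_sector:
  assumes \<epsilon>: "\<bar>\<epsilon>\<bar> = 1" and l: "0 < l"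
  shows "weight \<phi> (vector [l * x, \<epsilon> * l]) = slice'' \<epsilon> x * slice \<epsilon> x ^ 3"
proof -
  interpret convex_curve "slice \<epsilon>" "slice' \<epsilon>" "slice'' \<epsilon>"
    by (rule convex_curve_slice[OF \<epsilon>])
  define H where "H = {\<xi>::real^2. 0 < \<epsilon> * \<xi> $ 2}"
  have H: "open H"
    unfolding H_def by (intro open_Collect_less continuous_intros)
  have \<epsilon>2: "\<epsilon> * \<epsilon> = 1" using \<epsilon> by (metis abs_mult_self_eq mult_1)
  define s where "s \<xi> = \<xi> $ 1 / (\<epsilon> * \<xi> $ 2)" for \<xi> :: "real^2"
  let ?d = "\<lambda>\<xi> h. ((h $ 1 - s \<xi> * \<epsilon> * h $ 2) / (\<epsilon> * \<xi> $ 2))"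
  have nth: "((\<lambda>\<xi>::real^2. \<xi> $ i) has_derivative (\<lambda>h. h $ i)) (at \<xi>)" for i \<xi>
    by (rule bounded_linear_imp_has_derivative[OF bounded_linear_vec_nth])
  have s_deriv: "(s has_derivative (\<lambda>h. (h $ 1 - s \<xi> * \<epsilon> * h $ 2) / (\<epsilon> * \<xi> $ 2))) (at \<xi>)" if "\<xi> \<in> H" for \<xi>
  proof -
    have ne: "\<epsilon> \<noteq> 0" "\<xi> $ 2 \<noteq> 0" using that by (auto simp: H_def)
    show ?thesis
      unfolding s_def[abs_def]
      by (rule derivative_eq_intros nth refl | use ne in \<open>force simp: field_simps\<close>)+
  qed
  have A_deriv: "((\<lambda>\<xi>. A (s \<xi>)) has_derivative (\<lambda>h. A' * (?d \<xi> h))) (at \<xi>)"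
    if "\<xi> \<in> H" "(A has_real_derivative A') (at (s \<xi>))" for A A' \<xi>
    using has_derivative_compose[OF s_deriv[OF that(1)] that(2)[unfolded has_field_derivative_def]] .
  \<comment> \<open>A derivative sees only a neighbourhood of the point. The formulas for \<phi> and
    its first partials are therefore proved on the whole open half-plane \<open>H\<close>, so that
    they can be differentiated again to give the Hessian.\<close>
  have partial: "iterated_partial (v # vs) \<phi> \<xi> = D v"
    if "\<xi> \<in> H" "(f has_derivative D) (at \<xi>)" "\<And>\<zeta>. \<zeta> \<in> H \<Longrightarrow> f \<zeta> = iterated_partial vs \<phi> \<zeta>" for f D \<xi> v vs
  proof -
    have "(iterated_partial vs \<phi> has_derivative D) (at \<xi>)"
      by (rule has_derivative_transform_within_open[OF that(2) H that(1) that(3)])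
    from frechet_derivative_at[OF this] show ?thesis by simp
  qed
  have \<phi>_eq: "\<epsilon> * \<xi> $ 2 * slice \<epsilon> (s \<xi>) = \<phi> \<xi>" if "\<xi> \<in> H" for \<xi>
    using sector[OF \<epsilon>, of \<xi>] that by (simp add: H_def s_def)
  have \<phi>_deriv: "((\<lambda>\<xi>. \<epsilon> * \<xi> $ 2 * slice \<epsilon> (s \<xi>)) has_derivative
      (\<lambda>h. \<epsilon> * \<xi> $ 2 * (slice' \<epsilon> (s \<xi>) * (?d \<xi> h)) + \<epsilon> * h $ 2 * slice \<epsilon> (s \<xi>))) (at \<xi>)"
    if "\<xi> \<in> H" for \<xi>
    by (rule has_derivative_mult[OF has_derivative_mult_right[OF nth] A_deriv[OF that deriv_k]])
  have ne: "\<epsilon> \<noteq> 0" "\<xi> $ 2 \<noteq> 0" if "\<xi> \<in> H" for \<xi>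
    using that by (auto simp: H_def)
  have g1: "slice' \<epsilon> (s \<xi>) = iterated_partial [axis 1 1] \<phi> \<xi>" if "\<xi> \<in> H" for \<xi>
    using partial[OF that \<phi>_deriv[OF that], of "[]" "axis 1 1"] \<phi>_eq that by (auto simp: H_def axis_def)
  have g2: "\<epsilon> * (slice \<epsilon> (s \<xi>) - s \<xi> * slice' \<epsilon> (s \<xi>)) = iterated_partial [axis 2 1] \<phi> \<xi>" if "\<xi> \<in> H" for \<xi>
    using partial[OF that \<phi>_deriv[OF that], of "[]" "axis 2 1"] \<phi>_eq that ne[OF that] by (auto simp: H_def axis_def algebra_simps)
  have g1_deriv: "((\<lambda>\<xi>. slice' \<epsilon> (s \<xi>)) has_derivative
      (\<lambda>h. slice'' \<epsilon> (s \<xi>) * (?d \<xi> h))) (at \<xi>)" if "\<xi> \<in> H" for \<xi>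
    by (rule A_deriv[OF that deriv_k'])
  have g2_deriv: "((\<lambda>\<xi>. \<epsilon> * (slice \<epsilon> (s \<xi>) - s \<xi> * slice' \<epsilon> (s \<xi>))) has_derivative
      (\<lambda>h. - \<epsilon> * s \<xi> * slice'' \<epsilon> (s \<xi>) * (?d \<xi> h))) (at \<xi>)" if "\<xi> \<in> H" for \<xi>
  proof -
    have "((\<lambda>t. \<epsilon> * (slice \<epsilon> t - t * slice' \<epsilon> t)) has_real_derivative - \<epsilon> * t * slice'' \<epsilon> t) (at t)" for t
      by (auto intro!: derivative_eq_intros deriv_k deriv_k' simp: algebra_simps)
    from A_deriv[OF that this] show ?thesis .
  qed
  define \<xi> :: "real^2" where "\<xi> = vector [l * x, \<epsilon> * l]"
  have el: "\<epsilon> * \<xi> $ 2 = l" using \<epsilon>2 by (simp add: \<xi>_def mult.assoc[symmetric])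
  have \<xi>: "\<xi> \<in> H" "s \<xi> = x" using el l by (simp_all add: H_def s_def) (simp add: \<xi>_def)
  have grad: "grad \<phi> \<xi> $ 1 = slice' \<epsilon> x" "grad \<phi> \<xi> $ 2 = \<epsilon> * (slice \<epsilon> x - x * slice' \<epsilon> x)"
    using g1[OF \<xi>(1)] g2[OF \<xi>(1)] \<xi>(2) by (simp_all add: grad_def)
  have hess: "hessian \<phi> \<xi> $ 1 $ 1 = slice'' \<epsilon> x / l" "hessian \<phi> \<xi> $ 2 $ 1 = - \<epsilon> * x * slice'' \<epsilon> x / l"
      "hessian \<phi> \<xi> $ 1 $ 2 = - \<epsilon> * x * slice'' \<epsilon> x / l" "hessian \<phi> \<xi> $ 2 $ 2 = x\<^sup>2 * slice'' \<epsilon> x / l"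
    using partial[OF \<xi>(1) g1_deriv[OF \<xi>(1)] g1, of "axis 1 1"] partial[OF \<xi>(1) g1_deriv[OF \<xi>(1)] g1, of "axis 2 1"]
      partial[OF \<xi>(1) g2_deriv[OF \<xi>(1)] g2, of "axis 1 1"] partial[OF \<xi>(1) g2_deriv[OF \<xi>(1)] g2, of "axis 2 1"] \<epsilon>2
    unfolding \<xi>(2) el by (simp_all add: hessian_def axis_def power2_eq_square algebra_simps)
  have "\<phi> \<xi> = l * slice \<epsilon> x" using \<phi>_eq[OF \<xi>(1)] el \<xi>(2) by simp
  moreover have "(adjugate2 (hessian \<phi> \<xi>) *v grad \<phi> \<xi>) \<bullet> grad \<phi> \<xi> =
      hessian \<phi> \<xi> $ 2 $ 2 * (grad \<phi> \<xi> $ 1)\<^sup>2 - hessian \<phi> \<xi> $ 1 $ 2 * grad \<phi> \<xi> $ 1 * grad \<phi> \<xi> $ 2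
      - hessian \<phi> \<xi> $ 2 $ 1 * grad \<phi> \<xi> $ 1 * grad \<phi> \<xi> $ 2 + hessian \<phi> \<xi> $ 1 $ 1 * (grad \<phi> \<xi> $ 2)\<^sup>2"
    by (simp add: adjugate2_def inner_vec_def matrix_vector_mult_def sum_2 power2_eq_square algebra_simps)
  moreover have "\<dots> = slice'' \<epsilon> x / l * (slice \<epsilon> x)\<^sup>2"
  proof -
    have "\<epsilon> = 1 \<or> \<epsilon> = - 1" using \<epsilon> by auto
    then show ?thesis
      unfolding hess grad using l by (auto simp: field_simps power2_eq_square)
  qed
  ultimately show ?thesis
    using l by (simp add: weight_def \<xi>_def[symmetric] power2_eq_square power3_eq_cube)
qed

lemma \<phi>_sector: "0 < l \<Longrightarrow> \<phi> (vector [l * x, \<epsilon> * l]) = l * slice \<epsilon> x"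
proof -
  assume "0 < l"
  moreover have "(vector [l * x, \<epsilon> * l] :: real^2) = l *\<^sub>R vector [x, \<epsilon>]"
    by (simp add: vec_eq_iff forall_2)
  ultimately show ?thesis by (simp add: homogeneous slice_def)
qed

lemma cone_density_sector:
  assumes \<epsilon>: "\<bar>\<epsilon>\<bar> = 1" and l: "0 < l"
  shows "weight \<phi> (vector [l * x, \<epsilon> * l]) powr (1 / 3) / \<phi> (vector [l * x, \<epsilon> * l]) = slice'' \<epsilon> x powr (1 / 3) / l"
proof -
  have "(vector [x, \<epsilon>] :: real^2) $ 2 \<noteq> 0" using \<epsilon> by auto
  then have "(vector [x, \<epsilon>] :: real^2) \<noteq> 0" by (metis zero_index)
  then have s: "0 < slice \<epsilon> x" unfolding slice_def by (rule pos)
  have "0 \<le> slice'' \<epsilon> x"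
    using convex_curve.k''_nonneg[OF convex_curve_slice[OF \<epsilon>]] .
  then have "weight \<phi> (vector [l * x, \<epsilon> * l]) powr (1 / 3) = slice'' \<epsilon> x powr (1 / 3) * (slice \<epsilon> x powr 3) powr (1 / 3)"
    using s by (simp add: weight_sector[OF \<epsilon> l] powr_mult powr_numeral)
  also have "(slice \<epsilon> x powr 3) powr (1 / 3) = slice \<epsilon> x"
    using s by (simp only: powr_powr) simp
  finally show ?thesis using s by (simp add: \<phi>_sector[OF l])
qed

end

section \<open>Schwartz functions and the Fourier transform in coordinates\<close>

lemma schwartz_continuous:
  assumes "schwartz F"
  shows "continuous_on UNIV F"
proof -
  have "F differentiable (at x)" for x
    using assms unfolding schwartz_def smooth_on_def by (metis UNIV_I iterated_partial.simps(1) lists.Nil)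
  then show ?thesis
    by (intro continuous_at_imp_continuous_on ballI differentiable_imp_continuous_within)
qed

lemma integrable_inverse_one_plus_square: "integrable lborel (\<lambda>x::real. inverse (1 + x\<^sup>2))"
  using integrable_inverse_1_plus_square by (simp add: set_integrable_def)

lemma schwartz_integrable:
  fixes F :: "real^3 \<Rightarrow> complex"
  assumes F: "schwartz F"
  shows "integrable lborel (\<lambda>z::(real \<times> real) \<times> real. F (vector [fst (fst z), snd z, snd (fst z)]))"
proof -
  let ?F = "\<lambda>z. F (vector [fst (fst z), snd z, snd (fst z)])"
  define w where "w t = inverse (1 + t\<^sup>2)" for t :: real
  have w: "integrable lborel w"
    unfolding w_def[abs_def] by (rule integrable_inverse_one_plus_square)
  have w0: "0 < w t" for t by (simp add: w_def add_pos_nonneg)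
  have [measurable]: "F \<in> borel_measurable borel"
    by (intro borel_measurable_continuous_onI schwartz_continuous F)
  have decay: "\<exists>C. \<forall>x. norm x ^ k * norm (F x) \<le> C" for k
    using F unfolding schwartz_def by (metis iterated_partial.simps(1) lists.Nil)
  obtain C0 where C0: "\<And>x. norm (F x) \<le> C0" using decay[of 0] by auto
  obtain C6 where C6: "\<And>x. norm x ^ 6 * norm (F x) \<le> C6" using decay[of 6] by blast
  \<comment> \<open>With t the squared norm, the product of the three factors 1 + a^2, 1 + b^2, 1 +
    c^2 is at most (1 + t)^3 and hence at most 4 (1 + t^3). Decay of orders 0 and 6 therefore gives
    an integrable product majorant.\<close>
  define C where "C = 4 * (C0 + C6)"
  have bound: "norm (F (vector [a, b, c])) \<le> C * (w a * w c * w b)" for a b c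
  proof -
    define x :: "real^3" where "x = vector [a, b, c]"
    define t where "t = (norm x)\<^sup>2"
    have t: "0 \<le> t" "a\<^sup>2 \<le> t" "b\<^sup>2 \<le> t" "c\<^sup>2 \<le> t"
    proof -
      have "t = a\<^sup>2 + b\<^sup>2 + c\<^sup>2"
        unfolding t_def power2_norm_eq_inner x_def inner_vec_def sum_3 by (simp add: power2_eq_square)
      then show "0 \<le> t" "a\<^sup>2 \<le> t" "b\<^sup>2 \<le> t" "c\<^sup>2 \<le> t" by simp_all
    qed
    have "(1 + a\<^sup>2) * (1 + c\<^sup>2) * (1 + b\<^sup>2) \<le> (1 + t) * (1 + t) * (1 + t)"
      using t by (intro mult_mono) auto
    also have "\<dots> \<le> 4 * (1 + t ^ 3)"
    proof -
      \<comment> \<open>This product is the difference of the two sides, 4 (1 + t^3) - (1 +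
        t)^3.\<close>
      have "0 \<le> 3 * ((1 - t)\<^sup>2 * (1 + t))" using t by simp
      then show ?thesis by (simp add: algebra_simps power2_eq_square power3_eq_cube)
    qed
    finally have "(1 + a\<^sup>2) * (1 + c\<^sup>2) * (1 + b\<^sup>2) * norm (F x) \<le> 4 * (1 + t ^ 3) * norm (F x)"
      by (rule mult_right_mono) simp
    also have "\<dots> = 4 * (norm (F x) + norm x ^ 6 * norm (F x))"
      by (simp add: t_def algebra_simps flip: power_mult)
    also have "\<dots> \<le> C" using C0[of x] C6[of x] by (simp add: C_def)
    finally have "(1 + a\<^sup>2) * (1 + c\<^sup>2) * (1 + b\<^sup>2) * norm (F x) \<le> C" .
    then have "w a * w c * w b * ((1 + a\<^sup>2) * (1 + c\<^sup>2) * (1 + b\<^sup>2) * norm (F x)) \<le> w a * w c * w b * C"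
      using w0 by (intro mult_left_mono) (auto simp: less_imp_le)
    moreover have "w a * w c * w b * ((1 + a\<^sup>2) * (1 + c\<^sup>2) * (1 + b\<^sup>2) * norm (F x)) = norm (F x)"
    proof -
      have "w t * (1 + t\<^sup>2) = 1" for t :: real
        using w0[of t] by (simp add: w_def)
      moreover have "w a * w c * w b * ((1 + a\<^sup>2) * (1 + c\<^sup>2) * (1 + b\<^sup>2) * norm (F x)) =
          (w a * (1 + a\<^sup>2)) * (w c * (1 + c\<^sup>2)) * (w b * (1 + b\<^sup>2)) * norm (F x)"
        by (simp only: mult_ac)
      ultimately show ?thesis by (simp only: mult_1)
    qed
    ultimately show ?thesis by (simp only: x_def mult.commute[of _ C])
  qed
  have "integrable (lborel \<Otimes>\<^sub>M lborel) (\<lambda>z. w (fst z) * w (snd z))"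
    by (intro integrable_mult_pair lborel.sigma_finite_measure_axioms w)
  then have "integrable lborel (\<lambda>z. w (fst z) * w (snd z))" by (simp add: lborel_prod)
  from integrable_mult_pair[OF lborel.sigma_finite_measure_axioms lborel.sigma_finite_measure_axioms this w]
  have "integrable lborel (\<lambda>z::(real \<times> real) \<times> real. C * (w (fst (fst z)) * w (snd (fst z)) * w (snd z)))"
    by (simp add: lborel_prod)
  then show ?thesis
  proof (rule Bochner_Integration.integrable_bound)
    show "(\<lambda>z::(real \<times> real) \<times> real. ?F z) \<in> borel_measurable lborel"
      unfolding lborel_prod[symmetric] by measurable
    have "norm (?F z) \<le> norm (C * (w (fst (fst z)) * w (snd (fst z)) * w (snd z)))" for z
      using bound[of "fst (fst z)" "snd z" "snd (fst z)"] by (rule order.trans) (simp only: real_norm_def abs_ge_self)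
    then show "AE z in lborel. norm (?F z) \<le> norm (C * (w (fst (fst z)) * w (snd (fst z)) * w (snd z)))"
      by simp
  qed
qed

lemma fourier_eq_echar: "fourier F \<zeta> = (LINT x|lborel. F x * echar (x \<bullet> \<zeta>))"
  by (simp add: fourier_def echar_eq_exp mult.commute)

lemma borel_measurable_fourier [measurable]:
  assumes [measurable]: "F \<in> borel_measurable borel"
  shows "fourier F \<in> borel_measurable borel"
  unfolding fourier_eq_echar[abs_def] by measurable

lemma fourier_vector_3:
  fixes F :: "real^3 \<Rightarrow> complex"
  assumes [measurable]: "F \<in> borel_measurable borel"
  shows "fourier F (vector [u, v, w]) =
    (LINT z|lborel. F (vector [fst (fst z), snd z, snd (fst z)]) * echar (fst (fst z) * u + snd (fst z) * w + snd z * v))"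
proof -
  have "fourier F (vector [u, v, w]) =
      (LINT z|((lborel \<Otimes>\<^sub>M lborel) \<Otimes>\<^sub>M lborel). F (vector [fst (fst z), snd z, snd (fst z)]) * echar (vector [fst (fst z), snd z, snd (fst z)] \<bullet> (vector [u, v, w] :: real^3)))"
    unfolding fourier_eq_echar by (subst lborel_eq_distr_vector_3) (simp add: integral_distr)
  also have "\<dots> = (LINT z|lborel. F (vector [fst (fst z), snd z, snd (fst z)]) * echar (fst (fst z) * u + snd (fst z) * w + snd z * v))"
    by (simp add: lborel_prod inner_vec_def sum_3 add_ac)
  finally show ?thesis .
qed

section \<open>The restriction estimate for the cone\<close>

definition cone_const :: "real \<Rightarrow> real" where
  "cone_const P = 2 * (extension_const P powr (1 / 3) * pitt_const P)"

lemma cone_const_pos: "4 < P \<Longrightarrow> 0 < cone_const P"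
  using extension_const_pos[of P] pitt_const_pos[of P] by (simp add: cone_const_def)

lemma (in cone_generator) cone_restriction:
  fixes F :: "real^3 \<Rightarrow> complex"
  assumes P: "4 < P" and F: "schwartz F" and V: "0 < V"
    and F_le: "(\<integral>\<^sup>+x. ennreal (norm (F x) powr (P / (P - 1))) \<partial>lborel) \<le> ennreal V"
  shows "(\<integral>\<^sup>+\<xi>. ennreal (norm (fourier F (cone_point \<phi> \<xi>)) powr (P / 3)) \<partial>cone_measure \<phi>)
    \<le> ennreal (cone_const P * V powr ((P - 1) / 3))"
proof -
  have [measurable]: "F \<in> borel_measurable borel"
    by (intro borel_measurable_continuous_onI schwartz_continuous F)
  define F' where "F' z = F (vector [fst (fst z), snd z, snd (fst z)])" for z :: "(real \<times> real) \<times> real"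
  define f where "f \<xi> = ennreal (weight \<phi> \<xi> powr (1 / 3) / \<phi> \<xi>) * ennreal (norm (fourier F (cone_point \<phi> \<xi>)) powr (P / 3))" for \<xi>
  have [measurable]: "f \<in> borel_measurable borel" unfolding f_def by measurable
  have F'_int: "integrable lborel F'"
    unfolding F'_def[abs_def] by (rule schwartz_integrable[OF F])
  have F'_le: "(\<integral>\<^sup>+z. ennreal (norm (F' z) powr (P / (P - 1))) \<partial>lborel) \<le> ennreal V"
  proof -
    have "(\<integral>\<^sup>+x. ennreal (norm (F x) powr (P / (P - 1))) \<partial>lborel) =
        (\<integral>\<^sup>+z. ennreal (norm (F' z) powr (P / (P - 1))) \<partial>((lborel \<Otimes>\<^sub>M lborel) \<Otimes>\<^sub>M lborel))"
      by (subst lborel_eq_distr_vector_3) (simp add: nn_integral_distr F'_def)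
    then show ?thesis using F_le by (simp add: lborel_prod)
  qed
  have sector_le: "(\<integral>\<^sup>+l. (\<integral>\<^sup>+x. ennreal l * f (vector [l * x, \<epsilon> * l]) \<partial>lborel) * indicator {0<..} l \<partial>lborel)
      \<le> ennreal (extension_const P powr (1 / 3) * pitt_const P * V powr ((P - 1) / 3))" if \<epsilon>: "\<bar>\<epsilon>\<bar> = 1" for \<epsilon>
  proof -
    interpret convex_curve "slice \<epsilon>" "slice' \<epsilon>" "slice'' \<epsilon>"
      by (rule convex_curve_slice[OF \<epsilon>])
  let ?F = "\<lambda>l x. (LINT z|lborel. F' z * echar (fst (fst z) * (l * x) + snd (fst z) * (l * slice \<epsilon> x) + snd z * (\<epsilon> * l)))"
    have "ennreal l * f (vector [l * x, \<epsilon> * l]) =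
        ennreal (norm (?F l x) powr (P / 3)
          * slice'' \<epsilon> x powr (1 / 3))" if l: "0 < l" for l x
    proof -
      have "fourier F (cone_point \<phi> (vector [l * x, \<epsilon> * l])) =
          (?F l x)"
        by (simp add: cone_point_def \<phi>_sector[OF l] fourier_vector_3 F'_def)
      then show ?thesis
        using l unfolding f_def cone_density_sector[OF \<epsilon> l] by (simp add: ennreal_mult'[symmetric])
    qed
    then have "(\<integral>\<^sup>+l. (\<integral>\<^sup>+x. ennreal l * f (vector [l * x, \<epsilon> * l]) \<partial>lborel) * indicator {0<..} l \<partial>lborel) =
        (\<integral>\<^sup>+l. (\<integral>\<^sup>+x. ennreal (norm (?F l x) powr (P / 3)
          * slice'' \<epsilon> x powr (1 / 3)) \<partial>lborel) * indicator {0<..} l \<partial>lborel)"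
      by (intro nn_integral_cong) (simp split: split_indicator)
    also have "\<dots> \<le> ennreal (extension_const P powr (1 / 3) * pitt_const P * V powr ((P - 1) / 3))"
      by (rule cone_restriction_le[OF P \<epsilon> F'_int V F'_le])
    finally show ?thesis .
  qed
  have "(\<integral>\<^sup>+\<xi>. ennreal (norm (fourier F (cone_point \<phi> \<xi>)) powr (P / 3)) \<partial>cone_measure \<phi>) = (\<integral>\<^sup>+\<xi>. f \<xi> \<partial>lborel)"
    unfolding cone_measure_def f_def by (intro nn_integral_density) measurable
  also have "\<dots> = (\<Sum>\<epsilon>\<in>{1, -1::real}. \<integral>\<^sup>+l. (\<integral>\<^sup>+x. ennreal l * f (vector [l * x, \<epsilon> * l]) \<partial>lborel) * indicator {0<..} l \<partial>lborel)"
    by (rule nn_integral_real_2_sectors) measurable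
  \<comment> \<open>Both half-planes obey the same bound, which is the origin of the factor 2 in
    \<open>cone_const\<close>.\<close>
  also have "\<dots> \<le> (\<Sum>\<epsilon>\<in>{1, -1::real}. ennreal (extension_const P powr (1 / 3) * pitt_const P * V powr ((P - 1) / 3)))"
    by (intro sum_mono sector_le) auto
  also have "\<dots> = ennreal (cone_const P * V powr ((P - 1) / 3))"
    using pitt_const_pos[OF P] by (simp add: cone_const_def mult.assoc ennreal_mult' flip: mult_2)
  finally show ?thesis .
qed

lemma Lq_norm_ennreal:
  assumes "0 < q" and "(\<integral>\<^sup>+x. ennreal (norm (f x) powr q) \<partial>M) = ennreal I" and "0 \<le> I"
  shows "Lq_norm (ennreal q) M f = ennreal (I powr (1 / q))"
  using assms by (simp add: Lq_norm_def Let_def)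

lemma (in cone_generator) cone_restriction_Lq:
  fixes F :: "real^3 \<Rightarrow> complex"
  assumes P: "4 < P" and F: "schwartz F"
  shows "Lq_norm (ennreal (P / 3)) (cone_measure \<phi>) (\<lambda>\<xi>. fourier F (cone_point \<phi> \<xi>))
    \<le> ennreal (cone_const P powr (3 / P)) * Lq_norm (ennreal (P / (P - 1))) lborel F"
proof -
  have p: "0 < P / (P - 1)" "0 < P / 3" using P by auto
  have A: "0 < cone_const P powr (3 / P)" using cone_const_pos[OF P] by simp
  have [measurable]: "F \<in> borel_measurable borel"
    by (intro borel_measurable_continuous_onI schwartz_continuous F)
  define J where "J = (\<integral>\<^sup>+x. ennreal (norm (F x) powr (P / (P - 1))) \<partial>lborel)"
  show ?thesis
  proof (cases "J = \<infinity>")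
    case True
    then have "Lq_norm (ennreal (P / (P - 1))) lborel F = \<infinity>"
      using p by (simp add: Lq_norm_def J_def)
    then show ?thesis using A by (simp add: ennreal_mult_top)
  next
    case False
    then obtain V where V: "J = ennreal V" "0 \<le> V" by (cases J) auto
    define I where "I = (\<integral>\<^sup>+\<xi>. ennreal (norm (fourier F (cone_point \<phi> \<xi>)) powr (P / 3)) \<partial>cone_measure \<phi>)"
    have I: "I \<le> ennreal (cone_const P * V powr ((P - 1) / 3))"
    \<comment> \<open>\<open>cone_restriction\<close> is stated for a positive bound. If the norm is
      0, then \<open>F\<close> vanishes almost everywhere and its Fourier transform vanishes
      identically.\<close>
    proof (cases "V = 0")
      case True
      then have "(\<integral>\<^sup>+x. ennreal (norm (F x) powr (P / (P - 1))) \<partial>lborel) = 0" using V by (simp add: J_def)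
      then have "AE x in lborel. ennreal (norm (F x) powr (P / (P - 1))) = 0"
        by (subst (asm) nn_integral_0_iff_AE) auto
      then have "AE x in lborel. F x * echar (x \<bullet> \<zeta>) = 0" for \<zeta>
        by (rule eventually_mono) simp
      then have "fourier F \<zeta> = 0" for \<zeta>
        unfolding fourier_eq_echar by (rule integral_eq_zero_AE)
      then show ?thesis by (simp add: I_def)
    next
      case False
      then show ?thesis
        unfolding I_def using V by (intro cone_restriction P F) (auto simp: J_def)
    qed
    then have "I \<noteq> \<infinity>" by (auto simp: top_unique)
    then obtain W where W: "I = ennreal W" "0 \<le> W" by (cases I) auto
    have "W \<le> cone_const P * V powr ((P - 1) / 3)"
      using I W cone_const_pos[OF P] by simp
    then have "W powr (1 / (P / 3)) \<le> (cone_const P * V powr ((P - 1) / 3)) powr (1 / (P / 3))"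
      using W P by (intro powr_mono2) auto
    also have "\<dots> = cone_const P powr (3 / P) * V powr (1 / (P / (P - 1)))"
    proof -
      have "(P - 1) / 3 * (3 / P) = 1 / (P / (P - 1))" using P by (simp add: field_simps)
      then show ?thesis using cone_const_pos[OF P] by (simp add: powr_mult powr_powr)
    qed
    finally have "W powr (1 / (P / 3)) \<le> cone_const P powr (3 / P) * V powr (1 / (P / (P - 1)))" .
    moreover have "Lq_norm (ennreal (P / 3)) (cone_measure \<phi>) (\<lambda>\<xi>. fourier F (cone_point \<phi> \<xi>)) = ennreal (W powr (1 / (P / 3)))"
      using p W by (intro Lq_norm_ennreal) (auto simp: I_def)
    moreover have "Lq_norm (ennreal (P / (P - 1))) lborel F = ennreal (V powr (1 / (P / (P - 1))))"
      using p V by (intro Lq_norm_ennreal) (auto simp: J_def)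
    ultimately show ?thesis
      by (simp only: ennreal_mult'[symmetric] powr_ge_zero ennreal_leI)
  qed
qed

text \<open>The endpoint p = 1, where q is infinite: the Fourier transform is bounded at every point
  by the \<open>L^1\<close> norm, so the essential supremum over any measure is too, with constant
  1.\<close>

lemma (in cone_generator) cone_restriction_L1:
  fixes F :: "real^3 \<Rightarrow> complex"
  assumes F: "schwartz F"
  shows "Lq_norm \<infinity> (cone_measure \<phi>) (\<lambda>\<xi>. fourier F (cone_point \<phi> \<xi>)) \<le> Lq_norm 1 lborel F"
proof -
  have [measurable]: "F \<in> borel_measurable borel"
    by (intro borel_measurable_continuous_onI schwartz_continuous F)
  have le: "ennreal (norm (fourier F \<zeta>)) \<le> Lq_norm 1 lborel F" for \<zeta>
  proof -
    have "ennreal (norm (fourier F \<zeta>)) \<le> (\<integral>\<^sup>+x. ennreal (norm (F x * echar (x \<bullet> \<zeta>))) \<partial>lborel)"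
      unfolding fourier_eq_echar by (rule norm_integral_le_nn_integral)
    also have "\<dots> = (\<integral>\<^sup>+x. ennreal (norm (F x)) \<partial>lborel)"
      by (simp add: norm_mult)
    also have "\<dots> = Lq_norm 1 lborel F"
      by (cases "(\<integral>\<^sup>+x. ennreal (norm (F x)) \<partial>lborel)") (auto simp: Lq_norm_def Let_def)
    finally show ?thesis .
  qed
  have "(\<lambda>\<xi>. ennreal (norm (fourier F (cone_point \<phi> \<xi>)))) \<in> borel_measurable (cone_measure \<phi>)"
    unfolding cone_measure_def by measurable
  then have "esssup (cone_measure \<phi>) (\<lambda>\<xi>. ennreal (norm (fourier F (cone_point \<phi> \<xi>)))) \<le> Lq_norm 1 lborel F"
    by (rule esssup_I) (simp add: le)
  then show ?thesis
    by (subst Lq_norm_def) simp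
qed

theorem proposition1:
  fixes p :: real
  assumes "1 \<le> p" and "p < 4/3"
  shows "\<exists>A::real. A > 0 \<and>
    (\<forall>(\<Omega> :: (real^2) set) (\<phi> :: real^2 \<Rightarrow> real).
       admissible_domain \<Omega> \<longrightarrow> homogeneous_generator (frontier \<Omega>) \<phi> \<longrightarrow>
       (\<forall>F :: real^3 \<Rightarrow> complex. schwartz F \<longrightarrow>
          Lq_norm (conjugate_exponent (ennreal p) / 3) (cone_measure \<phi>)
            (\<lambda>\<xi>. fourier F (cone_point \<phi> \<xi>))
          \<le> ennreal A * Lq_norm (ennreal p) lborel F))"
proof (cases "p = 1")
  case True
  have q: "conjugate_exponent (ennreal p) / 3 = \<infinity>"
    using True by (simp add: conjugate_exponent_one ennreal_top_divide)
  show ?thesis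
    unfolding q
  proof (intro exI[of _ 1] conjI allI impI)
    fix \<Omega> :: "(real^2) set" and \<phi> :: "real^2 \<Rightarrow> real" and F :: "real^3 \<Rightarrow> complex"
    assume "admissible_domain \<Omega>" "homogeneous_generator (frontier \<Omega>) \<phi>" and F: "schwartz F"
    then interpret cone_generator \<Omega> \<phi> by unfold_locales
    show "Lq_norm \<infinity> (cone_measure \<phi>) (\<lambda>\<xi>. fourier F (cone_point \<phi> \<xi>)) \<le> ennreal 1 * Lq_norm (ennreal p) lborel F"
      using cone_restriction_L1[OF F] True by simp
  qed simp
next
  case False
  \<comment> \<open>The conjugate exponent of p: the hypothesis p < 4/3 becomes P > 4, and
    conjugating back gives \<open>P / (P - 1) = p\<close>.\<close>
  define P where "P = p / (p - 1)"
  have p: "1 < p" using False assms by simp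
  then have P: "4 < P" "P / (P - 1) = p" using assms by (auto simp: P_def field_simps)
  have q: "conjugate_exponent (ennreal p) / 3 = ennreal (P / 3)"
    using P(1) by (simp add: conjugate_exponent_real[OF p] P_def[symmetric] divide_ennreal flip: ennreal_numeral)
  show ?thesis
    unfolding q
    using cone_generator.cone_restriction_Lq[OF cone_generator.intro P(1)] cone_const_pos[OF P(1)]
    by (intro exI[of _ "cone_const P powr (3 / P)"]) (auto simp: P(2))
qed

end
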